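(* Let $L\ge1$ and $N=2L$. On the alternating antiperiodic $g\ell(1|1)$ spin chain $\mathcal{H}_N$, the centralizer in $\mathrm{End}_{\mathbb C}(\mathcal{H}_N)$ of the image of the representation of the algebra $JTL^{tw}_N$ is the associative algebra $\rho_{g\ell}(Us\ell(2))$, i.e. the image of the universal enveloping algebra of $s\ell(2)$ generated by $\mathsf e$, $\mathsf f$ and $\mathsf h$.
   Context: All algebras are associative unital algebras over $\mathbb{C}$. Let $N=2L$ and $\mathfrak q=i$. Spin chain. $\mathcal{H}_{N}=(\mathbb{C}^2)^{\otimes N}$ is the $2^N$-dimensional Fock space (irreducible Clifford module) of fermions $c_j,c_j^\dagger$, $1\le j\le N$, with $\{c_j,c_{j'}\}=\{c_j^\dagger,c_{j'}^\dagger\}=0$, $\{c_j,c_{j'}^\dagger\}=\delta_{jj'}$. Set $f_j=i^jc_j$ and $f_j^\dagger=i^jc_j^\dagger$, so that $\{f_j,f_{j'}\}=\{f_j^\dagger,f_{j'}^\dagger\}=0$ and $\{f_j,f_{j'}^\dagger\}=(-1)^j\delta_{jj'}$. Image of $JTL_N^{tw}$ in the antiperiodic model ($f_{N+1}=-f_1$, $f^\dagger_{N+1}=-f^\dagger_1$). It is the subalgebra of $\mathrm{End}_{\mathbb C}(\mathcal{H}_N)$ generated by the identity, the operators $$e_j=(f_j+f_{j+1})(f_j^\dagger+f_{j+1}^\dagger),\ 1\le j\le N-1,\qquad e_N=(f_N-f_1)(f_N^\dagger-f_1^\dagger),$$ and the translations $u^{\pm2}$, where $u^2$ is the invertible operator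 (determined up to a nonzero scalar, irrelevant for the centralizer) acting by conjugation as $u^2f_ju^{-2}=f_{j+2}$, $u^2f_j^\dagger u^{-2}=f_{j+2}^\dagger$ for $j\le N-2$, and $u^2f_ju^{-2}=-f_{j+2-N}$, $u^2f^\dagger_ju^{-2}=-f^\dagger_{j+2-N}$ for $j=N-1,N$. The $s\ell(2)$ action. $\rho_{g\ell}(Us\ell(2))$ is the subalgebra of $\mathrm{End}_{\mathbb C}(\mathcal{H}_N)$ generated by the operators $$\mathsf e=\sum_{1\le j_1<j_2\le N}(-1)^{j_1+j_2}\mathfrak q^{1-j_1-j_2}c_{j_1}^\dagger c_{j_2}^\dagger,\qquad \mathsf f=\sum_{1\le j_1<j_2\le N}\mathfrak q^{j_1+j_2-1}c_{j_1}c_{j_2},\qquad 2\mathsf h=\sum_{j=1}^N c_j^\dagger c_j-L,$$ which satisfy $[\mathsf h,\mathsf e]=\mathsf e$, $[\mathsf h,\mathsf f]=-\mathsf f$, $[\mathsf e,\mathsf f]=2\mathsf h$. *)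

theory Defs
  imports Complex_Main "Jordan_Normal_Form.Matrix"
begin

text \<open>
  The space $(\mathbb{C}^2)^{\otimes N}$ is realised as $\mathbb{C}^{2^N}$: the basis vector with
  index \<open>s < 2 ^ N\<close> is the occupation state in which site \<open>j\<close> (for \<open>1 \<le> j \<le> N\<close>) is filled iff bit
  \<open>j - 1\<close> of \<open>s\<close> is set. Its endomorphism algebra is \<open>carrier_mat (2 ^ N) (2 ^ N)\<close> over \<open>complex\<close>.
\<close>

text \<open>
  Jordan--Wigner form of the annihilation operator at site \<open>j\<close>. The entries are real, so its
  adjoint, the creation operator, is the transpose.
\<close>

definition ann :: "nat \<Rightarrow> nat \<Rightarrow> complex mat" where
  "ann N j = mat (2 ^ N) (2 ^ N) (\<lambda>(r, s).
     if bit s (j - 1) \<and> r = unset_bit (j - 1) s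
     then (- 1) ^ card {k. k < j - 1 \<and> bit s k} else 0)"

definition cre :: "nat \<Rightarrow> nat \<Rightarrow> complex mat" where
  "cre N j = transpose_mat (ann N j)"

definition f_op :: "nat \<Rightarrow> nat \<Rightarrow> complex mat" where
  "f_op N j = \<i> ^ j \<cdot>\<^sub>m ann N j"

text \<open>This is not the adjoint of \<^term>\<open>f_op N j\<close>: the phase \<open>\<i> ^ j\<close> is not conjugated.\<close>

definition fd_op :: "nat \<Rightarrow> nat \<Rightarrow> complex mat" where
  "fd_op N j = \<i> ^ j \<cdot>\<^sub>m cre N j"

text \<open>The last generator uses \<open>f\<^bsub>N+1\<^esub> = - f\<^sub>1\<close> and likewise for the daggered operators.\<close>

definition TL_e :: "nat \<Rightarrow> nat \<Rightarrow> complex mat" where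
  "TL_e N j =
     (if j < N then (f_op N j + f_op N (j + 1)) * (fd_op N j + fd_op N (j + 1))
      else (f_op N N - f_op N 1) * (fd_op N N - fd_op N 1))"

text \<open>
  \<open>U\<close> with inverse \<open>V\<close> implements the antiperiodic translation by two sites. The conjugation rules
  fix \<open>U\<close> up to a nonzero scalar.
\<close>

definition is_translation2 :: "nat \<Rightarrow> complex mat \<Rightarrow> complex mat \<Rightarrow> bool" where
  "is_translation2 N U V \<longleftrightarrow>
     U \<in> carrier_mat (2 ^ N) (2 ^ N) \<and> V \<in> carrier_mat (2 ^ N) (2 ^ N) \<and>
     inverts_mat U V \<and> inverts_mat V U \<and>
     (\<forall>j. 1 \<le> j \<and> j + 2 \<le> N \<longrightarrow>
        U * f_op N j * V = f_op N (j + 2) \<and> U * fd_op N j * V = fd_op N (j + 2)) \<and>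
     (\<forall>j. 1 \<le> j \<and> j \<le> N \<and> N < j + 2 \<longrightarrow>
        U * f_op N j * V = - f_op N (j + 2 - N) \<and> U * fd_op N j * V = - fd_op N (j + 2 - N))"

text \<open>The unital complex subalgebra of the \<open>n \<times> n\<close> matrices generated by \<open>G\<close>.\<close>

inductive_set generated_algebra :: "nat \<Rightarrow> complex mat set \<Rightarrow> complex mat set"
  for n :: nat and G :: "complex mat set" where
  one: "1\<^sub>m n \<in> generated_algebra n G"
| gen: "A \<in> G \<Longrightarrow> A \<in> generated_algebra n G"
| add: "A \<in> generated_algebra n G \<Longrightarrow> B \<in> generated_algebra n G \<Longrightarrow> A + B \<in> generated_algebra n G"
| smult: "A \<in> generated_algebra n G \<Longrightarrow> a \<cdot>\<^sub>m A \<in> generated_algebra n G"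
| mult: "A \<in> generated_algebra n G \<Longrightarrow> B \<in> generated_algebra n G \<Longrightarrow> A * B \<in> generated_algebra n G"

definition centralizer_mat :: "nat \<Rightarrow> complex mat set \<Rightarrow> complex mat set" where
  "centralizer_mat n S = {X \<in> carrier_mat n n. \<forall>A\<in>S. X * A = A * X}"

definition JTL_image :: "nat \<Rightarrow> complex mat \<Rightarrow> complex mat \<Rightarrow> complex mat set" where
  "JTL_image N U V = generated_algebra (2 ^ N) (TL_e N ` {1..N} \<union> {U, V})"

definition sum_mats :: "nat \<Rightarrow> ('k \<Rightarrow> complex mat) \<Rightarrow> 'k set \<Rightarrow> complex mat" where
  "sum_mats n F K = mat n n (\<lambda>ij. \<Sum>k\<in>K. F k $$ ij)"

definition ordered_pairs :: "nat \<Rightarrow> (nat \<times> nat) set" where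
  "ordered_pairs N = {(j1, j2). 1 \<le> j1 \<and> j1 < j2 \<and> j2 \<le> N}"

abbreviation qq :: complex where "qq \<equiv> \<i>"

definition sl2_e :: "nat \<Rightarrow> complex mat" where
  "sl2_e N = sum_mats (2 ^ N)
     (\<lambda>(j1, j2). ((- 1) ^ (j1 + j2) * qq powi (1 - int j1 - int j2)) \<cdot>\<^sub>m (cre N j1 * cre N j2))
     (ordered_pairs N)"

definition sl2_f :: "nat \<Rightarrow> complex mat" where
  "sl2_f N = sum_mats (2 ^ N)
     (\<lambda>(j1, j2). (qq powi (int j1 + int j2 - 1)) \<cdot>\<^sub>m (ann N j1 * ann N j2))
     (ordered_pairs N)"

text \<open>For \<open>N = 2 * L\<close> the subtracted constant \<open>L\<close> is \<open>N / 2\<close>.\<close>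

definition sl2_h :: "nat \<Rightarrow> complex mat" where
  "sl2_h N = (1 / 2) \<cdot>\<^sub>m
     (sum_mats (2 ^ N) (\<lambda>j. cre N j * ann N j) {1..N} - (of_nat N / 2) \<cdot>\<^sub>m 1\<^sub>m (2 ^ N))"

definition rho_gl :: "nat \<Rightarrow> complex mat set" where
  "rho_gl N = generated_algebra (2 ^ N) {sl2_e N, sl2_f N, sl2_h N}"

end

theory Submission
  imports Defs "HOL-Library.Function_Algebras" "HOL-Combinatorics.Permutations"
begin

text \<open>
  With \<open>v\<^sub>j = f\<^sub>j\<^sup>\<dagger> + f\<^bsub>j+1\<^esub>\<^sup>\<dagger>\<close>, each \<open>e\<^sub>j\<close> is, up to sign, the square of \<open>v\<^sub>j\<close> in \<open>S\<^sup>2V = sp(2L)\<close>,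
  for a symplectic form on \<open>V = span(f\<^sub>j\<^sup>\<dagger>)\<close> whose inverse is \<open>sl2_e\<close>; the form couples only neighbouring
  \<open>v\<^sub>j\<close>, so commutators of the \<open>e\<^sub>j\<close> yield all of \<open>sp(2L)\<close>. In a symplectic basis \<open>p\<^sub>i, q\<^sub>i\<close> of \<open>V\<close>
  the raising operator is the sum of the pair creators \<open>d\<^sub>i = p\<^sub>iq\<^sub>i\<close>. An operator \<open>X\<close> commuting
  with \<open>sp(2L)\<close> is determined by its values on the products of pair creators applied to the vacuum
  and to \<open>p\<^sub>0\<close> times the vacuum, because \<open>sp(2L)\<close> breaks pairs. It maps the span of such vectors
  \<open>d\<^sub>M\<close> to itself, and its matrix there is invariant under permutations of the sites, hence a
  function of \<open>card M\<close>, \<open>card N\<close>, \<open>card (M \<inter> N)\<close>. Between fixed cardinalities, \<open>e\<^sup>af\<^sup>b\<close> has the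
  matrix entries \<open>a! b! (card (M \<inter> N) choose (card M - b))\<close>, and binomial coefficients span all functions of
  \<open>card (M \<inter> N)\<close>; so \<open>X\<close> agrees with an element of the algebra of \<open>sl(2)\<close>.
\<close>

section \<open>Paired fermionic modes\<close>

text \<open>This is skew Howe duality for Sp(2L) and sl(2) on the exterior algebra of V, proved
  without double commutants or complete reducibility: the element of the sl(2) algebra is
  constructed. In the code \<open>p\<^sub>i\<close> is \<open>cr True i\<close> and
  \<open>q\<^sub>i\<close> is \<open>cr False i\<close>. The vacuum and \<open>p\<^sub>0\<close>
  times the vacuum account for the two parities of the fermion number, which sp(2L) cannot change.
  The permutation symmetry comes from the symplectic algebra itself: on products of pair creators,
  \<open>tQ a b\<close> after \<open>tP a b\<close> is the identity minus the transposition of a and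
  b. The elements found for different numbers of pairs are glued by polynomials in the number
  operator, whose eigenvalue determines both the parity and the number of pairs. The antiperiodic
  sign is decisive: in the periodic chain the alternating sum of the \<open>v\<^sub>j\<close>
  vanishes, so they do not span V and their squares cannot generate sp(2L).\<close>

locale fock_pairs = vector_space scale
  for scale :: "complex \<Rightarrow> 'v::ab_group_add \<Rightarrow> 'v" (infixr "*s" 75) +
  fixes L :: nat and cr an :: "bool \<Rightarrow> nat \<Rightarrow> 'v \<Rightarrow> 'v" and num :: "'v \<Rightarrow> 'v"
    and vac :: 'v and ev :: "'v \<Rightarrow> complex"
  assumes L_pos: "0 < L"
    and hom_cr: "\<And>b i. module_hom scale scale (cr b i)"
    and hom_an: "\<And>b i. module_hom scale scale (an b i)"
    and hom_num: "module_hom scale scale num"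
    and cr_cr: "\<And>b c i j v. i < L \<Longrightarrow> j < L \<Longrightarrow> cr b i (cr c j v) = - cr c j (cr b i v)"
    and an_an: "\<And>b c i j v. i < L \<Longrightarrow> j < L \<Longrightarrow> an b i (an c j v) = - an c j (an b i v)"
    and an_cr: "\<And>b c i j v. i < L \<Longrightarrow> j < L \<Longrightarrow>
      an b i (cr c j v) = (if b = c \<and> i = j then v else 0) - cr c j (an b i v)"
    and an_vac: "\<And>b i. i < L \<Longrightarrow> an b i vac = 0"
    and num_cr: "\<And>b i v. i < L \<Longrightarrow> num (cr b i v) = cr b i v + cr b i (num v)"
    and num_an: "\<And>b i v. i < L \<Longrightarrow> num (an b i v) = an b i (num v) - an b i v"
    and num_vac: "num vac = 0"
    and ev_add: "\<And>u v. ev (u + v) = ev u + ev v"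
    and ev_scale: "\<And>c v. ev (c *s v) = c * ev v"
    and ev_vac: "ev vac = 1"
    and ev_cr: "\<And>b i v. i < L \<Longrightarrow> ev (cr b i v) = 0"
begin

lemmas hom_simps [simp] =
  module_hom.add[OF hom_cr] module_hom.scale[OF hom_cr] module_hom.zero[OF hom_cr]
  module_hom.neg[OF hom_cr] module_hom.diff[OF hom_cr]
  module_hom.add[OF hom_an] module_hom.scale[OF hom_an] module_hom.zero[OF hom_an]
  module_hom.neg[OF hom_an] module_hom.diff[OF hom_an]
  module_hom.add[OF hom_num] module_hom.scale[OF hom_num] module_hom.zero[OF hom_num]
  module_hom.neg[OF hom_num] module_hom.diff[OF hom_num]

lemma eq_neg_self_iff: "(v::'v) = - v \<longleftrightarrow> v = 0"
proof
  assume "v = - v"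
  then have "2 *s v = 0"
    by (metis add.right_inverse one_add_one scale_left_distrib scale_one)
  then show "v = 0" by simp
qed simp

lemma cr_cr_same [simp]: "i < L \<Longrightarrow> cr b i (cr b i v) = 0"
  using cr_cr[of i i b b v] by (simp only: eq_neg_self_iff)

definition d :: "nat \<Rightarrow> 'v \<Rightarrow> 'v" where "d i v = cr True i (cr False i v)"
text \<open>The annihilators stand in the reverse order of the creators in \<open>d\<close>, so that
  \<open>D i\<close> undoes \<open>d i\<close> on an empty site with sign +1
  (\<open>D_d_same\<close>).\<close>

definition D :: "nat \<Rightarrow> 'v \<Rightarrow> 'v" where "D i v = an False i (an True i v)"
definition e :: "'v \<Rightarrow> 'v" where "e v = (\<Sum>i<L. d i v)"
definition f :: "'v \<Rightarrow> 'v" where "f v = (\<Sum>i<L. D i v)"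

lemma hom_d: "module_hom scale scale (d i)"
  by unfold_locales (auto simp: d_def)

lemma hom_D: "module_hom scale scale (D i)"
  by unfold_locales (auto simp: D_def)

lemma hom_e: "module_hom scale scale e"
  by unfold_locales
    (auto simp: e_def module_hom.add[OF hom_d] module_hom.scale[OF hom_d] sum.distrib scale_sum_right)

lemma hom_f: "module_hom scale scale f"
  by unfold_locales
    (auto simp: f_def module_hom.add[OF hom_D] module_hom.scale[OF hom_D] sum.distrib scale_sum_right)

lemma d_cr: "i < L \<Longrightarrow> j < L \<Longrightarrow> d i (cr b j v) = cr b j (d i v)"
  by (simp add: d_def cr_cr[of i j])

lemma d_commute: "i < L \<Longrightarrow> j < L \<Longrightarrow> d i (d j v) = d j (d i v)"
  by (simp add: d_def[of j] d_cr)

lemma d_d [simp]: "i < L \<Longrightarrow> d i (d i v) = 0"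
  by (simp add: d_def cr_cr[of i i False True])

lemma an_d: "i < L \<Longrightarrow> j < L \<Longrightarrow> i \<noteq> j \<Longrightarrow> an b i (d j v) = d j (an b i v)"
  by (simp add: d_def an_cr)

lemma D_d_same: "i < L \<Longrightarrow> (\<And>b. an b i v = 0) \<Longrightarrow> D i (d i v) = v"
  by (simp add: D_def d_def an_cr)

lemma num_d: "i < L \<Longrightarrow> num (d i v) = 2 *s d i v + d i (num v)"
  by (simp add: d_def num_cr scale_left_distrib[of 1 1, simplified])

text \<open>The \<open>d i\<close> commute only for i < L, hence the range conditions on M below;
  the order of the fold is then irrelevant.\<close>

definition om :: "'v \<Rightarrow> nat set \<Rightarrow> 'v" where "om u M = Finite_Set.fold d u M"

lemma om_empty [simp]: "om u {} = u"
  by (simp add: om_def)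

lemma om_insert:
  assumes "insert i M \<subseteq> {..<L}" "i \<notin> M"
  shows "om u (insert i M) = d i (om u M)"
proof -
  interpret comp_fun_commute_on "{..<L}" d
    by standard (auto simp: fun_eq_iff d_commute)
  show ?thesis unfolding om_def using assms by (intro fold_insert) (auto intro: finite_subset)
qed

lemma om_remove:
  assumes "M \<subseteq> {..<L}" "i \<in> M"
  shows "om u M = d i (om u (M - {i}))"
  using om_insert[of i "M - {i}" u] assms by (simp add: insert_absorb)

lemma subset_lt_induct [consumes 1, case_names empty insert]:
  assumes "M \<subseteq> {..<L}" "P {}"
    "\<And>i M. i < L \<Longrightarrow> M \<subseteq> {..<L} \<Longrightarrow> i \<notin> M \<Longrightarrow> P M \<Longrightarrow> P (insert i M)"
  shows "P M"
proof -
  have "finite M" using assms(1) by (rule finite_subset) simp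
  then show ?thesis using assms(1)
    by (induction M) (auto intro: assms)
qed

lemma an_om:
  assumes "M \<subseteq> {..<L}" "i < L" "i \<notin> M"
  shows "an b i (om u M) = om (an b i u) M"
  using assms by (induction M rule: subset_lt_induct) (auto simp: om_insert an_d)

lemma cr_om:
  assumes "M \<subseteq> {..<L}" "i < L"
  shows "cr b i (om u M) = om (cr b i u) M"
  using assms by (induction M rule: subset_lt_induct) (auto simp: om_insert simp flip: d_cr)

lemma om_zero [simp]: "M \<subseteq> {..<L} \<Longrightarrow> om 0 M = 0"
  by (induction M rule: subset_lt_induct) (auto simp: om_insert module_hom.zero[OF hom_d])

lemma num_om:
  assumes "M \<subseteq> {..<L}" "num u = of_nat k *s u"
  shows "num (om u M) = of_nat (k + 2 * card M) *s om u M"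
  using assms
proof (induction M rule: subset_lt_induct)
  case (insert i M)
  then have "finite M" by (auto intro: finite_subset)
  with insert show ?case
    by (simp add: om_insert num_d module_hom.scale[OF hom_d] module_hom.add[OF hom_d] algebra_simps)
qed simp

text \<open>K collects the sites that are empty in \<open>u\<close>. A site outside K must be
  blocked for pairs in both directions: in \<open>p\<^sub>0\<close> times the vacuum, site 0 is
  singly occupied and can neither receive nor lose a pair.\<close>

definition reference :: "'v \<Rightarrow> nat set \<Rightarrow> bool" where
  "reference u K \<longleftrightarrow> K \<subseteq> {..<L} \<and> (\<forall>i\<in>K. \<forall>b. an b i u = 0) \<and>
     (\<forall>i<L. i \<notin> K \<longrightarrow> d i u = 0 \<and> D i u = 0)"

lemma reference_vac: "reference vac {..<L}"
  by (simp add: reference_def an_vac)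

lemma reference_p0: "reference (cr True 0 vac) {1..<L}"
  using L_pos
  by (auto simp: reference_def an_vac an_cr d_def D_def cr_cr[of 0 0 False True] not_le less_Suc_eq)

lemma d_om_outside:
  assumes "reference u K" "M \<subseteq> K" "i < L" "i \<notin> K"
  shows "d i (om u M) = 0"
  using assms cr_om[of M i] unfolding reference_def d_def by (metis om_zero subset_trans)

lemma D_om_outside:
  assumes "reference u K" "M \<subseteq> K" "i < L" "i \<notin> K"
  shows "D i (om u M) = 0"
proof -
  have "M \<subseteq> {..<L}" "i \<notin> M" "D i u = 0" using assms by (auto simp: reference_def)
  then show ?thesis using an_om[of M i] assms(3) by (simp add: D_def)
qed

lemma an_om_zero:
  assumes "reference u K" "M \<subseteq> K" "i \<in> K" "i \<notin> M"
  shows "an b i (om u M) = 0"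
proof -
  have "M \<subseteq> {..<L}" "i < L" "an b i u = 0" using assms by (auto simp: reference_def)
  then show ?thesis using an_om[of M i b u] assms(4) by simp
qed

lemma d_om:
  assumes "reference u K" "M \<subseteq> K" "i < L"
  shows "d i (om u M) = (if i \<in> K - M then om u (insert i M) else 0)"
proof (cases "i \<in> K")
  case True
  have "M \<subseteq> {..<L}" using assms by (auto simp: reference_def)
  then show ?thesis
    using True assms om_insert[of i M u] om_remove[of M i u] by auto
qed (use assms d_om_outside in auto)

lemma D_om:
  assumes "reference u K" "M \<subseteq> K" "i < L"
  shows "D i (om u M) = (if i \<in> M then om u (M - {i}) else 0)"
proof (cases "i \<in> K")
  case True
  have M: "M \<subseteq> {..<L}" using assms by (auto simp: reference_def)
  show ?thesis
  proof (cases "i \<in> M")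
    case in_M: True
    have "\<And>b. an b i (om u (M - {i})) = 0"
      using assms True by (intro an_om_zero[of u K]) auto
    then show ?thesis
      using in_M om_remove[OF M in_M] D_d_same assms(3) by simp
  next
    case False
    then show ?thesis using an_om_zero[OF assms(1,2) True] by (simp add: D_def)
  qed
next
  case False
  then have "i \<notin> M" using assms by auto
  then show ?thesis using D_om_outside[OF assms(1,2,3) False] by simp
qed

lemma e_om:
  assumes "reference u K" "M \<subseteq> K"
  shows "e (om u M) = (\<Sum>i\<in>K - M. om u (insert i M))"
proof -
  have "K \<subseteq> {..<L}" using assms by (auto simp: reference_def)
  then have eq: "{..<L} \<inter> (K - M) = K - M" by auto
  have "e (om u M) = (\<Sum>i<L. if i \<in> K - M then om u (insert i M) else 0)"
    unfolding e_def using d_om[OF assms] by (intro sum.cong) auto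
  also have "\<dots> = (\<Sum>i\<in>{..<L} \<inter> (K - M). om u (insert i M))"
    by (subst sum.inter_restrict) auto
  finally show ?thesis unfolding eq .
qed

lemma f_om:
  assumes "reference u K" "M \<subseteq> K"
  shows "f (om u M) = (\<Sum>i\<in>M. om u (M - {i}))"
proof -
  have "M \<subseteq> {..<L}" using assms by (auto simp: reference_def)
  then have eq: "{..<L} \<inter> M = M" by auto
  have "f (om u M) = (\<Sum>i<L. if i \<in> M then om u (M - {i}) else 0)"
    unfolding f_def using D_om[OF assms] by (intro sum.cong) auto
  also have "\<dots> = (\<Sum>i\<in>{..<L} \<inter> M. om u (M - {i}))"
    by (subst sum.inter_restrict) auto
  finally show ?thesis unfolding eq .
qed

text \<open>The operator counterpart of \<open>rho_gl\<close>. Here \<open>num\<close> takes the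
  place of h, from which it differs by a factor 2 and a multiple of the identity.\<close>

inductive_set Alg :: "('v \<Rightarrow> 'v) set" where
  ident: "(\<lambda>v. v) \<in> Alg"
| e: "e \<in> Alg"
| f: "f \<in> Alg"
| num: "num \<in> Alg"
| add: "A \<in> Alg \<Longrightarrow> B \<in> Alg \<Longrightarrow> (\<lambda>v. A v + B v) \<in> Alg"
| smult: "A \<in> Alg \<Longrightarrow> (\<lambda>v. c *s A v) \<in> Alg"
| comp: "A \<in> Alg \<Longrightarrow> B \<in> Alg \<Longrightarrow> (\<lambda>v. A (B v)) \<in> Alg"

lemma hom_Alg: "A \<in> Alg \<Longrightarrow> module_hom scale scale A"
proof (induction rule: Alg.induct)
  case ident
  then show ?case by unfold_locales auto
next
  case (add A B)
  then show ?case
    by (intro module_hom.intro module_hom_axioms.intro module_axioms)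
      (simp_all add: module_hom.add module_hom.scale scale_right_distrib)
next
  case (smult A c)
  then show ?case
    by (intro module_hom.intro module_hom_axioms.intro module_axioms)
      (simp_all add: module_hom.add module_hom.scale scale_right_distrib mult.commute)
next
  case (comp A B)
  then show ?case
    by (intro module_hom.intro module_hom_axioms.intro module_axioms)
      (simp_all add: module_hom.add module_hom.scale)
qed (auto simp: hom_e hom_f hom_num)

lemma Alg_zero: "(\<lambda>v. 0) \<in> Alg"
  using Alg.smult[OF Alg.ident, of 0] by simp

lemma Alg_sum: "(\<And>i. i \<in> I \<Longrightarrow> A i \<in> Alg) \<Longrightarrow> (\<lambda>v. \<Sum>i\<in>I. A i v) \<in> Alg"
  by (induction I rule: infinite_finite_induct) (auto intro: Alg_zero Alg.add)

end

section \<open>Symmetric kernels and the raising and lowering operators\<close>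

text \<open>The matrix of the binomials \<open>j choose t\<close> is unitriangular.\<close>

lemma binomial_solve:
  fixes \<phi> :: "nat \<Rightarrow> complex"
  shows "\<exists>c. \<forall>j\<le>n. \<phi> j = (\<Sum>t\<le>n. c t * of_nat (j choose t))"
proof (induction n)
  case 0
  then show ?case by (auto intro: exI[of _ \<phi>])
next
  case (Suc n)
  then obtain c where c: "\<And>j. j \<le> n \<Longrightarrow> \<phi> j = (\<Sum>t\<le>n. c t * of_nat (j choose t))" by blast
  \<comment> \<open>The new coefficient affects only j = Suc n, because
    \<open>j choose Suc n\<close> vanishes for smaller j.\<close>
  define c' where "c' = c(Suc n := \<phi> (Suc n) - (\<Sum>t\<le>n. c t * of_nat (Suc n choose t)))"
  have "\<phi> j = (\<Sum>t\<le>Suc n. c' t * of_nat (j choose t))" if "j \<le> Suc n" for j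
  proof (cases "j = Suc n")
    case False
    with that have "j \<le> n" by simp
    then show ?thesis using c[of j] by (simp add: c'_def)
  qed (simp add: c'_def)
  then show ?case by blast
qed

section \<open>Orbits of pairs of subsets under permutations\<close>

lemma card_two_set_cells:
  assumes "finite K" "A \<subseteq> K" "B \<subseteq> K"
  shows "card {x \<in> K. x \<in> A \<and> x \<in> B} = card (A \<inter> B)"
    "card {x \<in> K. x \<in> A \<and> x \<notin> B} = card A - card (A \<inter> B)"
    "card {x \<in> K. x \<notin> A \<and> x \<in> B} = card B - card (A \<inter> B)"
    "card {x \<in> K. x \<notin> A \<and> x \<notin> B} = card K - (card A + card B - card (A \<inter> B))"
proof -
  have fin: "finite A" "finite B" using assms by (auto intro: finite_subset)
  have "card (A - B) = card A - card (A \<inter> B)" "card (B - A) = card B - card (B \<inter> A)"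
    using fin by (auto intro: card_Diff_subset_Int)
  moreover have "card (K - (A \<union> B)) = card K - card (A \<union> B)"
    using assms fin by (intro card_Diff_subset) auto
  moreover have "card (A \<union> B) = card A + card B - card (A \<inter> B)"
    using card_Un_Int[OF fin] by simp
  moreover have "{x \<in> K. x \<in> A \<and> x \<in> B} = A \<inter> B" "{x \<in> K. x \<in> A \<and> x \<notin> B} = A - B"
    "{x \<in> K. x \<notin> A \<and> x \<in> B} = B - A" "{x \<in> K. x \<notin> A \<and> x \<notin> B} = K - (A \<union> B)"
    using assms by auto
  ultimately show "card {x \<in> K. x \<in> A \<and> x \<in> B} = card (A \<inter> B)"
    "card {x \<in> K. x \<in> A \<and> x \<notin> B} = card A - card (A \<inter> B)"
    "card {x \<in> K. x \<notin> A \<and> x \<in> B} = card B - card (A \<inter> B)"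
    "card {x \<in> K. x \<notin> A \<and> x \<notin> B} = card K - (card A + card B - card (A \<inter> B))"
    by (simp_all only: Int_commute)
qed

lemma image_permutes_eq:
  assumes "\<sigma> permutes K" "M \<subseteq> K" "M' \<subseteq> K" "\<And>x. x \<in> K \<Longrightarrow> x \<in> M \<longleftrightarrow> \<sigma> x \<in> M'"
  shows "\<sigma> ` M = M'"
proof
  show "\<sigma> ` M \<subseteq> M'" using assms(2,4) by blast
  show "M' \<subseteq> \<sigma> ` M"
  proof
    fix y assume y: "y \<in> M'"
    then have "y \<in> \<sigma> ` K" using permutes_image[OF assms(1)] assms(3) by blast
    then obtain x where "x \<in> K" "y = \<sigma> x" by blast
    then show "y \<in> \<sigma> ` M" using assms(4) y by blast
  qed
qed

text \<open>Colour each point of K by its cell in the Venn diagram of the two sets. The three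
  cardinalities determine all cell sizes, so the two colourings have the same multiset of colours
  and differ by a permutation.\<close>

lemma ex_permutes_matching_pairs:
  assumes K: "finite K" and sub: "M \<subseteq> K" "N \<subseteq> K" "M' \<subseteq> K" "N' \<subseteq> K"
    and cards: "card M = card M'" "card N = card N'" "card (M \<inter> N) = card (M' \<inter> N')"
  obtains \<sigma> where "\<sigma> permutes K" "\<sigma> ` M = M'" "\<sigma> ` N = N'"
proof -
  define col where "col A B x = (x \<in> A, x \<in> B)" for A B :: "'a set" and x
  have count: "count (image_mset (col A B) (mset_set K)) y = card {x \<in> K. col A B x = y}" for A B y
  proof -
    have "(\<Sum>x\<in>col A B -` {y} \<inter> K. count (mset_set K) x) = (\<Sum>x\<in>col A B -` {y} \<inter> K. 1)"
      using K by (intro sum.cong) auto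
    moreover have "col A B -` {y} \<inter> K = {x \<in> K. col A B x = y}" by auto
    ultimately show ?thesis unfolding count_image_mset using K by simp
  qed
  have "card {x \<in> K. col M N x = y} = card {x \<in> K. col M' N' x = y}" for y
  proof -
    obtain a b where y: "y = (a, b)" by (cases y)
    note eqs = card_two_set_cells[OF K sub(1,2)] card_two_set_cells[OF K sub(3,4)]
    show ?thesis
      unfolding col_def y prod.inject
      by (cases a; cases b) (simp_all only: simp_thms eqs cards)
  qed
  then have "image_mset (col M N) (mset_set K) = image_mset (col M' N') (mset_set K)"
    by (intro multiset_eqI) (simp only: count)
  from image_mset_eq_implies_permutes[OF K this]
  obtain \<sigma> where \<sigma>: "\<sigma> permutes K" "\<forall>x\<in>K. col M N x = col M' N' (\<sigma> x)" by blast
  show thesis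
    using \<sigma>(2) sub
    by (intro that[OF \<sigma>(1)] image_permutes_eq[OF \<sigma>(1)]) (simp_all add: col_def)
qed

context fock_pairs
begin

text \<open>One more application of \<open>f\<close> deletes some i from a set S. A set R of the
  next size arises once for each i in M - R, that is in Suc b ways, and these multiplicities build
  up the factorial.\<close>

lemma lowering_powers:
  assumes "reference u K" "M \<subseteq> K" "card M = t + b"
  shows "(f ^^ b) (om u M) = fact b *s (\<Sum>S | S \<subseteq> M \<and> card S = t. om u S)"
  using assms(3)
proof (induction b arbitrary: t)
  case 0
  have "finite M" using assms by (auto simp: reference_def intro: finite_subset)
  then have "{S. S \<subseteq> M \<and> card S = t} = {M}" using 0 by (auto dest: card_subset_eq)
  then show ?case by simp
next
  case (Suc b)
  have fin: "finite M" using assms by (auto simp: reference_def intro: finite_subset)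
  have IH: "(f ^^ b) (om u M) = fact b *s (\<Sum>S | S \<subseteq> M \<and> card S = Suc t. om u S)"
    using Suc.prems by (intro Suc.IH) simp
  have "f (\<Sum>S | S \<subseteq> M \<and> card S = Suc t. om u S)
      = (\<Sum>S | S \<subseteq> M \<and> card S = Suc t. \<Sum>i\<in>S. om u (S - {i}))"
    unfolding module_hom.sum[OF hom_f] using assms by (intro sum.cong f_om) auto
  also have "\<dots> = (\<Sum>(S, i)\<in>Sigma {S. S \<subseteq> M \<and> card S = Suc t} (\<lambda>S. S). om u (S - {i}))"
    using fin by (intro sum.Sigma) (auto intro: finite_subset)
  also have "\<dots> = (\<Sum>(R, i)\<in>Sigma {R. R \<subseteq> M \<and> card R = t} (\<lambda>R. M - R). om u R)"
    by (rule sum.reindex_bij_witness[of _ "\<lambda>(R, i). (insert i R, i)" "\<lambda>(S, i). (S - {i}, i)"])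
      (use fin in \<open>auto simp: insert_absorb card_insert_if finite_subset\<close>)
  also have "\<dots> = (\<Sum>R | R \<subseteq> M \<and> card R = t. \<Sum>i\<in>M - R. om u R)"
    using fin by (intro sum.Sigma[symmetric]) (auto intro: finite_subset)
  also have "\<dots> = (\<Sum>R | R \<subseteq> M \<and> card R = t. of_nat (Suc b) *s om u R)"
    using fin Suc.prems
    by (intro sum.cong refl) (auto simp: sum_constant_scale card_Diff_subset finite_subset)
  finally have "f (\<Sum>S | S \<subseteq> M \<and> card S = Suc t. om u S)
      = of_nat (Suc b) *s (\<Sum>R | R \<subseteq> M \<and> card R = t. om u R)"
    by (simp only: scale_sum_right)
  then show ?case
    using IH by (simp add: module_hom.scale[OF hom_f] mult.commute del: of_nat_Suc)
qed

text \<open>Mirror image of \<open>lowering_powers\<close>: any element of R - S may be the one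
  added last, which gives Suc a ways to reach R.\<close>

lemma raising_powers:
  assumes "reference u K" "S \<subseteq> K"
  shows "(e ^^ a) (om u S) = fact a *s (\<Sum>M | S \<subseteq> M \<and> M \<subseteq> K \<and> card M = card S + a. om u M)"
proof (induction a)
  case 0
  have "finite K" using assms by (auto simp: reference_def intro: finite_subset)
  then have "M = S" if "S \<subseteq> M" "M \<subseteq> K" "card M = card S" for M
    using that card_subset_eq[of M S] finite_subset[of M K] by auto
  then have "{M. S \<subseteq> M \<and> M \<subseteq> K \<and> card M = card S} = {S}"
    using assms(2) by blast
  then show ?case by simp
next
  case (Suc a)
  have fin: "finite K" using assms by (auto simp: reference_def intro: finite_subset)
  let ?F = "\<lambda>a. {M. S \<subseteq> M \<and> M \<subseteq> K \<and> card M = card S + a}"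
  have "e (\<Sum>M\<in>?F a. om u M) = (\<Sum>M\<in>?F a. \<Sum>i\<in>K - M. om u (insert i M))"
    unfolding module_hom.sum[OF hom_e] using assms by (intro sum.cong e_om) auto
  also have "\<dots> = (\<Sum>(M, i)\<in>Sigma (?F a) (\<lambda>M. K - M). om u (insert i M))"
    using fin by (intro sum.Sigma) (auto intro: finite_subset)
  also have "\<dots> = (\<Sum>(R, i)\<in>Sigma (?F (Suc a)) (\<lambda>R. R - S). om u R)"
    by (rule sum.reindex_bij_witness[of _ "\<lambda>(R, i). (R - {i}, i)" "\<lambda>(M, i). (insert i M, i)"])
      (use fin in \<open>auto simp: insert_absorb card_insert_if finite_subset\<close>)
  also have "\<dots> = (\<Sum>R\<in>?F (Suc a). \<Sum>i\<in>R - S. om u R)"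
    using fin by (intro sum.Sigma[symmetric]) (auto intro: finite_subset)
  also have "\<dots> = (\<Sum>R\<in>?F (Suc a). of_nat (Suc a) *s om u R)"
    using fin assms
    by (intro sum.cong refl) (auto simp: sum_constant_scale card_Diff_subset finite_subset)
  finally have "e (\<Sum>M\<in>?F a. om u M) = of_nat (Suc a) *s (\<Sum>R\<in>?F (Suc a). om u R)"
    by (simp only: scale_sum_right)
  then show ?case
    using Suc by (simp add: module_hom.scale[OF hom_e] mult.commute del: of_nat_Suc)
qed

lemma Alg_funpow: "A \<in> Alg \<Longrightarrow> (A ^^ n) \<in> Alg"
proof (induction n)
  case 0
  then show ?case using Alg.ident by (simp add: id_def)
next
  case (Suc n)
  then show ?case using Alg.comp[of A "A ^^ n"] by (simp add: comp_def)
qed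

text \<open>Lowering takes M to its t-subsets S, and raising takes S to the k'-subsets containing
  it. Thus M' is reached once for every t-subset of \<open>M \<inter> M'\<close>; the prefactor
  cancels the two factorials.\<close>

lemma ex_Alg_binomial_kernel:
  assumes "reference u K" "t \<le> k" "t \<le> k'"
  shows "\<exists>A\<in>Alg. \<forall>M. M \<subseteq> K \<and> card M = k \<longrightarrow>
    A (om u M) = (\<Sum>M' | M' \<subseteq> K \<and> card M' = k'. of_nat (card (M \<inter> M') choose t) *s om u M')"
proof -
  let ?A = "\<lambda>v. (1 / (fact (k' - t) * fact (k - t))) *s (e ^^ (k' - t)) ((f ^^ (k - t)) v)"
  have fin: "finite K" using assms by (auto simp: reference_def intro: finite_subset)
  have hom: "module_hom scale scale (e ^^ n)" for n
    by (intro hom_Alg Alg_funpow Alg.e)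
  have "?A (om u M) = (\<Sum>M' | M' \<subseteq> K \<and> card M' = k'. of_nat (card (M \<inter> M') choose t) *s om u M')"
    if M: "M \<subseteq> K" "card M = k" for M
  proof -
    have "(e ^^ (k' - t)) ((f ^^ (k - t)) (om u M)) =
        fact (k - t) *s (\<Sum>S | S \<subseteq> M \<and> card S = t. (e ^^ (k' - t)) (om u S))"
      using lowering_powers[OF assms(1) M(1), of t "k - t"] M(2) assms(2)
      by (simp add: module_hom.scale[OF hom] module_hom.sum[OF hom])
    also have "(\<Sum>S | S \<subseteq> M \<and> card S = t. (e ^^ (k' - t)) (om u S)) =
        (\<Sum>S | S \<subseteq> M \<and> card S = t. fact (k' - t) *s
           (\<Sum>M' | M' \<subseteq> K \<and> card M' = k'. if S \<subseteq> M' then om u M' else 0))"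
    proof (intro sum.cong refl)
      fix S assume "S \<in> {S. S \<subseteq> M \<and> card S = t}"
      then have S: "S \<subseteq> K" "card S = t" using M by auto
      have "{M'. S \<subseteq> M' \<and> M' \<subseteq> K \<and> card M' = card S + (k' - t)} =
          {M'. M' \<subseteq> K \<and> card M' = k'} \<inter> {M'. S \<subseteq> M'}"
        using S assms by auto
      then show "(e ^^ (k' - t)) (om u S) =
         fact (k' - t) *s (\<Sum>M' | M' \<subseteq> K \<and> card M' = k'. if S \<subseteq> M' then om u M' else 0)"
        unfolding raising_powers[OF assms(1) S(1), of "k' - t"]
        using fin sum.inter_restrict[of "{M'. M' \<subseteq> K \<and> card M' = k'}" "om u" "{M'. S \<subseteq> M'}"]
        by simp
    qed
    also have "\<dots> = fact (k' - t) *s (\<Sum>M' | M' \<subseteq> K \<and> card M' = k'.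
         \<Sum>S | S \<subseteq> M \<and> card S = t. if S \<subseteq> M' then om u M' else 0)"
      unfolding scale_sum_right[symmetric] by (rule arg_cong, rule sum.swap)
    also have "(\<Sum>M' | M' \<subseteq> K \<and> card M' = k'.
         \<Sum>S | S \<subseteq> M \<and> card S = t. if S \<subseteq> M' then om u M' else 0) =
        (\<Sum>M' | M' \<subseteq> K \<and> card M' = k'. of_nat (card (M \<inter> M') choose t) *s om u M')"
    proof (intro sum.cong refl)
      fix M' assume "M' \<in> {M'. M' \<subseteq> K \<and> card M' = k'}"
      have fM: "finite M" using M fin finite_subset by blast
      have "(\<Sum>S | S \<subseteq> M \<and> card S = t. if S \<subseteq> M' then om u M' else 0) =
          (\<Sum>S\<in>{S. S \<subseteq> M \<and> card S = t} \<inter> {S. S \<subseteq> M'}. om u M')"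
        using fM by (subst sum.inter_restrict) auto
      also have "{S. S \<subseteq> M \<and> card S = t} \<inter> {S. S \<subseteq> M'} = {S. S \<subseteq> M \<inter> M' \<and> card S = t}" by auto
      also have "(\<Sum>S\<in>{S. S \<subseteq> M \<inter> M' \<and> card S = t}. om u M')
          = of_nat (card (M \<inter> M') choose t) *s om u M'"
        using fM n_subsets[of "M \<inter> M'" t] by (simp add: sum_constant_scale)
      finally show "(\<Sum>S | S \<subseteq> M \<and> card S = t. if S \<subseteq> M' then om u M' else 0) =
          of_nat (card (M \<inter> M') choose t) *s om u M'" .
    qed
    finally have eq: "(e ^^ (k' - t)) ((f ^^ (k - t)) (om u M)) = (fact (k' - t) * fact (k - t)) *s
        (\<Sum>M' | M' \<subseteq> K \<and> card M' = k'. of_nat (card (M \<inter> M') choose t) *s om u M')"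
      by (simp only: scale_scale mult.commute)
    show ?thesis unfolding eq scale_scale by simp
  qed
  moreover have "?A \<in> Alg"
    by (intro Alg.smult Alg.comp[of "e ^^ (k' - t)" "f ^^ (k - t)"] Alg_funpow Alg.e Alg.f)
  ultimately show ?thesis by (intro bexI[of _ ?A]) auto
qed

lemma ex_Alg_kernel:
  assumes "reference u K"
  shows "\<exists>A\<in>Alg. \<forall>M. M \<subseteq> K \<and> card M = k \<longrightarrow>
    A (om u M) = (\<Sum>M' | M' \<subseteq> K \<and> card M' = k'. \<phi> (card (M \<inter> M')) *s om u M')"
proof -
  have fin: "finite K" using assms by (auto simp: reference_def intro: finite_subset)
  \<comment> \<open>Intersections have at most min k k' elements, and t up to this bound is exactly
    what the exponents k - t and k' - t allow.\<close>
  let ?m = "min k k'"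
  obtain c where c: "\<And>j. j \<le> ?m \<Longrightarrow> \<phi> j = (\<Sum>t\<le>?m. c t * of_nat (j choose t))"
    using binomial_solve[of ?m \<phi>] by blast
  have "\<forall>t\<in>{..?m}. \<exists>A. A \<in> Alg \<and> (\<forall>M. M \<subseteq> K \<and> card M = k \<longrightarrow>
    A (om u M) = (\<Sum>M' | M' \<subseteq> K \<and> card M' = k'. of_nat (card (M \<inter> M') choose t) *s om u M'))"
    using ex_Alg_binomial_kernel[OF assms] by (auto simp: Bex_def)
  from bchoice[OF this] obtain A where "\<forall>t\<in>{..?m}. A t \<in> Alg \<and> (\<forall>M. M \<subseteq> K \<and> card M = k \<longrightarrow>
    A t (om u M) = (\<Sum>M' | M' \<subseteq> K \<and> card M' = k'. of_nat (card (M \<inter> M') choose t) *s om u M'))" ..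
  then have A: "\<And>t. t \<le> ?m \<Longrightarrow> A t \<in> Alg"
    "\<And>t M. t \<le> ?m \<Longrightarrow> M \<subseteq> K \<Longrightarrow> card M = k \<Longrightarrow> A t (om u M) =
       (\<Sum>M' | M' \<subseteq> K \<and> card M' = k'. of_nat (card (M \<inter> M') choose t) *s om u M')"
    by auto
  let ?B = "\<lambda>v. \<Sum>t\<le>?m. c t *s A t v"
  have "?B (om u M) = (\<Sum>M' | M' \<subseteq> K \<and> card M' = k'. \<phi> (card (M \<inter> M')) *s om u M')"
    if M: "M \<subseteq> K" "card M = k" for M
  proof -
    have "?B (om u M) = (\<Sum>t\<le>?m. \<Sum>M' | M' \<subseteq> K \<and> card M' = k'.
        (c t * of_nat (card (M \<inter> M') choose t)) *s om u M')"
      using A(2)[OF _ M] by (simp add: scale_sum_right)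
    also have "\<dots> = (\<Sum>M' | M' \<subseteq> K \<and> card M' = k'.
        (\<Sum>t\<le>?m. c t * of_nat (card (M \<inter> M') choose t)) *s om u M')"
      by (subst sum.swap) (simp add: scale_sum_left)
    also have "\<dots> = (\<Sum>M' | M' \<subseteq> K \<and> card M' = k'. \<phi> (card (M \<inter> M')) *s om u M')"
    proof (intro sum.cong refl)
      fix M' assume M': "M' \<in> {M'. M' \<subseteq> K \<and> card M' = k'}"
      then have "card (M \<inter> M') \<le> ?m"
        using M fin by (auto intro!: card_mono intro: finite_subset)
      then show "(\<Sum>t\<le>?m. c t * of_nat (card (M \<inter> M') choose t)) *s om u M' =
          \<phi> (card (M \<inter> M')) *s om u M'" using c by simp
    qed
    finally show ?thesis .
  qed
  moreover have "?B \<in> Alg" using A(1) by (intro Alg_sum Alg.smult) auto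
  ultimately show ?thesis by (intro bexI[of _ ?B]) auto
qed

text \<open>Lagrange interpolation in \<open>num\<close>: one factor (num - j) / (k - j) for each
  weight j to be killed.\<close>

lemma ex_Alg_weight_projection:
  assumes "finite J" "k \<notin> J"
  shows "\<exists>P\<in>Alg. (\<forall>v. num v = of_nat k *s v \<longrightarrow> P v = v) \<and>
    (\<forall>j\<in>J. \<forall>v. num v = of_nat j *s v \<longrightarrow> P v = 0)"
  using assms
proof (induction J)
  case empty
  show ?case by (intro bexI[of _ "\<lambda>v. v"] Alg.ident) auto
next
  case (insert j J)
  then obtain P where P: "P \<in> Alg" "\<And>v. num v = of_nat k *s v \<Longrightarrow> P v = v"
    "\<And>i v. i \<in> J \<Longrightarrow> num v = of_nat i *s v \<Longrightarrow> P v = 0" by auto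
  let ?Q = "\<lambda>v. (1 / (of_nat k - of_nat j)) *s (num v + (- of_nat j) *s v)"
  have Q: "?Q \<in> Alg" by (intro Alg.smult Alg.add Alg.num Alg.ident)
  have hom: "module_hom scale scale P" by (rule hom_Alg[OF P(1)])
  have Qv: "?Q v = ((of_nat i - of_nat j) / (of_nat k - of_nat j)) *s v"
    if "num v = of_nat i *s v" for i v
  proof -
    have "num v + (- of_nat j) *s v = (of_nat i - of_nat j) *s v"
      unfolding that scale_left_distrib[symmetric] by simp
    then show ?thesis by (simp only: scale_scale) simp
  qed
  have "(\<lambda>v. P (?Q v)) \<in> Alg" by (rule Alg.comp[OF P(1) Q])
  moreover have "P (?Q v) = v" if "num v = of_nat k *s v" for v
    unfolding Qv[OF that] using P(2)[OF that] insert.prems by simp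
  moreover have "P (?Q v) = 0" if "num v = of_nat i *s v" "i \<in> insert j J" for i v
    unfolding Qv[OF that(1)] using P(3)[OF _ that(1)] that(2)
    by (auto simp: module_hom.scale[OF hom] module_hom.zero[OF hom])
  ultimately show ?case by (intro bexI[of _ "\<lambda>v. P (?Q v)"]) auto
qed

end

section \<open>The symplectic commutation relations\<close>

context fock_pairs
begin

text \<open>With annihilators read as derivatives, \<open>tP i k\<close>, \<open>tQ i k\<close> and
  \<open>tM i k\<close> are, up to sign, the elements \<open>p\<^sub>i p\<^sub>k\<close>,
  \<open>q\<^sub>i q\<^sub>k\<close> and \<open>p\<^sub>i q\<^sub>k\<close> of the symmetric square
  of V, acting as derivations of the exterior algebra. Together they span sp(2L).\<close>

definition tP :: "nat \<Rightarrow> nat \<Rightarrow> 'v \<Rightarrow> 'v" where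
  "tP i k v = cr True i (an False k v) + cr True k (an False i v)"
definition tQ :: "nat \<Rightarrow> nat \<Rightarrow> 'v \<Rightarrow> 'v" where
  "tQ i k v = cr False i (an True k v) + cr False k (an True i v)"
definition tM :: "nat \<Rightarrow> nat \<Rightarrow> 'v \<Rightarrow> 'v" where
  "tM i k v = cr True i (an True k v) - cr False k (an False i v)"

definition sp_comm :: "('v \<Rightarrow> 'v) \<Rightarrow> bool" where
  "sp_comm X \<longleftrightarrow> module_hom scale scale X \<and>
     (\<forall>i<L. \<forall>k<L. \<forall>v. X (tP i k v) = tP i k (X v) \<and> X (tQ i k v) = tQ i k (X v) \<and>
        X (tM i k v) = tM i k (X v))"

lemma sp_commD:
  assumes "sp_comm X"
  shows "module_hom scale scale X"
    "i < L \<Longrightarrow> k < L \<Longrightarrow> X (tP i k v) = tP i k (X v)"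
    "i < L \<Longrightarrow> k < L \<Longrightarrow> X (tQ i k v) = tQ i k (X v)"
    "i < L \<Longrightarrow> k < L \<Longrightarrow> X (tM i k v) = tM i k (X v)"
  using assms by (auto simp: sp_comm_def)

lemma hom_tP: "module_hom scale scale (tP i k)"
  and hom_tQ: "module_hom scale scale (tQ i k)"
  and hom_tM: "module_hom scale scale (tM i k)"
  by (unfold_locales; simp add: tP_def tQ_def tM_def scale_right_distrib scale_right_diff_distrib)+

lemma sp_comm_add: "sp_comm X \<Longrightarrow> sp_comm Y \<Longrightarrow> sp_comm (\<lambda>v. X v + Y v)"
  unfolding sp_comm_def
  by (auto intro!: module_hom.intro module_hom_axioms.intro module_axioms
      simp: module_hom.add module_hom.scale module_hom.add[OF hom_tP] module_hom.add[OF hom_tQ]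
        module_hom.add[OF hom_tM] scale_right_distrib)

lemma sp_comm_scale: "sp_comm X \<Longrightarrow> sp_comm (\<lambda>v. c *s X v)"
  unfolding sp_comm_def
  by (auto intro!: module_hom.intro module_hom_axioms.intro module_axioms
      simp: module_hom.add module_hom.scale module_hom.scale[OF hom_tP] module_hom.scale[OF hom_tQ]
        module_hom.scale[OF hom_tM] scale_right_distrib mult.commute)

lemma sp_comm_comp: "sp_comm X \<Longrightarrow> sp_comm Y \<Longrightarrow> sp_comm (\<lambda>v. X (Y v))"
  unfolding sp_comm_def
  by (auto intro!: module_hom.intro module_hom_axioms.intro module_axioms
      simp: module_hom.add module_hom.scale)

lemma sp_comm_diff:
  assumes "sp_comm X" "sp_comm Y"
  shows "sp_comm (\<lambda>v. X v - Y v)"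
  using sp_comm_add[OF assms(1) sp_comm_scale[OF assms(2), of "-1"]] by simp

lemma e_cr: "i < L \<Longrightarrow> e (cr b i v) = cr b i (e v)"
  by (simp add: e_def d_cr module_hom.sum[OF hom_cr])

lemma d_an:
  assumes "i < L" "j < L"
  shows "d j (an True i v) = an True i (d j v) - (if i = j then cr False i v else 0)"
    "d j (an False i v) = an False i (d j v) + (if i = j then cr True i v else 0)"
  using assms by (simp_all add: d_def an_cr)

lemma e_an:
  assumes "i < L"
  shows "e (an True i v) = an True i (e v) - cr False i v"
    "e (an False i v) = an False i (e v) + cr True i v"
  using assms by (simp_all add: e_def d_an module_hom.sum[OF hom_an] sum_subtractf sum.distrib)

lemma D_cr:
  assumes "i < L" "j < L"
  shows "D j (cr True i v) = cr True i (D j v) + (if i = j then an False i v else 0)"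
    "D j (cr False i v) = cr False i (D j v) - (if i = j then an True i v else 0)"
  using assms by (simp_all add: D_def an_cr)

lemma f_cr:
  assumes "i < L"
  shows "f (cr True i v) = cr True i (f v) + an False i v"
    "f (cr False i v) = cr False i (f v) - an True i v"
  using assms by (simp_all add: f_def D_cr module_hom.sum[OF hom_cr] sum_subtractf sum.distrib)

lemma f_an: "i < L \<Longrightarrow> f (an b i v) = an b i (f v)"
  by (simp add: f_def D_def an_an[of _ i] module_hom.sum[OF hom_an])

text \<open>\<open>e\<close> is multiplication by the invariant bivector of the symplectic form: the
  extra creators produced by moving \<open>e\<close> past annihilators cancel in pairs by
  anticommutation.\<close>

lemma sp_comm_e: "sp_comm e"
  unfolding sp_comm_def
proof (intro conjI allI impI hom_e)
  fix i k v assume "i < L" "k < L"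
  then show "e (tP i k v) = tP i k (e v)" "e (tQ i k v) = tQ i k (e v)" "e (tM i k v) = tM i k (e v)"
    using cr_cr[of i k True True v] cr_cr[of i k False False v] cr_cr[of k i False True v]
    by (simp_all add: tP_def tQ_def tM_def module_hom.add[OF hom_e] module_hom.diff[OF hom_e]
      e_cr e_an)
qed

lemma sp_comm_f: "sp_comm f"
  unfolding sp_comm_def
proof (intro conjI allI impI hom_f)
  fix i k v assume "i < L" "k < L"
  then show "f (tP i k v) = tP i k (f v)" "f (tQ i k v) = tQ i k (f v)" "f (tM i k v) = tM i k (f v)"
    using an_an[of i k True True v] an_an[of i k False False v] an_an[of k i True False v]
    by (simp_all add: tP_def tQ_def tM_def module_hom.add[OF hom_f] module_hom.diff[OF hom_f]
      f_cr f_an)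
qed

lemma sp_comm_num: "sp_comm num"
  unfolding sp_comm_def by (auto simp: hom_num tP_def tQ_def tM_def num_cr num_an)

lemma sp_comm_Alg: "A \<in> Alg \<Longrightarrow> sp_comm A"
proof (induction rule: Alg.induct)
  case ident
  show ?case by (auto simp: sp_comm_def intro!: hom_Alg Alg.ident)
qed (auto intro: sp_comm_e sp_comm_f sp_comm_num sp_comm_add sp_comm_scale sp_comm_comp)

text \<open>Occupation monomials: S holds the singly occupied sites, T the doubly occupied ones. The
  species of the single fermions and the order of creation are left open, so S and T do not
  determine v.\<close>

inductive mon :: "nat set \<Rightarrow> nat set \<Rightarrow> 'v \<Rightarrow> bool" where
  vac: "mon {} {} vac"
| single: "mon S T v \<Longrightarrow> i < L \<Longrightarrow> i \<notin> S \<Longrightarrow> i \<notin> T \<Longrightarrow> mon (insert i S) T (cr b i v)"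
| pair: "mon S T v \<Longrightarrow> i < L \<Longrightarrow> i \<notin> S \<Longrightarrow> i \<notin> T \<Longrightarrow> mon S (insert i T) (d i v)"

lemma mon_subsets: "mon S T v \<Longrightarrow> S \<subseteq> {..<L} \<and> T \<subseteq> {..<L} \<and> S \<inter> T = {}"
  by (induction rule: mon.induct) auto

lemma mon_an: "mon S T v \<Longrightarrow> i < L \<Longrightarrow> i \<notin> S \<Longrightarrow> i \<notin> T \<Longrightarrow> an b i v = 0"
  by (induction rule: mon.induct) (auto simp: an_vac an_cr an_d module_hom.zero[OF hom_d])

text \<open>Bringing the creator at i to the front costs at most a sign, whence the
  disjunction.\<close>

lemma mon_single_front:
  assumes "mon S T v" "i \<in> S"
  shows "\<exists>b w. mon (S - {i}) T w \<and> (v = cr b i w \<or> v = - cr b i w)"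
  using assms
proof (induction rule: mon.induct)
  case (single S T v j b)
  show ?case
  proof (cases "i = j")
    case True
    then show ?thesis using single by auto
  next
    case False
    then have "i \<in> S" using single by auto
    with single.IH obtain c w where w: "mon (S - {i}) T w" "v = cr c i w \<or> v = - cr c i w"
      by blast
    have "i < L" using mon_subsets[OF single.hyps(1)] \<open>i \<in> S\<close> by auto
    have "mon (insert j (S - {i})) T (cr b j w)"
      using single by (intro mon.single w) auto
    moreover have "insert j (S - {i}) = insert j S - {i}" using False by auto
    moreover have "cr b j v = cr c i (cr b j w) \<or> cr b j v = - cr c i (cr b j w)"
      using w(2) cr_cr[OF \<open>j < L\<close> \<open>i < L\<close>, of b c w] by auto
    ultimately show ?thesis by metis
  qed
next
  case (pair S T v j)
  then obtain c w where w: "mon (S - {i}) T w" "v = cr c i w \<or> v = - cr c i w" by blast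
  have "i < L" using mon_subsets[OF pair.hyps(1)] pair.prems by auto
  have "mon (S - {i}) (insert j T) (d j w)" using pair by (intro mon.pair w) auto
  moreover have "d j v = cr c i (d j w) \<or> d j v = - cr c i (d j w)"
    using w(2) d_cr[OF \<open>j < L\<close> \<open>i < L\<close>] module_hom.neg[OF hom_d] by auto
  ultimately show ?case by blast
qed auto

lemma mon_pair_front:
  assumes "mon S T v" "i \<in> T"
  shows "\<exists>w. mon S (T - {i}) w \<and> v = d i w"
  using assms
proof (induction rule: mon.induct)
  case (single S T v j b)
  then obtain w where w: "mon S (T - {i}) w" "v = d i w" by blast
  have "i < L" using mon_subsets[OF single.hyps(1)] single.prems by auto
  have "mon (insert j S) (T - {i}) (cr b j w)" using single by (intro mon.single w) auto
  moreover have "cr b j v = d i (cr b j w)"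
    using w(2) d_cr[OF \<open>i < L\<close> \<open>j < L\<close>] by simp
  ultimately show ?case by blast
next
  case (pair S T v j)
  show ?case
  proof (cases "i = j")
    case True
    then show ?thesis using pair by auto
  next
    case False
    then have "i \<in> T" using pair by auto
    with pair.IH obtain w where w: "mon S (T - {i}) w" "v = d i w" by blast
    have "i < L" using mon_subsets[OF pair.hyps(1)] \<open>i \<in> T\<close> by auto
    have "mon S (insert j (T - {i})) (d j w)" using pair by (intro mon.pair w) auto
    moreover have "insert j (T - {i}) = insert j T - {i}" using False by auto
    moreover have "d j v = d i (d j w)" using w(2) d_commute \<open>i < L\<close> \<open>j < L\<close> by simp
    ultimately show ?thesis by metis
  qed
qed auto

lemma mon_no_single: "mon S T v \<Longrightarrow> S = {} \<Longrightarrow> v = om vac T"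
proof (induction rule: mon.induct)
  case (pair S T v i)
  then show ?case using mon_subsets[OF pair.hyps(1)] by (simp add: om_insert)
qed auto

text \<open>The operators act on a whole type, which in the application is larger than the Fock
  space; statements about X are therefore made on this span only.\<close>

definition Fock :: "'v set" where "Fock = span {v. \<exists>S T. mon S T v}"

lemma Fock_vac: "vac \<in> Fock"
  unfolding Fock_def by (intro span_base) (auto intro: mon.vac)

lemma Fock_mon: "mon S T v \<Longrightarrow> v \<in> Fock"
  unfolding Fock_def by (intro span_base) auto

lemma Fock_cr:
  assumes "v \<in> Fock" "i < L"
  shows "cr b i v \<in> Fock"
  using assms(1) unfolding Fock_def
proof (induction rule: span_induct)
  case base
  show ?case
    by (rule subspaceI) (auto intro: span_add span_scale span_zero)
next
  case (step x)
  then obtain S T where x: "mon S T x" by blast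
  have "cr b i x \<in> Fock"
  proof -
    consider "i \<in> S" | "i \<in> T" | "i \<notin> S" "i \<notin> T" by blast
    then show ?thesis
    proof cases
      case 1
      then obtain c w where w: "mon (S - {i}) T w" "x = cr c i w \<or> x = - cr c i w"
        using mon_single_front[OF x] by blast
      have "i \<notin> T" using mon_subsets[OF x] 1 by auto
      then have "d i w \<in> Fock" using mon.pair[OF w(1) assms(2)] by (auto intro: Fock_mon)
      moreover have "cr b i (cr c i w) \<in> {0, d i w, - d i w}"
        using assms(2) cr_cr[of i i False True w] by (cases b; cases c) (auto simp: d_def)
      ultimately have "cr b i (cr c i w) \<in> Fock" "- cr b i (cr c i w) \<in> Fock"
        unfolding Fock_def by (auto intro: span_neg span_zero)
      then show ?thesis using w(2) by auto
    next
      case 2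
      then obtain w where w: "x = d i w" using mon_pair_front[OF x] by blast
      have "cr b i x = 0"
        using assms(2) cr_cr[of i i False True] unfolding w d_def by (cases b) simp_all
      then show ?thesis unfolding Fock_def by (simp add: span_zero)
    next
      case 3
      then show ?thesis using mon.single[OF x assms(2)] by (auto intro: Fock_mon)
    qed
  qed
  then show ?case unfolding Fock_def .
qed

text \<open>Breaking a filled pair at \<open>i\<close> over an empty site \<open>j\<close> produces any two single occupations,
  so the vectors with at most one single occupation determine an operator commuting with \<open>sp\<close>.\<close>

lemma sp_comm_zero_on_Fock:
  assumes Z: "sp_comm Z"
    and vac0: "\<And>M. M \<subseteq> {..<L} \<Longrightarrow> Z (om vac M) = 0"
    and single0: "\<And>M. M \<subseteq> {1..<L} \<Longrightarrow> Z (om (cr True 0 vac) M) = 0"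
    and v: "v \<in> Fock"
  shows "Z v = 0"
proof -
  note hom = sp_commD(1)[OF Z]
  note [simp] = module_hom.neg[OF hom] module_hom.zero[OF hom]
  have tP0: "Z (tP i k x) = 0" and tQ0: "Z (tQ i k x) = 0" and tM0: "Z (tM i k x) = 0"
    if "Z x = 0" "i < L" "k < L" for i k x
    using sp_commD(2-4)[OF Z that(2,3), of x] that(1) module_hom.zero[OF hom_tP]
      module_hom.zero[OF hom_tQ] module_hom.zero[OF hom_tM] by simp_all
  have half: "Z x = 0" if "Z (x + x) = 0" for x
  proof -
    have "Z x + Z x = 0" using that by (simp only: module_hom.add[OF hom])
    then have "Z x = - Z x" by (rule eq_neg_iff_add_eq_0[THEN iffD2])
    then show ?thesis by (simp only: eq_neg_self_iff)
  qed
  \<comment> \<open>\<open>tQ i i\<close> is twice the operator that replaces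
    \<open>p\<^sub>i\<close> by \<open>q\<^sub>i\<close>, so this flips the species at a singly
    occupied site.\<close>
  have lQ: "Z (cr False i (an True i x)) = 0" if "Z x = 0" "i < L" for i x
    using tQ0[OF that(1,2,2)] by - (rule half, simp add: tQ_def)
  \<comment> \<open>\<open>single0\<close> only speaks of a single fermion at site 0;
    \<open>tM a 0\<close> transports it to site a.\<close>
  have one: "Z (cr True a (om vac T)) = 0" if a: "a < L" "T \<subseteq> {..<L}" "a \<notin> T" for a T
  proof (cases "a = 0")
    case True
    then have "T \<subseteq> {1..<L}" using a by (auto simp: Suc_le_eq intro!: gr0I)
    then show ?thesis using single0[of T] cr_om[OF a(2,1)] True by simp
  next
    case a0: False
    show ?thesis
    proof (cases "0 \<in> T")
      case False
      then have "T \<subseteq> {1..<L}" using a by (auto simp: Suc_le_eq intro!: gr0I)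
      then have "Z (cr True 0 (om vac T)) = 0" using single0[of T] cr_om[OF a(2) L_pos] by simp
      from tM0[OF this a(1) L_pos] have "Z (tM a 0 (cr True 0 (om vac T))) = 0" .
      moreover have "an b 0 (om vac T) = 0" "an b a (om vac T) = 0" for b
        using a False L_pos an_om_zero[OF reference_vac a(2)] by auto
      ultimately show ?thesis using a L_pos a0 by (simp add: tM_def an_cr)
    next
      case True
      define w where "w = om vac (T - {0})"
      have T: "om vac T = d 0 w" using om_remove[OF a(2) True] by (simp add: w_def)
      have w: "an b 0 w = 0" "an b a w = 0" for b
        unfolding w_def using a L_pos an_om_zero[OF reference_vac, of "T - {0}"] by auto
      \<comment> \<open>If site 0 is to end up paired, start with the pair at a instead:
        \<open>tM a 0\<close> exchanges the single fermion at 0 with the pair at a.\<close>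
      have "insert a (T - {0}) \<subseteq> {..<L}" "insert a (T - {0}) \<subseteq> {1..<L}"
        using a a0 by (auto simp: Suc_le_eq intro!: gr0I)
      then have "Z (om (cr True 0 vac) (insert a (T - {0}))) = 0" by (intro single0)
      moreover have "om (cr True 0 vac) (insert a (T - {0})) = cr True 0 (d a w)"
        using \<open>insert a (T - {0}) \<subseteq> {..<L}\<close> a L_pos unfolding w_def
        by (simp flip: cr_om add: om_insert d_cr)
      ultimately have "Z (cr True 0 (d a w)) = 0" by simp
      from tM0[OF this a(1) L_pos] have "Z (tM a 0 (cr True 0 (d a w))) = 0" .
      moreover have "tM a 0 (cr True 0 (d a w)) = cr True a (d 0 w)"
        using a L_pos a0 w cr_cr[of 0 a False True w] cr_cr[of 0 a True True "cr False 0 w"]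
          cr_cr[of 0 0 False True "cr True a w"]
        by (simp add: tM_def d_def an_cr)
      ultimately show ?thesis using T by simp
    qed
  qed
  have mon0: "Z m = 0" if "mon S T m" for S T m
    using that
  \<comment> \<open>The induction is on the number of single occupations: two of them come from one
    pair and one empty site.\<close>
  proof (induction "card S" arbitrary: S T m rule: less_induct)
    case less
    have sub: "S \<subseteq> {..<L}" "T \<subseteq> {..<L}" "S \<inter> T = {}" using mon_subsets[OF less.prems] by auto
    have fin: "finite S" using sub(1) by (rule finite_subset) simp
    show ?case
    proof (cases "S = {}")
      case True
      then show ?thesis using mon_no_single[OF less.prems] vac0[OF sub(2)] by simp
    next
      case False
      then obtain i where i: "i \<in> S" by blast
      obtain b w where w: "mon (S - {i}) T w" "m = cr b i w \<or> m = - cr b i w"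
        using mon_single_front[OF less.prems i] by blast
      have iL: "i < L" and iT: "i \<notin> T" using i sub by auto
      have an_w: "an c i w = 0" for c using mon_an[OF w(1) iL] iT by simp
      show ?thesis
      proof (cases "S = {i}")
        case True
        then have "w = om vac T" using mon_no_single w(1) by simp
        then have p: "Z (cr True i w) = 0" using one[OF iL sub(2) iT] by simp
        moreover have "Z (cr False i w) = 0"
          using lQ[OF p iL] iL an_w by (simp add: an_cr)
        ultimately show ?thesis using w(2) by (cases b) auto
      next
        case False
        then obtain j where j: "j \<in> S - {i}" using i by blast
        obtain c x where x: "mon (S - {i} - {j}) T x" "w = cr c j x \<or> w = - cr c j x"
          using mon_single_front[OF w(1) j] by blast
        have jL: "j < L" and jT: "j \<notin> T" and ij: "i \<noteq> j" using j sub by auto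
        have an_x: "an c i x = 0" "an c j x = 0" for c
          using mon_an[OF x(1)] iL iT jL jT by auto
        \<comment> \<open>\<open>d i x\<close> has two singles fewer. \<open>tP i j\<close> breaks
          its pair over the empty site j and yields \<open>p\<^sub>i p\<^sub>j x\<close>;
          \<open>lQ\<close> then gives the other three choices of species.\<close>
        have "mon (S - {i} - {j}) (insert i T) (d i x)"
          using x(1) iL iT by (intro mon.pair) auto
        moreover have "card (S - {i} - {j}) < card S"
          using i fin by (intro psubset_card_mono) auto
        ultimately have "Z (d i x) = 0" using less.hyps by blast
        from tP0[OF this iL jL] have pp: "Z (cr True i (cr True j x)) = 0"
          using iL jL ij an_x cr_cr[of j i True True x] by (simp add: tP_def d_def an_cr)
        have qp: "Z (cr False i (cr True j x)) = 0"
          using lQ[OF pp iL] iL jL ij an_x by (simp add: an_cr)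
        have pq: "Z (cr True i (cr False j x)) = 0"
          using lQ[OF pp jL] iL jL ij an_x cr_cr[of i j True False x] by (simp add: an_cr)
        have qq: "Z (cr False i (cr False j x)) = 0"
          using lQ[OF pq iL] iL jL ij an_x by (simp add: an_cr)
        have "Z (cr b i (cr c j x)) = 0" using pp qp pq qq by (cases b; cases c) auto
        then show ?thesis using w(2) x(2) by auto
      qed
    qed
  qed
  show ?thesis
    using v unfolding Fock_def
  proof (induction rule: span_induct)
    case base
    show ?case
      by (rule subspaceI) (simp_all add: module_hom.add[OF hom] module_hom.scale[OF hom])
  qed (use mon0 in blast)
qed

end

section \<open>Operators commuting with the symplectic algebra\<close>

context fock_pairs
begin

text \<open>\<open>root_up i\<close> and \<open>root_down i\<close> generate the sl(2) of the long
  root at site i. A singly occupied site is its doublet; an empty or paired site is a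
  singlet.\<close>

definition root_up :: "nat \<Rightarrow> 'v \<Rightarrow> 'v" where "root_up i v = cr True i (an False i v)"
definition root_down :: "nat \<Rightarrow> 'v \<Rightarrow> 'v" where "root_down i v = cr False i (an True i v)"

text \<open>The projection onto the states in which site \<open>i\<close> is empty or filled by a pair.\<close>

definition pair_proj :: "nat \<Rightarrow> 'v \<Rightarrow> 'v" where "pair_proj i v = v - root_down i (root_up i v) - root_up i (root_down i v)"

lemma hom_pair_proj: "module_hom scale scale (pair_proj i)"
  by unfold_locales (simp_all add: pair_proj_def root_up_def root_down_def scale_right_diff_distrib)

lemma hom_foldr_pair_proj: "module_hom scale scale (foldr pair_proj xs)"
  by (induction xs)
    (auto intro!: module_hom.intro module_hom_axioms.intro module_axioms
      simp: module_hom.add module_hom.scale module_hom.add[OF hom_pair_proj] module_hom.scale[OF hom_pair_proj])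

lemma mon_site_cases:
  assumes "mon S T m" "i < L"
  obtains (empty) "i \<notin> S" "i \<notin> T" "\<And>b. an b i m = 0"
  | (pair) w where "i \<in> T" "i \<notin> S" "m = d i w" "\<And>b. an b i w = 0"
  | (single) b w where "i \<in> S" "i \<notin> T" "m = cr b i w \<or> m = - cr b i w" "\<And>b. an b i w = 0"
      "mon (S - {i}) T w"
proof -
  have disj: "S \<inter> T = {}" using mon_subsets[OF assms(1)] by blast
  consider "i \<notin> S" "i \<notin> T" | "i \<in> T" "i \<notin> S" | "i \<in> S" "i \<notin> T" using disj by blast
  then show thesis
  proof cases
    case 1
    then show ?thesis using empty mon_an[OF assms] by blast
  next
    case 2
    then obtain w where w: "mon S (T - {i}) w" "m = d i w" using mon_pair_front[OF assms(1)] by blast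
    show ?thesis using pair[OF 2 w(2)] mon_an[OF w(1) assms(2)] 2 by blast
  next
    case 3
    then obtain b w where w: "mon (S - {i}) T w" "m = cr b i w \<or> m = - cr b i w"
      using mon_single_front[OF assms(1)] by blast
    show ?thesis using single[OF 3 w(2) _ w(1)] mon_an[OF w(1) assms(2)] 3 by blast
  qed
qed

lemma pair_proj_mon:
  assumes "mon S T m" "i < L"
  shows "pair_proj i m = (if i \<in> S then 0 else m)"
  using assms
proof (cases rule: mon_site_cases)
  case empty
  then show ?thesis by (simp add: pair_proj_def root_up_def root_down_def)
next
  case (pair w)
  then show ?thesis using assms(2) by (simp add: pair_proj_def root_up_def root_down_def d_def an_cr)
next
  case (single b w)
  then show ?thesis using assms(2) by (cases b) (auto simp: pair_proj_def root_up_def root_down_def an_cr)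
qed

lemma foldr_pair_proj_mon:
  assumes "mon S T m" "set xs \<subseteq> {..<L}"
  shows "foldr pair_proj xs m = (if set xs \<inter> S = {} then m else 0)"
  using assms(2)
  by (induction xs) (auto simp: pair_proj_mon[OF assms(1)] module_hom.zero[OF hom_pair_proj])

lemma foldr_pair_proj_fixed: "(\<And>i. i \<in> set xs \<Longrightarrow> root_up i v = 0 \<and> root_down i v = 0) \<Longrightarrow> foldr pair_proj xs v = v"
proof (induction xs)
  case (Cons i xs)
  then have "foldr pair_proj xs v = v" "root_up i v = 0" "root_down i v = 0" by auto
  moreover have "pair_proj i v = v"
    unfolding pair_proj_def \<open>root_up i v = 0\<close> \<open>root_down i v = 0\<close> by (simp add: root_up_def root_down_def)
  ultimately show ?case by simp
qed simp

lemma Fock_map_span: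
  assumes "module_hom scale scale H" "\<And>S T m. mon S T m \<Longrightarrow> H m \<in> span B" "v \<in> Fock"
  shows "H v \<in> span B"
  using assms(3) unfolding Fock_def
proof (induction rule: span_induct)
  case base
  show ?case
    by (rule subspaceI)
      (simp_all add: module_hom.add[OF assms(1)] module_hom.scale[OF assms(1)]
        module_hom.zero[OF assms(1)] span_add span_scale span_zero)
qed (use assms(2) in blast)

text \<open>The product of the pair projections over all sites fixes v, and it maps every monomial
  either to 0 or to a product of pairs.\<close>

lemma span_om_vac:
  assumes "v \<in> Fock" "\<And>i. i < L \<Longrightarrow> root_up i v = 0 \<and> root_down i v = 0"
  shows "v \<in> span (om vac ` Pow {..<L})"
proof -
  have "foldr pair_proj [0..<L] v \<in> span (om vac ` Pow {..<L})"
  proof (rule Fock_map_span[OF hom_foldr_pair_proj _ assms(1)])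
    fix S T m assume m: "mon S T m"
    have sub: "S \<subseteq> {..<L}" "T \<subseteq> {..<L}" using mon_subsets[OF m] by auto
    have xs: "set [0..<L] \<subseteq> {..<L}" by auto
    show "foldr pair_proj [0..<L] m \<in> span (om vac ` Pow {..<L})"
    proof (cases "S = {}")
      case True
      then have "foldr pair_proj [0..<L] m = om vac T"
        using foldr_pair_proj_mon[OF m xs] mon_no_single[OF m] by simp
      then show ?thesis using sub by (auto intro!: span_base)
    next
      case False
      then have "foldr pair_proj [0..<L] m = 0"
        using foldr_pair_proj_mon[OF m xs] sub by (auto simp: atLeast0LessThan)
      then show ?thesis by (simp add: span_zero)
    qed
  qed
  moreover have "foldr pair_proj [0..<L] v = v" using assms(2) by (intro foldr_pair_proj_fixed) auto
  ultimately show ?thesis by simp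
qed

lemma span_om_single:
  assumes "v \<in> Fock" "\<And>i. i \<in> {1..<L} \<Longrightarrow> root_up i v = 0 \<and> root_down i v = 0" "tM 0 0 v = v"
  shows "v \<in> span (om (cr True 0 vac) ` Pow {1..<L})"
proof -
  \<comment> \<open>\<open>tM 0 0\<close> has eigenvalue 1 on a single \<open>p\<^sub>0\<close>, -1
    on a single \<open>q\<^sub>0\<close> and 0 on an empty or paired site 0, so half of the sum of
    it and its square projects onto eigenvalue 1.\<close>
  define G where "G x = foldr pair_proj [1..<L] ((1/2) *s (tM 0 0 x + tM 0 0 (tM 0 0 x)))" for x
  have "module_hom scale scale G"
    unfolding G_def
    by (auto intro!: module_hom.intro module_hom_axioms.intro module_axioms
      simp: module_hom.add[OF hom_tM] module_hom.scale[OF hom_tM] module_hom.add[OF hom_foldr_pair_proj]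
        module_hom.scale[OF hom_foldr_pair_proj] scale_right_distrib mult.commute)
  then have "G v \<in> span (om (cr True 0 vac) ` Pow {1..<L})"
  proof (rule Fock_map_span[OF _ _ assms(1)])
    fix S T m assume m: "mon S T m"
    have xs: "set [1..<L] \<subseteq> {..<L}" by auto
    show "G m \<in> span (om (cr True 0 vac) ` Pow {1..<L})"
      using m L_pos
    proof (cases rule: mon_site_cases)
      case empty
      then have "tM 0 0 m = 0" by (simp add: tM_def)
      then show ?thesis by (simp add: G_def module_hom.zero[OF hom_foldr_pair_proj] span_zero
        module_hom.zero[OF hom_tM])
    next
      case (pair w)
      then have "tM 0 0 m = 0"
        using L_pos cr_cr[of 0 0 False True w] by (simp add: tM_def d_def an_cr)
      then show ?thesis by (simp add: G_def module_hom.zero[OF hom_foldr_pair_proj] span_zero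
        module_hom.zero[OF hom_tM])
    next
      case (single b w)
      show ?thesis
      proof (cases b)
        case False
        then have "tM 0 0 m = - m" using single L_pos by (auto simp: tM_def an_cr)
        then show ?thesis by (simp add: G_def module_hom.zero[OF hom_foldr_pair_proj] span_zero
          module_hom.neg[OF hom_tM])
      next
        case True
        then have "tM 0 0 m = m" using single L_pos by (auto simp: tM_def an_cr)
        then have G: "G m = foldr pair_proj [1..<L] m"
          by (simp add: G_def scale_left_distrib[of 1 1, simplified, symmetric])
        show ?thesis
        proof (cases "S = {0}")
          case S: True
          then have w: "w = om vac T" using mon_no_single single by simp
          have T: "T \<subseteq> {..<L}" "T \<subseteq> {1..<L}"
            using mon_subsets[OF m] single(2) by (auto simp: Suc_le_eq intro!: gr0I)
          have "G m = m" unfolding G using foldr_pair_proj_mon[OF m xs] S by auto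
          moreover have "m = om (cr True 0 vac) T \<or> m = - om (cr True 0 vac) T"
            using single True w cr_om[OF T(1) L_pos] by auto
          ultimately show ?thesis using T(2) by (auto intro: span_base span_neg)
        next
          case False
          then obtain i where "i \<in> S" "i \<noteq> 0" using single by blast
          then have "i \<in> set [1..<L] \<inter> S" using mon_subsets[OF m] by auto
          then have "G m = 0" unfolding G using foldr_pair_proj_mon[OF m xs] by auto
          then show ?thesis by (simp add: span_zero)
        qed
      qed
    qed
  qed
  moreover have "G v = v"
    using foldr_pair_proj_fixed[of "[1..<L]" v] assms(2,3)
    by (simp add: G_def scale_left_distrib[of 1 1, simplified, symmetric])
  ultimately show ?thesis by simp
qed

lemma sp_comm_root_up_root_down:
  assumes "sp_comm X" "i < L"
  shows "X (root_up i v) = root_up i (X v)" "X (root_down i v) = root_down i (X v)"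
proof -
  note hom = sp_commD(1)[OF assms(1)]
  have half: "x = y" if "x + x = y + y" for x y :: 'v
  proof -
    have "2 *s z = z + z" for z using scale_left_distrib[of 1 1 z] by simp
    then have "2 *s x = 2 *s y" using that by simp
    then show ?thesis by simp
  qed
  show "X (root_up i v) = root_up i (X v)"
    by (rule half)
      (use sp_commD(2)[OF assms(1) assms(2,2), of v] in \<open>simp add: tP_def root_up_def module_hom.add[OF hom]\<close>)
  show "X (root_down i v) = root_down i (X v)"
    by (rule half)
      (use sp_commD(3)[OF assms(1) assms(2,2), of v] in \<open>simp add: tQ_def root_down_def module_hom.add[OF hom]\<close>)
qed

text \<open>The number s is the weight of \<open>u\<close>, so that \<open>om u M\<close> has weight
  s + 2 * card M.\<close>

definition sector :: "nat \<Rightarrow> 'v \<Rightarrow> nat set \<Rightarrow> bool" where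
  "sector s u K \<longleftrightarrow> s = 0 \<and> u = vac \<and> K = {..<L} \<or> s = 1 \<and> u = cr True 0 vac \<and> K = {1..<L}"

lemma sector_reference: "sector s u K \<Longrightarrow> reference u K"
  unfolding sector_def using reference_vac reference_p0 by blast

lemma sector_num: "sector s u K \<Longrightarrow> num u = of_nat s *s u"
  unfolding sector_def using L_pos by (auto simp: num_vac num_cr)

lemma root_up_root_down_om:
  assumes "reference u K" "M \<subseteq> K" "i \<in> K"
  shows "root_up i (om u M) = 0" "root_down i (om u M) = 0"
proof -
  have M: "M \<subseteq> {..<L}" and i: "i < L" using assms by (auto simp: reference_def)
  have "root_up i (om u M) = 0 \<and> root_down i (om u M) = 0"
  proof (cases "i \<in> M")
    case True
    have "\<And>b. an b i (om u (M - {i})) = 0"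
      using assms by (intro an_om_zero[of u K]) auto
    then show ?thesis
      using om_remove[OF M True] i by (simp add: root_up_def root_down_def d_def an_cr)
  next
    case False
    then show ?thesis using an_om_zero[OF assms] by (simp add: root_up_def root_down_def)
  qed
  then show "root_up i (om u M) = 0" "root_down i (om u M) = 0" by auto
qed

text \<open>Inside \<open>Fock\<close> the span is cut out by operators of sp: both root operators
  vanish at the sites of K and, in the odd sector, \<open>tM 0 0\<close> has eigenvalue 1. X
  commutes with these operators and so preserves the conditions.\<close>

lemma sp_comm_om_span:
  assumes X: "sp_comm X" "\<And>v. v \<in> Fock \<Longrightarrow> X v \<in> Fock"
    and u: "sector s u K" "M \<subseteq> K"
  shows "X (om u M) \<in> span (om u ` Pow K)"
proof -
  note hom = sp_commD(1)[OF X(1)]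
  have K: "K \<subseteq> {..<L}" using sector_reference[OF u(1)] by (simp add: reference_def)
  have "om u M \<in> Fock"
  proof -
    have "u \<in> Fock" using u(1) Fock_vac Fock_cr L_pos by (auto simp: sector_def)
    moreover have "M \<subseteq> {..<L}" using u(2) K by blast
    moreover have "om u M \<in> Fock" if "u \<in> Fock" "M \<subseteq> {..<L}"
      using that(2)
    proof (induction M rule: subset_lt_induct)
      case (insert i M)
      then show ?case by (simp add: om_insert d_def Fock_cr)
    qed (simp add: that)
    ultimately show ?thesis by blast
  qed
  then have F: "X (om u M) \<in> Fock" by (rule X(2))
  have kill: "root_up i (X (om u M)) = 0 \<and> root_down i (X (om u M)) = 0" if "i \<in> K" for i
  proof -
    have "i < L" using that K by auto
    from sp_comm_root_up_root_down[OF X(1) this, of "om u M", symmetric] show ?thesis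
      using root_up_root_down_om[OF sector_reference[OF u(1)] u(2) that] by (simp add: module_hom.zero[OF hom])
  qed
  from u(1) show ?thesis unfolding sector_def
  proof (elim disjE conjE)
    assume "u = vac" "K = {..<L}"
    then show ?thesis using span_om_vac[OF F] kill by auto
  next
    assume u': "u = cr True 0 vac" "K = {1..<L}"
    have M: "M \<subseteq> {..<L}" "0 \<notin> M" using u(2) u' by auto
    have "an True 0 (om u M) = om vac M" "an False 0 (om u M) = 0"
      using an_om[OF M(1) L_pos M(2)] M(1) L_pos unfolding u' by (simp_all add: an_cr an_vac)
    then have "tM 0 0 (om u M) = om u M"
      using cr_om[OF M(1) L_pos] by (simp add: tM_def u')
    then have "tM 0 0 (X (om u M)) = X (om u M)"
      using sp_commD(4)[OF X(1) L_pos L_pos, of "om u M"] by simp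
    then show ?thesis using span_om_single[OF F] kill unfolding u' by blast
  qed
qed

text \<open>Coordinate functionals defined on the whole space, which also show that the vectors
  \<open>om u M\<close> are independent. The functional for N strips the pairs of N by the
  \<open>D i\<close> and then tests for \<open>u\<close>.\<close>

lemma ex_om_coefficients:
  assumes "sector s u K"
  shows "\<exists>c :: nat set \<Rightarrow> 'v \<Rightarrow> complex.
    (\<forall>N x y. c N (x + y) = c N x + c N y) \<and> (\<forall>N a x. c N (a *s x) = a * c N x) \<and>
    (\<forall>M N. M \<subseteq> K \<and> N \<subseteq> K \<longrightarrow> c N (om u M) = (if M = N then 1 else 0))"
proof -
  note ref = sector_reference[OF assms]
  have K: "K \<subseteq> {..<L}" using ref by (simp add: reference_def)
  have "\<exists>w :: 'v \<Rightarrow> complex. (\<forall>x y. w (x + y) = w x + w y) \<and> (\<forall>a x. w (a *s x) = a * w x) \<and>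
    w u = 1 \<and> (\<forall>i\<in>K. \<forall>x. w (d i x) = 0)"
  proof (cases "s = 0")
    case True
    then have "u = vac" "K = {..<L}" using assms by (auto simp: sector_def)
    then show ?thesis
      by (intro exI[of _ ev]) (simp add: ev_add ev_scale ev_vac d_def ev_cr)
  next
    case False
    then have uK: "u = cr True 0 vac" "K = {1..<L}" using assms by (auto simp: sector_def)
    \<comment> \<open>In the odd sector \<open>u\<close> is detected by first removing
      \<open>p\<^sub>0\<close> and then taking the vacuum component.\<close>
    have "ev (an True 0 (d i x)) = 0" if "i \<in> K" for i x
      using that L_pos an_d[of 0 i True x] uK by (simp add: d_def ev_cr)
    moreover have "ev (an True 0 u) = 1" using L_pos by (simp add: uK an_cr an_vac ev_vac)
    ultimately show ?thesis
      by (intro exI[of _ "\<lambda>x. ev (an True 0 x)"]) (simp add: ev_add ev_scale)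
  qed
  then obtain w :: "'v \<Rightarrow> complex" where
    "(\<forall>x y. w (x + y) = w x + w y) \<and> (\<forall>a x. w (a *s x) = a * w x) \<and>
    w u = 1 \<and> (\<forall>i\<in>K. \<forall>x. w (d i x) = 0)" ..
  then have w: "\<And>x y. w (x + y) = w x + w y"
    "\<And>a x. w (a *s x) = a * w x" "w u = 1" "\<And>i x. i \<in> K \<Longrightarrow> w (d i x) = 0"
    by simp_all
  have w_om: "w (om u M) = (if M = {} then 1 else 0)" if "M \<subseteq> K" for M
  proof (cases "M = {}")
    case False
    then obtain i where "i \<in> M" by blast
    moreover have "M \<subseteq> {..<L}" using that K by blast
    ultimately have "om u M = d i (om u (M - {i}))" by (intro om_remove)
    then show ?thesis using w(4)[of i "om u (M - {i})"] that \<open>i \<in> M\<close> False by auto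
  qed (simp add: w(3))
  have D_list: "foldr D xs (om u M) = (if set xs \<subseteq> M then om u (M - set xs) else 0)"
    if "M \<subseteq> K" "set xs \<subseteq> K" "distinct xs" for M xs
    using that(2,3)
  proof (induction xs)
    case (Cons i xs)
    then have i: "i < L" "i \<notin> set xs" using K by auto
    show ?case
    proof (cases "set xs \<subseteq> M")
      case True
      have "D i (om u (M - set xs)) = (if i \<in> M - set xs then om u (M - set xs - {i}) else 0)"
        using that(1) i by (intro D_om[OF ref]) auto
      moreover have "M - set xs - {i} = M - set (i # xs)" by auto
      moreover have "foldr D xs (om u M) = om u (M - set xs)" using Cons True by simp
      moreover have "set (i # xs) \<subseteq> M \<longleftrightarrow> i \<in> M - set xs" using True i by auto
      ultimately show ?thesis by simp
    next
      case False
      then have "foldr D xs (om u M) = 0" using Cons by simp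
      then show ?thesis using False by (simp add: module_hom.zero[OF hom_D])
    qed
  qed simp
  have hom: "module_hom scale scale (foldr D xs)" for xs
    by (induction xs)
      (auto intro!: module_hom.intro module_hom_axioms.intro module_axioms
        simp: module_hom.add module_hom.scale module_hom.add[OF hom_D] module_hom.scale[OF hom_D])
  \<comment> \<open>A set M not containing N is killed by some \<open>D i\<close>, and a set
    strictly larger than N leaves a pair behind, which w kills.\<close>
  define c where "c N x = w (foldr D (sorted_list_of_set N) x)" for N x
  have "c N (om u M) = (if M = N then 1 else 0)" if "M \<subseteq> K" "N \<subseteq> K" for M N
  proof -
    have "N \<subseteq> {..<L}" using that K by simp
    then have N: "finite N" by (rule finite_subset) simp
    have "foldr D (sorted_list_of_set N) (om u M) = (if N \<subseteq> M then om u (M - N) else 0)"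
      using D_list[OF that(1), of "sorted_list_of_set N"] that(2) N by simp
    moreover have "w 0 = 0" using w(2)[of 0 0] by simp
    moreover have "w (om u (M - N)) = (if M - N = {} then 1 else 0)"
      using that(1) by (intro w_om) auto
    ultimately have "c N (om u M) = (if N \<subseteq> M \<and> M - N = {} then 1 else 0)"
      by (simp add: c_def)
    also have "N \<subseteq> M \<and> M - N = {} \<longleftrightarrow> M = N" by blast
    finally show ?thesis .
  qed
  moreover have "c N (x + y) = c N x + c N y" "c N (a *s x) = a * c N x" for N x y a
    by (simp_all add: c_def module_hom.add[OF hom] module_hom.scale[OF hom] w(1,2))
  ultimately have "(\<forall>N x y. c N (x + y) = c N x + c N y) \<and> (\<forall>N a x. c N (a *s x) = a * c N x) \<and>
    (\<forall>M N. M \<subseteq> K \<and> N \<subseteq> K \<longrightarrow> c N (om u M) = (if M = N then 1 else 0))"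
    by (intro conjI allI impI) auto
  then show ?thesis by (rule exI[of _ c])
qed

text \<open>If exactly one of a, b is paired, \<open>tP a b\<close> breaks the pair over both sites
  and \<open>tQ a b\<close> recombines it at either site, with opposite signs. If both or neither
  are paired, \<open>tP a b\<close> gives 0 and the transposition fixes M.\<close>

lemma transposition_om:
  assumes "reference u K" "M \<subseteq> K" "a \<in> K" "b \<in> K" "a \<noteq> b"
  shows "tQ a b (tP a b (om u M)) = om u M - om u (Transposition.transpose a b ` M)"
proof -
  have K: "K \<subseteq> {..<L}" using assms(1) by (simp add: reference_def)
  have M: "M \<subseteq> {..<L}" and ab: "a < L" "b < L" using assms K by auto
  have exchange: "tQ a b (tP a b (om u M)) = om u M - om u (Transposition.transpose a b ` M)"
    if M: "M \<subseteq> K" and ab: "a \<in> M" "b \<notin> M" "b \<in> K" for M a b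
  proof -
    define w where "w = om u (M - {a})"
    have L: "a < L" "b < L" "M \<subseteq> {..<L}" "a \<noteq> b" using that K by auto
    have w: "an c a w = 0" "an c b w = 0" for c
      using an_om_zero[OF assms(1), of "M - {a}"] that unfolding w_def by auto
    have "Transposition.transpose a b ` M = insert b (M - {a})"
      using ab by (auto simp: Transposition.transpose_def image_iff)
    then have "om u (Transposition.transpose a b ` M) = d b w"
      using om_insert[of b "M - {a}" u] L ab unfolding w_def by auto
    moreover have "om u M = d a w" using om_remove[OF L(3) ab(1)] by (simp add: w_def)
    moreover have "tQ a b (tP a b (d a w)) = d a w - d b w"
      using L w cr_cr[of b a True True w] cr_cr[of a a False True w] cr_cr[of b b False True w]
      by (simp add: tQ_def tP_def d_def an_cr)
    ultimately show ?thesis by simp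
  qed
  have sym: "tQ b a (tP b a v) = tQ a b (tP a b v)" for v
    by (simp add: tQ_def tP_def add.commute)
  consider "a \<in> M" "b \<notin> M" | "b \<in> M" "a \<notin> M" | "a \<in> M" "b \<in> M" | "a \<notin> M" "b \<notin> M" by blast
  then show ?thesis
  proof cases
    case 1
    then show ?thesis using exchange assms by blast
  next
    case 2
    then show ?thesis using exchange[of M b a] assms sym by (simp add: transpose_commute)
  next
    case 3
    define w where "w = om u (M - {a} - {b})"
    have Mw: "om u M = d a (d b w)"
    proof -
      have "M - {a} \<subseteq> {..<L}" "b \<in> M - {a}" using 3 M assms(5) by auto
      from om_remove[OF M 3(1), of u] om_remove[OF this, of u] show ?thesis by (simp add: w_def)
    qed
    have w: "an c a w = 0" "an c b w = 0" for c
      using an_om_zero[OF assms(1), of "M - {a} - {b}"] assms unfolding w_def by auto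
    have "tP a b (om u M) = 0"
      unfolding Mw tP_def
      using ab w assms(5) by (simp add: d_def an_cr cr_cr[of b a True True])
    moreover have "Transposition.transpose a b ` M = M" using 3
      by (auto simp: Transposition.transpose_def image_iff)
    ultimately show ?thesis by (simp add: module_hom.zero[OF hom_tQ])
  next
    case 4
    then have "tP a b (om u M) = 0"
      using an_om_zero[OF assms(1,2)] assms(3,4) by (simp add: tP_def)
    moreover have "Transposition.transpose a b ` M = M" using 4
      by (auto simp: Transposition.transpose_def image_iff)
    ultimately show ?thesis by (simp add: module_hom.zero[OF hom_tQ])
  qed
qed

lemma sp_comm_om_kernel:
  assumes X: "sp_comm X" "\<And>v. v \<in> Fock \<Longrightarrow> X v \<in> Fock"
    and u: "sector s u K"
  shows "\<exists>\<phi>. \<forall>M. M \<subseteq> K \<longrightarrow>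
    X (om u M) = (\<Sum>N\<in>Pow K. \<phi> (card M) (card N) (card (M \<inter> N)) *s om u N)"
proof -
  note hom = sp_commD(1)[OF X(1)]
  note ref = sector_reference[OF u]
  have K: "K \<subseteq> {..<L}" using ref by (simp add: reference_def)
  then have fin: "finite K" by (rule finite_subset) simp
  from ex_om_coefficients[OF u] obtain c :: "nat set \<Rightarrow> 'v \<Rightarrow> complex" where
    "(\<forall>N x y. c N (x + y) = c N x + c N y) \<and> (\<forall>N a x. c N (a *s x) = a * c N x) \<and>
    (\<forall>M N. M \<subseteq> K \<and> N \<subseteq> K \<longrightarrow> c N (om u M) = (if M = N then 1 else 0))" ..
  then have c: "\<And>N x y. c N (x + y) = c N x + c N y" "\<And>N a x. c N (a *s x) = a * c N x"
    "\<And>M N. M \<subseteq> K \<Longrightarrow> N \<subseteq> K \<Longrightarrow> c N (om u M) = (if M = N then 1 else 0)"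
    by simp_all
  have c0: "c N 0 = 0" for N using c(2)[of N 0 0] by simp
  have c_sum: "c N (sum g A) = (\<Sum>x\<in>A. c N (g x))" if "finite A" for N A and g :: "nat set \<Rightarrow> 'v"
    using that by (induction A) (simp_all add: c0 c(1))
  have expand: "v = (\<Sum>N\<in>Pow K. c N v *s om u N)" if "v \<in> span (om u ` Pow K)" for v
    using that
  proof (induction rule: span_induct)
    case base
    show ?case
    proof (rule subspaceI)
      fix a x assume "x \<in> {v. v = (\<Sum>N\<in>Pow K. c N v *s om u N)}"
      then have "x = (\<Sum>N\<in>Pow K. c N x *s om u N)" by (rule CollectD)
      then have "a *s x = a *s (\<Sum>N\<in>Pow K. c N x *s om u N)" by (rule arg_cong)
      also have "\<dots> = (\<Sum>N\<in>Pow K. c N (a *s x) *s om u N)" by (simp add: c(2) scale_sum_right)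
      finally show "a *s x \<in> {v. v = (\<Sum>N\<in>Pow K. c N v *s om u N)}" by (rule CollectI)
    qed (simp_all add: c(1) c0 scale_left_distrib sum.distrib)
  next
    case (step x)
    then obtain M where M: "M \<subseteq> K" "x = om u M" by blast
    have "(\<Sum>N\<in>Pow K. c N x *s om u N) = (\<Sum>N\<in>Pow K. if N = M then om u N else 0)"
      unfolding M(2) using c(3)[OF M(1)] by (intro sum.cong) auto
    also have "\<dots> = x" using fin M by simp
    finally show ?case by simp
  qed
  have exp_X: "X (om u M) = (\<Sum>N\<in>Pow K. c N (X (om u M)) *s om u N)" if "M \<subseteq> K" for M
    using sp_comm_om_span[OF X u that] by (rule expand)
  \<comment> \<open>By \<open>transposition_om\<close> the transposition acts as an operator built
    from sp, with which X commutes; so the matrix of X is unchanged when rows and columns are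
    transposed simultaneously.\<close>
  have transp: "c (Transposition.transpose a b ` N) (X (om u (Transposition.transpose a b ` M))) =
      c N (X (om u M))"
    if "M \<subseteq> K" "N \<subseteq> K" "a \<in> K" "b \<in> K" "a \<noteq> b" for a b M N
  proof -
    let ?\<tau> = "Transposition.transpose a b"
    let ?T = "\<lambda>v. tQ a b (tP a b v)"
    have \<tau>K: "?\<tau> ` A \<subseteq> K" if "A \<subseteq> K" for A
      using that \<open>a \<in> K\<close> \<open>b \<in> K\<close> by (auto simp: Transposition.transpose_def)
    have ab: "a < L" "b < L" using that K by auto
    have XT: "X (?T v) = ?T (X v)" for v
      using sp_commD(2,3)[OF X(1) ab] by simp
    have homT: "module_hom scale scale ?T"
      by (auto intro!: module_hom.intro module_hom_axioms.intro module_axioms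
        simp: module_hom.add[OF hom_tP] module_hom.add[OF hom_tQ]
         module_hom.scale[OF hom_tP] module_hom.scale[OF hom_tQ])
    have om_\<tau>: "om u (?\<tau> ` A) = om u A - ?T (om u A)" if "A \<subseteq> K" for A
      using transposition_om[OF ref that \<open>a \<in> K\<close> \<open>b \<in> K\<close> \<open>a \<noteq> b\<close>] by simp
    have "X (om u (?\<tau> ` M)) = X (om u M) - ?T (X (om u M))"
      using om_\<tau>[OF \<open>M \<subseteq> K\<close>] by (simp add: module_hom.diff[OF hom] XT)
    also have "\<dots> = (\<Sum>A\<in>Pow K. c A (X (om u M)) *s om u A) -
        ?T (\<Sum>A\<in>Pow K. c A (X (om u M)) *s om u A)"
      unfolding exp_X[OF \<open>M \<subseteq> K\<close>, symmetric] ..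
    also have "\<dots> = (\<Sum>A\<in>Pow K. c A (X (om u M)) *s (om u A - ?T (om u A)))"
      unfolding module_hom.sum[OF homT] module_hom.scale[OF homT] scale_right_diff_distrib
        sum_subtractf ..
    also have "\<dots> = (\<Sum>A\<in>Pow K. c A (X (om u M)) *s om u (?\<tau> ` A))"
      by (intro sum.cong refl arg_cong[where f = "scale _"] om_\<tau>[symmetric]) auto
    finally have "c (?\<tau> ` N) (X (om u (?\<tau> ` M))) =
        (\<Sum>A\<in>Pow K. c A (X (om u M)) * c (?\<tau> ` N) (om u (?\<tau> ` A)))"
      using fin by (simp add: c_sum c(2))
    also have "\<dots> = (\<Sum>A\<in>Pow K. if A = N then c A (X (om u M)) else 0)"
    proof (intro sum.cong refl)
      fix A assume "A \<in> Pow K"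
      moreover have "?\<tau> ` A = ?\<tau> ` N \<longleftrightarrow> A = N"
        by (rule inj_image_eq_iff) (rule inj_transpose)
      ultimately show "c A (X (om u M)) * c (?\<tau> ` N) (om u (?\<tau> ` A)) =
          (if A = N then c A (X (om u M)) else 0)"
        using c(3)[OF \<tau>K \<tau>K, of A N] \<open>N \<subseteq> K\<close> by simp
    qed
    also have "\<dots> = c N (X (om u M))" using fin \<open>N \<subseteq> K\<close> by simp
    finally show ?thesis .
  qed
  have perm: "c (\<sigma> ` N) (X (om u (\<sigma> ` M))) = c N (X (om u M))"
    if "\<sigma> permutes K" "M \<subseteq> K" "N \<subseteq> K" for \<sigma> M N
    using that(1) fin
  proof (induction rule: permutes_induct)
    case (swap a b p)
    have "p ` M \<subseteq> K" "p ` N \<subseteq> K" using that permutes_image[OF swap.hyps(4)] by auto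
    from transp[OF this swap.hyps(1,2,3)] swap.IH show ?case by (simp add: image_comp)
  qed simp
  \<comment> \<open>The entry of X at any representative of the orbit labelled by the three
    cardinalities; by \<open>perm\<close> and \<open>ex_permutes_matching_pairs\<close> the choice
    does not matter.\<close>
  define \<phi> where "\<phi> k k' j = (SOME x. \<exists>M N. M \<subseteq> K \<and> N \<subseteq> K \<and> card M = k \<and> card N = k' \<and>
    card (M \<inter> N) = j \<and> x = c N (X (om u M)))" for k k' j
  have \<phi>: "\<phi> (card M) (card N) (card (M \<inter> N)) = c N (X (om u M))" if MN: "M \<subseteq> K" "N \<subseteq> K" for M N
    unfolding \<phi>_def
  proof (rule some_equality)
    fix x assume "\<exists>M' N'. M' \<subseteq> K \<and> N' \<subseteq> K \<and> card M' = card M \<and> card N' = card N \<and>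
      card (M' \<inter> N') = card (M \<inter> N) \<and> x = c N' (X (om u M'))"
    then obtain M' N' where *: "M' \<subseteq> K" "N' \<subseteq> K" "card M' = card M" "card N' = card N"
      "card (M' \<inter> N') = card (M \<inter> N)" "x = c N' (X (om u M'))" by blast
    obtain \<sigma> where "\<sigma> permutes K" "\<sigma> ` M' = M" "\<sigma> ` N' = N"
      using ex_permutes_matching_pairs[OF fin *(1,2) MN *(3,4,5)] by blast
    then show "x = c N (X (om u M))" using perm[of \<sigma> M' N'] * by simp
  qed (use MN in blast)
  have "X (om u M) = (\<Sum>N\<in>Pow K. \<phi> (card M) (card N) (card (M \<inter> N)) *s om u N)"
    if "M \<subseteq> K" for M
  proof -
    have "(\<Sum>N\<in>Pow K. c N (X (om u M)) *s om u N) =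
        (\<Sum>N\<in>Pow K. \<phi> (card M) (card N) (card (M \<inter> N)) *s om u N)"
      using \<phi>[OF that] by (intro sum.cong) auto
    with exp_X[OF that] show ?thesis by (rule trans)
  qed
  then show ?thesis by blast
qed

lemma ex_Alg_on_sector:
  assumes X: "sp_comm X" "\<And>v. v \<in> Fock \<Longrightarrow> X v \<in> Fock"
    and u: "sector s u K"
  shows "\<exists>A\<in>Alg. \<forall>M. M \<subseteq> K \<and> card M = k \<longrightarrow> A (om u M) = X (om u M)"
proof -
  note ref = sector_reference[OF u]
  have K: "K \<subseteq> {..<L}" using ref by (simp add: reference_def)
  then have fin: "finite K" by (rule finite_subset) simp
  obtain \<phi> where \<phi>: "\<And>M. M \<subseteq> K \<Longrightarrow>
    X (om u M) = (\<Sum>N\<in>Pow K. \<phi> (card M) (card N) (card (M \<inter> N)) *s om u N)"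
    using sp_comm_om_kernel[OF X u] by blast
  have "\<forall>k'. \<exists>A. A \<in> Alg \<and> (\<forall>M. M \<subseteq> K \<and> card M = k \<longrightarrow>
    A (om u M) = (\<Sum>N | N \<subseteq> K \<and> card N = k'. \<phi> k k' (card (M \<inter> N)) *s om u N))"
    using ex_Alg_kernel[OF ref] by (simp add: Bex_def)
  from choice[OF this] obtain A where A: "\<And>k'. A k' \<in> Alg"
    "\<And>k' M. M \<subseteq> K \<Longrightarrow> card M = k \<Longrightarrow>
      A k' (om u M) = (\<Sum>N | N \<subseteq> K \<and> card N = k'. \<phi> k k' (card (M \<inter> N)) *s om u N)"
    by blast
  have "(\<Sum>k'\<le>card K. A k' (om u M)) = X (om u M)" if M: "M \<subseteq> K" "card M = k" for M
  proof -
    have "X (om u M) = (\<Sum>k'\<in>{..card K}. \<Sum>N | N \<in> Pow K \<and> card N = k'.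
        \<phi> k (card N) (card (M \<inter> N)) *s om u N)"
      unfolding \<phi>[OF M(1)] M(2) using fin
      by (intro sum.group[symmetric]) (auto intro: card_mono)
    also have "\<dots> = (\<Sum>k'\<le>card K. A k' (om u M))"
      using A(2)[OF M] by (intro sum.cong) (auto intro: sum.cong)
    finally show ?thesis by simp
  qed
  moreover have "(\<lambda>v. \<Sum>k'\<le>card K. A k' v) \<in> Alg" using A(1) by (intro Alg_sum) auto
  ultimately show ?thesis by (intro bexI[of _ "\<lambda>v. \<Sum>k'\<le>card K. A k' v"]) auto
qed

theorem sp_comm_in_Alg:
  assumes X: "sp_comm X" "\<And>v. v \<in> Fock \<Longrightarrow> X v \<in> Fock"
  shows "\<exists>A\<in>Alg. \<forall>v\<in>Fock. X v = A v"
proof -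
  define us where "us s = (if s = 0 then vac else cr True 0 vac)" for s :: nat
  define Ks where "Ks s = (if s = 0 then {..<L} else {1..<L})" for s :: nat
  have sec: "sector s (us s) (Ks s)" if "s < 2" for s
    using that by (auto simp: sector_def us_def Ks_def)
  \<comment> \<open>A strict upper bound for the weights s + 2 * card M with s < 2 and card M at
    most L.\<close>
  define n where "n = 2 * L + 2"
  \<comment> \<open>The weight k encodes the sector and the number of pairs: k mod 2 is s and k div
    2 is card M.\<close>
  have "\<forall>k. \<exists>A. A \<in> Alg \<and> (\<forall>M. M \<subseteq> Ks (k mod 2) \<and> card M = k div 2 \<longrightarrow>
      A (om (us (k mod 2)) M) = X (om (us (k mod 2)) M))"
  proof
    fix k
    have "k mod 2 < (2::nat)" by simp
    from ex_Alg_on_sector[OF X sec[OF this], of "k div 2"]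
    show "\<exists>A. A \<in> Alg \<and> (\<forall>M. M \<subseteq> Ks (k mod 2) \<and> card M = k div 2 \<longrightarrow>
      A (om (us (k mod 2)) M) = X (om (us (k mod 2)) M))" by blast
  qed
  from choice[OF this] obtain A where A: "\<And>k. A k \<in> Alg"
    "\<And>k M. M \<subseteq> Ks (k mod 2) \<Longrightarrow> card M = k div 2 \<Longrightarrow>
      A k (om (us (k mod 2)) M) = X (om (us (k mod 2)) M)"
    by blast
  have "\<forall>k. \<exists>P. P \<in> Alg \<and> (\<forall>v. num v = of_nat k *s v \<longrightarrow> P v = v) \<and>
    (\<forall>j\<in>{..<n} - {k}. \<forall>v. num v = of_nat j *s v \<longrightarrow> P v = 0)"
  proof
    fix k
    show "\<exists>P. P \<in> Alg \<and> (\<forall>v. num v = of_nat k *s v \<longrightarrow> P v = v) \<and>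
      (\<forall>j\<in>{..<n} - {k}. \<forall>v. num v = of_nat j *s v \<longrightarrow> P v = 0)"
      using ex_Alg_weight_projection[of "{..<n} - {k}" k] by blast
  qed
  from choice[OF this] obtain P where "\<forall>k. P k \<in> Alg \<and> (\<forall>v. num v = of_nat k *s v \<longrightarrow> P k v = v) \<and>
    (\<forall>j\<in>{..<n} - {k}. \<forall>v. num v = of_nat j *s v \<longrightarrow> P k v = 0)" by blast
  then have P: "\<And>k. P k \<in> Alg" "\<And>k v. num v = of_nat k *s v \<Longrightarrow> P k v = v"
    "\<And>k j v. j < n \<Longrightarrow> j \<noteq> k \<Longrightarrow> num v = of_nat j *s v \<Longrightarrow> P k v = 0"
    by blast+
  \<comment> \<open>\<open>P k\<close> isolates weight k before \<open>A k\<close> acts, so B agrees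
    with X on all reference products at once; since both commute with sp, they then agree on
    \<open>Fock\<close>.\<close>
  define B where "B v = (\<Sum>k<n. A k (P k v))" for v
  have B: "B \<in> Alg" unfolding B_def[abs_def] by (rule Alg_sum) (rule Alg.comp[OF A(1) P(1)])
  have BX: "B (om (us s) M) = X (om (us s) M)" if s: "s < 2" and M: "M \<subseteq> Ks s" for s M
  proof -
    define k where "k = s + 2 * card M"
    have MsubL: "M \<subseteq> {..<L}" using M by (auto simp: Ks_def split: if_splits)
    then have "card M \<le> L" using card_mono[of "{..<L}" M] by simp
    then have k: "k < n" "k mod 2 = s" "k div 2 = card M" using s by (auto simp: k_def n_def)
    have num: "num (om (us s) M) = of_nat k *s om (us s) M"
      unfolding k_def by (rule num_om[OF MsubL sector_num[OF sec[OF s]]])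
    have "B (om (us s) M) = (\<Sum>j<n. if j = k then A k (om (us s) M) else 0)"
      unfolding B_def
    proof (intro sum.cong refl)
      fix j assume "j \<in> {..<n}"
      show "A j (P j (om (us s) M)) = (if j = k then A k (om (us s) M) else 0)"
        using P(2)[OF num] P(3)[OF k(1) _ num, of j] module_hom.zero[OF hom_Alg[OF A(1)]] by auto
    qed
    also have "\<dots> = X (om (us s) M)" using A(2)[of M k] k M by simp
    finally show ?thesis .
  qed
  have "X v - B v = 0" if "v \<in> Fock" for v
  proof (rule sp_comm_zero_on_Fock[OF sp_comm_diff[OF X(1) sp_comm_Alg[OF B]] _ _ that])
    show "X (om vac M) - B (om vac M) = 0" if "M \<subseteq> {..<L}" for M
      using BX[of 0 M] that by (simp add: us_def Ks_def)
    show "X (om (cr True 0 vac) M) - B (om (cr True 0 vac) M) = 0" if "M \<subseteq> {1..<L}" for M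
      using BX[of 1 M] that by (simp add: us_def Ks_def)
  qed
  then show ?thesis using B by (intro bexI[of _ B]) auto
qed

end

section \<open>Staggered fermions\<close>

lemma sum_even_odd:
  fixes t :: "nat \<Rightarrow> 'a::comm_monoid_add"
  shows "(\<Sum>j<2 * L. t j) = (\<Sum>i<L. t (2 * i) + t (2 * i + 1))"
  by (induction L) (simp_all add: add.assoc)

text \<open>\<open>F j\<close> and \<open>Fd j\<close> model the chain operators at site j + 1, so
  the anticommutator sign becomes - ((- 1) ^ j). The functional \<open>ev\<close> is the vacuum
  coefficient.\<close>

locale staggered_fermions = vector_space scale
  for scale :: "complex \<Rightarrow> 'v::ab_group_add \<Rightarrow> 'v" (infixr "*s" 75) +
  fixes L :: nat and F Fd :: "nat \<Rightarrow> 'v \<Rightarrow> 'v" and vac :: 'v and ev :: "'v \<Rightarrow> complex"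
  assumes L_pos: "0 < L"
    and hom_F: "\<And>j. module_hom scale scale (F j)"
    and hom_Fd: "\<And>j. module_hom scale scale (Fd j)"
    and Fd_Fd: "\<And>j k v. j < 2 * L \<Longrightarrow> k < 2 * L \<Longrightarrow> Fd j (Fd k v) = - Fd k (Fd j v)"
    and F_F: "\<And>j k v. j < 2 * L \<Longrightarrow> k < 2 * L \<Longrightarrow> F j (F k v) = - F k (F j v)"
    and F_Fd: "\<And>j k v. j < 2 * L \<Longrightarrow> k < 2 * L \<Longrightarrow>
      F j (Fd k v) = (if j = k then (- ((- 1) ^ j)) *s v else 0) - Fd k (F j v)"
    and F_vac: "\<And>j. j < 2 * L \<Longrightarrow> F j vac = 0"
    and ev_add: "\<And>u v. ev (u + v) = ev u + ev v"
    and ev_scale: "\<And>c v. ev (c *s v) = c * ev v"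
    and ev_vac: "ev vac = 1"
    and ev_Fd: "\<And>j v. j < 2 * L \<Longrightarrow> ev (Fd j v) = 0"
begin

definition lincomb :: "(nat \<Rightarrow> 'v \<Rightarrow> 'v) \<Rightarrow> (nat \<Rightarrow> complex) \<Rightarrow> 'v \<Rightarrow> 'v" where
  "lincomb G x v = (\<Sum>j<2 * L. x j *s G j v)"

abbreviation CR :: "(nat \<Rightarrow> complex) \<Rightarrow> 'v \<Rightarrow> 'v" where "CR \<equiv> lincomb Fd"
abbreviation AN :: "(nat \<Rightarrow> complex) \<Rightarrow> 'v \<Rightarrow> 'v" where "AN \<equiv> lincomb F"

text \<open>The anticommutator of \<open>AN x\<close> with \<open>CR y\<close>. It is symmetric; the
  symplectic form appears only through the signs in \<open>beta\<close>.\<close>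

definition bform :: "(nat \<Rightarrow> complex) \<Rightarrow> (nat \<Rightarrow> complex) \<Rightarrow> complex" where
  "bform x y = (\<Sum>j<2 * L. - ((- 1) ^ j) * x j * y j)"

text \<open>The sign is its own inverse and cancels the one in the anticommutator, so every mode is
  counted with weight +1.\<close>

definition num :: "'v \<Rightarrow> 'v" where "num v = (\<Sum>j<2 * L. (- ((- 1) ^ j)) *s Fd j (F j v))"

lemma hom_lincomb:
  assumes "\<And>j. module_hom scale scale (G j)"
  shows "module_hom scale scale (lincomb G x)"
  by (intro module_hom.intro module_hom_axioms.intro module_axioms)
    (simp_all add: lincomb_def module_hom.add[OF assms] module_hom.scale[OF assms] scale_right_distrib
      sum.distrib scale_sum_right mult.commute)

lemma hom_CR: "module_hom scale scale (CR x)"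
  and hom_AN: "module_hom scale scale (AN x)"
  by (simp_all add: hom_lincomb hom_F hom_Fd)

lemma hom_num: "module_hom scale scale num"
  by (intro module_hom.intro module_hom_axioms.intro module_axioms)
    (simp_all add: num_def module_hom.add[OF hom_F] module_hom.scale[OF hom_F]
      module_hom.add[OF hom_Fd] module_hom.scale[OF hom_Fd] scale_right_distrib sum.distrib
      scale_sum_right mult.commute sum_negf sum_subtractf)

lemma lincomb_cong: "(\<And>j. j < 2 * L \<Longrightarrow> x j = y j) \<Longrightarrow> lincomb G x v = lincomb G y v"
  unfolding lincomb_def by (intro sum.cong) auto

lemma lincomb_add: "lincomb G (\<lambda>j. x j + y j) v = lincomb G x v + lincomb G y v"
  by (simp add: lincomb_def scale_left_distrib sum.distrib)

lemma lincomb_diff: "lincomb G (\<lambda>j. x j - y j) v = lincomb G x v - lincomb G y v"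
  by (simp add: lincomb_def scale_left_diff_distrib sum_subtractf)

lemma lincomb_cmult: "lincomb G (\<lambda>j. c * x j) v = c *s lincomb G x v"
  by (simp add: lincomb_def scale_sum_right)

lemma lincomb_minus: "lincomb G (\<lambda>j. - x j) v = - lincomb G x v"
  by (simp add: lincomb_def sum_negf)

lemma lincomb_lincomb:
  assumes "\<And>j. module_hom scale scale (G j)"
  shows "lincomb G x (lincomb H y v) = (\<Sum>j<2 * L. \<Sum>k<2 * L. (x j * y k) *s G j (H k v))"
  by (simp add: lincomb_def module_hom.sum[OF assms] module_hom.scale[OF assms] scale_sum_right)

lemma lincomb_anticommute:
  assumes "\<And>j. module_hom scale scale (G j)"
    "\<And>j k v. j < 2 * L \<Longrightarrow> k < 2 * L \<Longrightarrow> G j (G k v) = - G k (G j v)"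
  shows "lincomb G x (lincomb G y v) = - lincomb G y (lincomb G x v)"
proof -
  have "lincomb G x (lincomb G y v) = (\<Sum>j<2 * L. \<Sum>k<2 * L. (x j * y k) *s (- G k (G j v)))"
    unfolding lincomb_lincomb[OF assms(1)]
  proof (intro sum.cong refl)
    fix j k assume "j \<in> {..<2 * L}" "k \<in> {..<2 * L}"
    then show "(x j * y k) *s G j (G k v) = (x j * y k) *s (- G k (G j v))"
      by (subst assms(2)) simp_all
  qed
  also have "\<dots> = - (\<Sum>j<2 * L. \<Sum>k<2 * L. (y k * x j) *s G k (G j v))"
    by (simp add: sum_negf mult.commute)
  also have "\<dots> = - lincomb G y (lincomb G x v)"
    unfolding lincomb_lincomb[OF assms(1)] by (subst sum.swap) (rule refl)
  finally show ?thesis .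
qed

lemma CR_CR: "CR x (CR y v) = - CR y (CR x v)"
  by (rule lincomb_anticommute[OF hom_Fd Fd_Fd])

lemma AN_AN: "AN x (AN y v) = - AN y (AN x v)"
  by (rule lincomb_anticommute[OF hom_F F_F])

lemma AN_CR: "AN x (CR y v) = bform x y *s v - CR y (AN x v)"
proof -
  have "AN x (CR y v) = (\<Sum>j<2 * L. \<Sum>k<2 * L.
      (if j = k then (- ((- 1) ^ j) * x j * y k) *s v else 0) - (y k * x j) *s Fd k (F j v))"
    unfolding lincomb_lincomb[OF hom_F] using F_Fd
    by (intro sum.cong) (auto simp: scale_right_diff_distrib mult_ac)
  also have "\<dots> = bform x y *s v - (\<Sum>j<2 * L. \<Sum>k<2 * L. (y k * x j) *s Fd k (F j v))"
    unfolding sum_subtractf by (simp add: bform_def scale_sum_left)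
  also have "(\<Sum>j<2 * L. \<Sum>k<2 * L. (y k * x j) *s Fd k (F j v)) = CR y (AN x v)"
    unfolding lincomb_lincomb[OF hom_Fd] by (subst sum.swap) (rule refl)
  finally show ?thesis .
qed

lemma num_Fd:
  assumes "k < 2 * L"
  shows "num (Fd k v) = Fd k v + Fd k (num v)"
proof -
  have "num (Fd k v) = (\<Sum>j<2 * L. (if j = k then Fd k v else 0) +
      Fd k ((- ((- 1) ^ j)) *s Fd j (F j v)))"
    unfolding num_def
  proof (intro sum.cong refl)
    fix j assume "j \<in> {..<2 * L}"
    then have j: "j < 2 * L" by simp
    have "Fd j (F j (Fd k v)) = (if j = k then (- ((- 1) ^ j)) *s Fd k v else 0) + Fd k (Fd j (F j v))"
      using F_Fd[OF j assms, of v] Fd_Fd[OF j assms, of "F j v"]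
      by (auto simp: module_hom.diff[OF hom_Fd] module_hom.scale[OF hom_Fd] module_hom.zero[OF hom_Fd]
        module_hom.neg[OF hom_Fd])
    then show "(- ((- 1) ^ j)) *s Fd j (F j (Fd k v)) =
        (if j = k then Fd k v else 0) + Fd k ((- ((- 1) ^ j)) *s Fd j (F j v))"
      by (simp add: scale_right_distrib module_hom.scale[OF hom_Fd] module_hom.neg[OF hom_Fd]
        flip: power_add mult_2)
  qed
  also have "\<dots> = Fd k v + Fd k (num v)"
    using assms by (simp add: sum.distrib num_def module_hom.sum[OF hom_Fd])
  finally show ?thesis .
qed

lemma num_F:
  assumes "k < 2 * L"
  shows "num (F k v) = F k (num v) - F k v"
proof -
  have "F k (num v) = (\<Sum>j<2 * L. (if j = k then F k v else 0) +
      (- ((- 1) ^ j)) *s Fd j (F j (F k v)))"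
    unfolding num_def module_hom.sum[OF hom_F]
  proof (intro sum.cong refl)
    fix j assume "j \<in> {..<2 * L}"
    then have j: "j < 2 * L" by simp
    have "F k (Fd j (F j v)) = (if j = k then (- ((- 1) ^ j)) *s F k v else 0) + Fd j (F j (F k v))"
      using F_Fd[OF assms j, of "F j v"] F_F[OF j assms, of v]
      by (auto simp: module_hom.neg[OF hom_Fd])
    then show "F k ((- ((- 1) ^ j)) *s Fd j (F j v)) =
        (if j = k then F k v else 0) + (- ((- 1) ^ j)) *s Fd j (F j (F k v))"
      by (simp add: scale_right_distrib module_hom.scale[OF hom_F] module_hom.neg[OF hom_F]
        flip: power_add mult_2)
  qed
  also have "\<dots> = F k v + num (F k v)"
    using assms unfolding sum.distrib num_def by simp
  finally show ?thesis by simp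
qed

lemma num_CR: "num (CR x v) = CR x v + CR x (num v)"
  by (simp add: lincomb_def module_hom.sum[OF hom_num] module_hom.scale[OF hom_num] num_Fd
    scale_right_distrib sum.distrib)

lemma num_AN: "num (AN x v) = AN x (num v) - AN x v"
  by (simp add: lincomb_def module_hom.sum[OF hom_num] module_hom.scale[OF hom_num] num_F
    scale_right_diff_distrib sum_subtractf)

definition Pc :: "nat \<Rightarrow> nat \<Rightarrow> complex" where
  "Pc i j = (if j = 2 * i \<or> j = 2 * i + 1 then 1 else 0)"
definition Qc :: "nat \<Rightarrow> nat \<Rightarrow> complex" where
  "Qc i j = (if 2 * i < j then 1 / 2 else - 1 / 2)"

text \<open>These coefficients make \<open>cr True i\<close>, \<open>cr False i\<close> a symplectic basis for the form
  given by \<open>sl2_e\<close>: the sum over ordered pairs of \<open>Fd a * Fd b\<close> becomes the sum of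
  \<open>cr True i * cr False i\<close>.\<close>

definition cr :: "bool \<Rightarrow> nat \<Rightarrow> 'v \<Rightarrow> 'v" where "cr b i = CR (if b then Pc i else Qc i)"
text \<open>The coefficients are exchanged relative to \<open>cr\<close>: \<open>bform\<close> pairs
  \<open>Pc i\<close> with \<open>Qc i\<close> and vanishes within each of the two families.\<close>

definition an :: "bool \<Rightarrow> nat \<Rightarrow> 'v \<Rightarrow> 'v" where "an b i = AN (if b then Qc i else Pc i)"

lemma bform_pairs:
  "bform x y = (\<Sum>i<L. x (2 * i + 1) * y (2 * i + 1) - x (2 * i) * y (2 * i))"
  unfolding bform_def sum_even_odd by (intro sum.cong) (simp_all add: power_add)

lemma bform_Pc:
  assumes "i < L"
  shows "bform (Pc i) y = y (2 * i + 1) - y (2 * i)"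
proof -
  have "bform (Pc i) y = (\<Sum>k<L. if k = i then y (2 * k + 1) - y (2 * k) else 0)"
    unfolding bform_pairs by (intro sum.cong) (auto simp: Pc_def)
  then show ?thesis using assms by simp
qed

lemma bform_commute: "bform x y = bform y x"
  unfolding bform_def by (intro sum.cong) auto

lemma bform_Pc_Pc: "i < L \<Longrightarrow> bform (Pc i) (Pc k) = 0"
  using bform_Pc[of i "Pc k"] by (auto simp: Pc_def)

lemma bform_Pc_Qc: "i < L \<Longrightarrow> bform (Pc i) (Qc k) = (if i = k then 1 else 0)"
  using bform_Pc[of i "Qc k"] by (auto simp: Qc_def)

text \<open>A block 2 * l, 2 * l + 1 on which both step functions are constant contributes 0. For
  distinct i and k the blocks i and k contribute 1/2 and -1/2; for i = k the single block cancels
  internally.\<close>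

lemma bform_Qc_Qc:
  assumes "i < L" "k < L"
  shows "bform (Qc i) (Qc k) = 0"
proof -
  have "bform (Qc i) (Qc k) = (\<Sum>l<L. (if l = i then (if k < i then 1/2 else if i < k then - 1/2 else 0) else 0)
      + (if l = k then (if i < k then 1/2 else if k < i then - 1/2 else 0) else 0))"
    unfolding bform_pairs by (intro sum.cong refl) (auto simp: Qc_def)
  then show ?thesis using assms by (auto simp: sum.distrib)
qed

sublocale fock_pairs scale L cr an num vac ev
proof unfold_locales
  show "0 < L" by (rule L_pos)
  fix b c i j v
  show "\<And>b i. cr b i (u + v) = cr b i u + cr b i v" for u v
    by (simp add: cr_def module_hom.add[OF hom_CR])
  show "\<And>b i. cr b i (a *s v) = a *s cr b i v" for a v
    by (simp add: cr_def module_hom.scale[OF hom_CR])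
  show "\<And>b i. an b i (u + v) = an b i u + an b i v" for u v
    by (simp add: an_def module_hom.add[OF hom_AN])
  show "\<And>b i. an b i (a *s v) = a *s an b i v" for a v
    by (simp add: an_def module_hom.scale[OF hom_AN])
  show "num (u + v) = num u + num v" for u v
    by (rule module_hom.add[OF hom_num])
  show "num (a *s v) = a *s num v" for a v
    by (rule module_hom.scale[OF hom_num])
  show "cr b i (cr c j v) = - cr c j (cr b i v)" unfolding cr_def by (rule CR_CR)
  show "an b i (an c j v) = - an c j (an b i v)" unfolding an_def by (rule AN_AN)
  show "an b i vac = 0" by (simp add: an_def lincomb_def F_vac)
  show "num (cr b i v) = cr b i v + cr b i (num v)" unfolding cr_def by (rule num_CR)
  show "num (an b i v) = an b i (num v) - an b i v" unfolding an_def by (rule num_AN)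
  show "num vac = 0" by (simp add: num_def F_vac module_hom.zero[OF hom_Fd])
  show "ev (u + v) = ev u + ev v" for u v by (rule ev_add)
  show "ev (a *s v) = a * ev v" for a v by (rule ev_scale)
  show "ev vac = 1" by (rule ev_vac)
  have ev_sum: "ev (sum g A) = (\<Sum>x\<in>A. ev (g x))" if "finite A" for g and A :: "nat set"
    using that ev_scale[of 0 0] by (induction A) (simp_all add: ev_add)
  show "ev (cr b i v) = 0" by (simp add: cr_def lincomb_def ev_sum ev_scale ev_Fd)
  assume "i < L" "j < L"
  then show "an b i (cr c j v) = (if b = c \<and> i = j then v else 0) - cr c j (an b i v)"
    unfolding an_def cr_def AN_CR
    using bform_Pc_Pc[of i j] bform_Pc_Qc[of i j] bform_Qc_Qc[of i j] bform_Pc_Qc[of j i] bform_commute[of "Qc i" "Pc j"]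
    by (cases b; cases c) auto
qed

end

section \<open>Generation by the Temperley--Lieb operators\<close>

context staggered_fermions
begin

definition alpha :: "nat \<Rightarrow> nat \<Rightarrow> complex" where
  "alpha j k = (if k = j then 1 else if j + 1 < 2 * L \<and> k = j + 1 then 1
     else if j + 1 = 2 * L \<and> k = 0 then - 1 else 0)"
text \<open>The functional dual to \<open>alpha j\<close> under the symplectic form: the alternating
  sign turns the symmetric \<open>bform\<close> into the antisymmetric \<open>omega\<close>.\<close>

definition beta :: "nat \<Rightarrow> nat \<Rightarrow> complex" where
  "beta j k = (- 1) ^ (j + 1) * alpha j k"
text \<open>The symplectic form on the vectors \<open>alpha\<close>; only cyclic neighbours
  couple.\<close>

definition omega :: "nat \<Rightarrow> nat \<Rightarrow> complex" where
  "omega j k = (- 1) ^ (j + 1) * bform (alpha j) (alpha k)"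

definition tl_op :: "nat \<Rightarrow> 'v \<Rightarrow> 'v" where "tl_op j v = AN (alpha j) (CR (alpha j) v)"

text \<open>The symmetric product of x and y as an operator on the exterior algebra, where x' and y'
  are meant to be the functionals dual to x and y.\<close>

definition spgen :: "(nat \<Rightarrow> complex) \<Rightarrow> (nat \<Rightarrow> complex) \<Rightarrow> (nat \<Rightarrow> complex) \<Rightarrow> (nat \<Rightarrow> complex) \<Rightarrow> 'v \<Rightarrow> 'v"
  where "spgen x x' y y' v = CR x (AN y' v) + CR y (AN x' v)"

lemma bform_alpha:
  assumes "j < 2 * L"
  shows "(- 1) ^ (j + 1) * bform (alpha j) y =
    (if j + 1 < 2 * L then y j - y (j + 1) else y j + y 0)"
proof -
  have "bform (alpha j) y = (\<Sum>k<2 * L. (if k = j then - ((- 1) ^ j) * y j else 0) +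
      (if k = (if j + 1 < 2 * L then j + 1 else 0)
       then (if j + 1 < 2 * L then (- 1) ^ j * y (j + 1) else y 0) else 0))"
    unfolding bform_def using assms by (intro sum.cong) (auto simp: alpha_def)
  also have "\<dots> = - ((- 1) ^ j) * y j + (if j + 1 < 2 * L then (- 1) ^ j * y (j + 1) else y 0)"
    using assms L_pos by (simp add: sum.distrib)
  finally have B: "bform (alpha j) y =
    - ((- 1) ^ j) * y j + (if j + 1 < 2 * L then (- 1) ^ j * y (j + 1) else y 0)" .
  show ?thesis
  proof (cases "j + 1 < 2 * L")
    case True
    have "(- 1 :: complex) ^ j * (- 1) ^ j = 1" by (simp flip: power_add mult_2)
    then show ?thesis unfolding B using True by (simp add: algebra_simps flip: mult.assoc)
  next
    case False
    then have "odd j" using assms by presburger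
    then show ?thesis unfolding B using False by simp
  qed
qed

lemma omega_antisym: "j < 2 * L \<Longrightarrow> k < 2 * L \<Longrightarrow> omega k j = - omega j k"
  unfolding omega_def by (subst (1 2) bform_alpha) (auto simp: alpha_def)

lemma omega_self: "j < 2 * L \<Longrightarrow> omega j j = 0"
  using omega_antisym[of j j] by simp

text \<open>The value is -1, or -2 for L = 1, where the direct coupling and the one around the chain
  coincide.\<close>

lemma omega_next: "j + 1 < 2 * L \<Longrightarrow> omega j (j + 1) \<noteq> 0"
  unfolding omega_def by (subst bform_alpha) (auto simp: alpha_def)

lemma beta_alpha: "AN (beta j) (CR (alpha k) v) = omega j k *s v - CR (alpha k) (AN (beta j) v)"
proof -
  have "bform (beta j) (alpha k) = omega j k"
    by (simp add: bform_def omega_def beta_def[abs_def] sum_distrib_left mult_ac)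
  then show ?thesis unfolding AN_CR by simp
qed

lemma AN_beta: "AN (beta j) v = (- 1) ^ (j + 1) *s AN (alpha j) v"
  unfolding beta_def[abs_def] by (rule lincomb_cmult)

text \<open>\<open>alpha j\<close> is isotropic for \<open>bform\<close>, so its creator and
  annihilator anticommute and may be exchanged.\<close>

lemma alpha_beta_eq_tl_op:
  assumes "j < 2 * L"
  shows "CR (alpha j) (AN (beta j) v) = (- 1) ^ j *s tl_op j v"
proof -
  have "bform (alpha j) (alpha j) = 0" using omega_self[OF assms] by (simp add: omega_def)
  then show ?thesis
    by (simp add: tl_op_def AN_beta AN_CR module_hom.scale[OF hom_CR] module_hom.neg[OF hom_CR])
qed

text \<open>In the symmetric square this is the bracket of \<open>v\<^sub>j v\<^sub>k\<close> with
  half the square of \<open>v\<^sub>m\<close>. An operator commuting with both arguments commutes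
  with the right-hand side, which is how new products are reached.\<close>

lemma spgen_commutator:
  assumes "j < 2 * L" "k < 2 * L" "m < 2 * L"
  shows "spgen (alpha j) (beta j) (alpha k) (beta k) (CR (alpha m) (AN (beta m) v)) -
      CR (alpha m) (AN (beta m) (spgen (alpha j) (beta j) (alpha k) (beta k) v)) =
    omega k m *s spgen (alpha j) (beta j) (alpha m) (beta m) v +
    omega j m *s spgen (alpha k) (beta k) (alpha m) (beta m) v"
  using omega_antisym[OF assms(1,3)] omega_antisym[OF assms(2,3)]
    CR_CR[of "alpha j" "alpha m" "AN (beta k) (AN (beta m) v)"]
    CR_CR[of "alpha k" "alpha m" "AN (beta j) (AN (beta m) v)"]
    AN_AN[of "beta m" "beta j" v] AN_AN[of "beta m" "beta k" v]
  by (simp add: spgen_def beta_alpha module_hom.add[OF hom_CR] module_hom.add[OF hom_AN]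
    module_hom.diff[OF hom_CR] module_hom.scale[OF hom_CR] module_hom.neg[OF hom_CR]
    scale_right_distrib algebra_simps)

lemma spgen_commute: "spgen x x' y y' v = spgen y y' x x' v"
  by (simp add: spgen_def add.commute)

lemma lincomb_alpha_even: "i < L \<Longrightarrow> lincomb G (alpha (2 * i)) v = lincomb G (Pc i) v"
  by (intro lincomb_cong) (auto simp: alpha_def Pc_def)

lemma lincomb_beta_even: "i < L \<Longrightarrow> lincomb G (beta (2 * i)) v = - lincomb G (Pc i) v"
  unfolding lincomb_minus[symmetric] by (intro lincomb_cong) (auto simp: alpha_def beta_def Pc_def)

lemma lincomb_alpha_odd: "i + 1 < L \<Longrightarrow> lincomb G (alpha (2 * i + 1)) v = lincomb G (Qc i) v - lincomb G (Qc (i + 1)) v"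
  unfolding lincomb_diff[symmetric] by (intro lincomb_cong) (auto simp: alpha_def Qc_def)

lemma lincomb_alpha_last: "lincomb G (alpha (2 * (L - 1) + 1)) v = lincomb G (Qc (L - 1)) v + lincomb G (Qc 0) v"
  unfolding lincomb_add[symmetric] using L_pos by (intro lincomb_cong) (auto simp: alpha_def Qc_def)

lemma lincomb_beta_odd: "lincomb G (beta (2 * i + 1)) v = lincomb G (alpha (2 * i + 1)) v"
  by (intro lincomb_cong) (simp add: beta_def)

context
  fixes X :: "'v \<Rightarrow> 'v"
  assumes hom_X: "module_hom scale scale X"
    and X_tl_op: "\<And>j v. j < 2 * L \<Longrightarrow> X (tl_op j v) = tl_op j (X v)"
begin

lemmas X_simps = module_hom.add[OF hom_X] module_hom.scale[OF hom_X] module_hom.neg[OF hom_X]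
  module_hom.diff[OF hom_X] module_hom.zero[OF hom_X]

abbreviation spgen_alpha :: "nat \<Rightarrow> nat \<Rightarrow> 'v \<Rightarrow> 'v" where
  "spgen_alpha j k \<equiv> spgen (alpha j) (beta j) (alpha k) (beta k)"

lemma X_alpha_beta:
  assumes "j < 2 * L"
  shows "X (CR (alpha j) (AN (beta j) v)) = CR (alpha j) (AN (beta j) (X v))"
  using assms by (simp add: alpha_beta_eq_tl_op X_simps X_tl_op)

lemma X_spgen_diag: "j < 2 * L \<Longrightarrow> X (spgen_alpha j j v) = spgen_alpha j j (X v)"
  by (simp add: spgen_def X_simps X_alpha_beta)

lemma X_spgen_step:
  assumes jkm: "j < 2 * L" "k < 2 * L" "m < 2 * L"
    and jk: "\<And>v. X (spgen_alpha j k v) = spgen_alpha j k (X v)"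
  shows "X (omega k m *s spgen_alpha j m v + omega j m *s spgen_alpha k m v) =
    omega k m *s spgen_alpha j m (X v) + omega j m *s spgen_alpha k m (X v)"
  unfolding spgen_commutator[OF jkm, symmetric]
  by (simp add: X_simps jk X_alpha_beta[OF jkm(3)])

lemma scale_cancel: "c \<noteq> 0 \<Longrightarrow> c *s x = c *s y \<Longrightarrow> x = y" for c :: complex
  by simp

text \<open>Bracket of the squares at k and k + 1: both terms of the commutator coincide, whence the
  factor 2.\<close>

lemma X_spgen_next:
  assumes "k + 1 < 2 * L"
  shows "X (spgen_alpha k (k + 1) v) = spgen_alpha k (k + 1) (X v)"
proof (rule scale_cancel)
  show "2 * omega k (k + 1) \<noteq> 0" using omega_next[OF assms] by simp
  have two: "(2 * c) *s x = c *s x + c *s x" for c x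
    by (simp only: mult_2 scale_left_distrib)
  have k: "k < 2 * L" using assms by simp
  show "(2 * omega k (k + 1)) *s X (spgen_alpha k (k + 1) v) = (2 * omega k (k + 1)) *s spgen_alpha k (k + 1) (X v)"
    using X_spgen_step[OF k k assms X_spgen_diag[OF k], of v] by (simp only: two X_simps)
qed

text \<open>Bracketing the product of j and k with the square at k + 1 yields the product of j and k
  + 1. The other term, present when j itself couples to k + 1, is a product of neighbours and
  already settled.\<close>

lemma X_spgen_le:
  assumes "j \<le> k" "k < 2 * L"
  shows "X (spgen_alpha j k v) = spgen_alpha j k (X v)"
  using assms
proof (induction k arbitrary: v rule: dec_induct)
  case base
  then show ?case by (rule X_spgen_diag)
next
  case (step k)
  have *: "X (omega k (k + 1) *s spgen_alpha j (k + 1) v + omega j (k + 1) *s spgen_alpha k (k + 1) v) =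
    omega k (k + 1) *s spgen_alpha j (k + 1) (X v) + omega j (k + 1) *s spgen_alpha k (k + 1) (X v)"
    using step by (intro X_spgen_step) auto
  have "X (spgen_alpha k (k + 1) v) = spgen_alpha k (k + 1) (X v)"
    using step by (intro X_spgen_next) simp
  with * have "omega k (k + 1) *s X (spgen_alpha j (k + 1) v) = omega k (k + 1) *s spgen_alpha j (k + 1) (X v)"
    by (simp add: X_simps)
  then show ?case using omega_next[of k] step by simp
qed

lemma X_spgen:
  assumes "j < 2 * L" "k < 2 * L"
  shows "X (spgen_alpha j k v) = spgen_alpha j k (X v)"
proof (cases "j \<le> k")
  case True
  then show ?thesis using assms by (intro X_spgen_le)
next
  case False
  then show ?thesis
    using X_spgen_le[of k j v] assms
    unfolding spgen_commute[of "alpha j" "beta j" "alpha k" "beta k"] by simp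
qed

text \<open>The twist at the last site makes the telescoping differences of the \<open>Qc i\<close> sum to
  \<open>2 * Qc 0\<close>, so they span the same space as the \<open>Qc i\<close>.\<close>

lemma X_spgen_Qc:
  assumes "\<And>i v. i < L \<Longrightarrow>
    X (spgen (alpha (2 * i + 1)) (beta (2 * i + 1)) y y' v) = spgen (alpha (2 * i + 1)) (beta (2 * i + 1)) y y' (X v)"
  and "i < L"
  shows "X (spgen (Qc i) (Qc i) y y' v) = spgen (Qc i) (Qc i) y y' (X v)"
proof -
  \<comment> \<open>The failure of X to commute. It is constant in i by telescoping, while the
    twisted last generator gives H (L - 1) = - H 0, so it vanishes.\<close>
  define H where "H i = X (spgen (Qc i) (Qc i) y y' v) - spgen (Qc i) (Qc i) y y' (X v)" for i
  have tele: "spgen (alpha (2 * i + 1)) (beta (2 * i + 1)) y y' v =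
      spgen (Qc i) (Qc i) y y' v - spgen (Qc (i + 1)) (Qc (i + 1)) y y' v" if "i + 1 < L" for i v
    using lincomb_alpha_odd[OF that]
    by (simp add: spgen_def lincomb_beta_odd[simplified] module_hom.diff[OF hom_CR])
  have "H i = H (i + 1)" if "i + 1 < L" for i
  proof -
    have "X (spgen (Qc i) (Qc i) y y' v - spgen (Qc (i + 1)) (Qc (i + 1)) y y' v) =
        spgen (Qc i) (Qc i) y y' (X v) - spgen (Qc (i + 1)) (Qc (i + 1)) y y' (X v)"
      using assms(1)[of i v] that unfolding tele[OF that] by simp
    then show ?thesis by (simp add: H_def X_simps algebra_simps)
  qed
  then have H0: "H i = H 0" if "i < L" for i
    using that by (induction i) auto
  have last: "spgen (alpha (2 * (L - 1) + 1)) (beta (2 * (L - 1) + 1)) y y' v =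
      spgen (Qc (L - 1)) (Qc (L - 1)) y y' v + spgen (Qc 0) (Qc 0) y y' v" for v
    by (simp only: spgen_def lincomb_beta_odd lincomb_alpha_last module_hom.add[OF hom_CR]) simp
  have "X (spgen (Qc (L - 1)) (Qc (L - 1)) y y' v + spgen (Qc 0) (Qc 0) y y' v) =
      spgen (Qc (L - 1)) (Qc (L - 1)) y y' (X v) + spgen (Qc 0) (Qc 0) y y' (X v)"
    using assms(1)[of "L - 1" v] L_pos unfolding last by simp
  then have "H (L - 1) = - H 0" by (simp add: H_def X_simps algebra_simps)
  then have "H 0 = 0" using H0[of "L - 1"] L_pos eq_neg_self_iff[of "H 0"] by simp
  then show ?thesis using H0[OF assms(2)] by (simp add: H_def)
qed

lemma sp_comm_of_tl_op: "sp_comm X"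
proof -
  have PP: "X (spgen_alpha (2 * i) (2 * k) v) = spgen_alpha (2 * i) (2 * k) (X v)" if "i < L" "k < L" for i k v
    using that by (intro X_spgen) auto
  \<comment> \<open>The even \<open>alpha\<close> are the \<open>Pc\<close>. The odd ones are traded
    for \<open>Qc\<close> in one factor here, and in the other factor below by the symmetry of
    \<open>spgen\<close>.\<close>
  have Qa: "X (spgen (Qc i) (Qc i) (alpha k) (beta k) v) = spgen (Qc i) (Qc i) (alpha k) (beta k) (X v)"
    if "i < L" "k < 2 * L" for i k v
    using that by (intro X_spgen_Qc X_spgen) auto
  have QQ: "X (spgen (Qc i) (Qc i) (Qc k) (Qc k) v) = spgen (Qc i) (Qc i) (Qc k) (Qc k) (X v)"
    if "i < L" "k < L" for i k v
  proof (rule X_spgen_Qc[OF _ that(1)])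
    fix j v assume j: "j < L"
    have "X (spgen (Qc k) (Qc k) (alpha (2 * j + 1)) (beta (2 * j + 1)) v) =
      spgen (Qc k) (Qc k) (alpha (2 * j + 1)) (beta (2 * j + 1)) (X v)"
      using j that by (intro Qa) auto
    then show "X (spgen (alpha (2 * j + 1)) (beta (2 * j + 1)) (Qc k) (Qc k) v) =
      spgen (alpha (2 * j + 1)) (beta (2 * j + 1)) (Qc k) (Qc k) (X v)"
      by (simp only: spgen_commute[of "alpha (2 * j + 1)"])
  qed
  show ?thesis
    unfolding sp_comm_def
  proof (intro conjI allI impI hom_X)
    fix i k v assume ik: "i < L" "k < L"
    show "X (tP i k v) = tP i k (X v)"
    proof -
      have "tP i k v = - spgen_alpha (2 * i) (2 * k) v" for v
        using ik by (simp add: tP_def spgen_def cr_def an_def lincomb_alpha_even lincomb_beta_even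
          module_hom.neg[OF hom_CR])
      then show ?thesis using PP[OF ik, of v] by (simp add: X_simps)
    qed
    show "X (tQ i k v) = tQ i k (X v)"
      using QQ[OF ik, of v] by (simp add: tQ_def spgen_def cr_def an_def)
    show "X (tM i k v) = tM i k (X v)"
    proof -
      have "tM k' i' v = spgen (Qc i') (Qc i') (alpha (2 * k')) (beta (2 * k')) v" if "k' < L" for i' k' v
        using that by (simp add: tM_def spgen_def cr_def an_def lincomb_alpha_even lincomb_beta_even
          module_hom.neg[OF hom_CR])
      then show ?thesis using Qa[of k "2 * i" v] ik by simp
    qed
  qed
qed

end

text \<open>The converse direction: up to sign each \<open>tl_op\<close> is half the square of
  \<open>p\<^sub>i\<close>, of \<open>q\<^sub>i - q\<^sub>i\<^sub>+\<^sub>1\<close> or of the sum of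
  the last and the first q, and expanding the square leaves only root operators and
  \<open>tQ\<close>.\<close>

lemma tl_op_of_sp_comm:
  assumes A: "sp_comm A" and j: "j < 2 * L"
  shows "A (tl_op j v) = tl_op j (A v)"
proof -
  note hom = sp_commD(1)[OF A]
  have tl_op: "tl_op j v = (- 1) ^ j *s CR (alpha j) (AN (beta j) v)" for v
    unfolding alpha_beta_eq_tl_op[OF j] by (simp flip: power_add mult_2)
  have rl: "A (root_up i v) = root_up i (A v)" "A (root_down i v) = root_down i (A v)" if "i < L" for i v
    using sp_comm_root_up_root_down[OF A that] by auto
  obtain i where i: "i < L" "j = 2 * i \<or> j = 2 * i + 1"
    using j by (metis evenE oddE less_mult_imp_div_less mult.commute nonzero_mult_div_cancel_left
      add_lessD1 nat_mult_less_cancel1 zero_less_numeral)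
  have "A (CR (alpha j) (AN (beta j) v)) = CR (alpha j) (AN (beta j) (A v))"
  proof (cases "j = 2 * i")
    case True
    have "CR (alpha j) (AN (beta j) v) = - root_up i v" for v
      unfolding True using i(1)
      by (simp add: lincomb_alpha_even lincomb_beta_even root_up_def cr_def an_def module_hom.neg[OF hom_CR])
    then show ?thesis using rl(1)[OF i(1)] by (simp add: module_hom.neg[OF hom])
  next
    case False
    then have ji: "j = 2 * i + 1" using i by simp
    show ?thesis
    proof (cases "i + 1 < L")
      case True
      have "CR (alpha j) (AN (beta j) v) = root_down i v - tQ i (i + 1) v + root_down (i + 1) v" for v
        unfolding ji lincomb_beta_odd lincomb_alpha_odd[OF True]
        by (simp add: tQ_def root_down_def cr_def an_def module_hom.diff[OF hom_CR] algebra_simps)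
      then show ?thesis
        using rl(2)[OF i(1)] rl(2)[OF True] sp_commD(3)[OF A i(1) True]
        by (simp add: module_hom.add[OF hom] module_hom.diff[OF hom])
    next
      case False
      then have iL: "i = L - 1" using i by simp
      have "CR (alpha j) (AN (beta j) v) = root_down i v + tQ i 0 v + root_down 0 v" for v
        unfolding ji iL lincomb_beta_odd lincomb_alpha_last
        by (simp add: tQ_def root_down_def cr_def an_def module_hom.add[OF hom_CR] algebra_simps)
      then show ?thesis
        using rl(2)[OF i(1)] rl(2)[OF L_pos] sp_commD(3)[OF A i(1) L_pos]
        by (simp add: module_hom.add[OF hom])
    qed
  qed
  then show ?thesis by (simp add: tl_op module_hom.scale[OF hom])
qed

end

section \<open>Pair sums and translation\<close>

lemma sum_cyclic_shift:
  fixes t :: "nat \<Rightarrow> 'a::comm_monoid_add"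
  assumes "0 < L"
  shows "(\<Sum>i<L. t (if i + 1 < L then i + 1 else 0)) = (\<Sum>i<L. t i)"
proof -
  obtain M where L: "L = Suc M" using assms gr0_conv_Suc by blast
  have "(\<Sum>i<M. t (if i + 1 < Suc M then i + 1 else 0)) = (\<Sum>i<M. t (Suc i))"
    by (intro sum.cong) auto
  then have "(\<Sum>i<L. t (if i + 1 < L then i + 1 else 0)) = (\<Sum>i<M. t (Suc i)) + t 0"
    unfolding L sum.lessThan_Suc by simp
  also have "\<dots> = (\<Sum>i<L. t i)"
    unfolding L sum.lessThan_Suc_shift by (rule add.commute)
  finally show ?thesis .
qed

context staggered_fermions
begin

lemma lincomb_Pc:
  assumes "i < L"
  shows "lincomb G (Pc i) v = G (2 * i) v + G (2 * i + 1) v"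
proof -
  have "lincomb G (Pc i) v = (\<Sum>k<L. if k = i then G (2 * k) v + G (2 * k + 1) v else 0)"
    unfolding lincomb_def sum_even_odd by (intro sum.cong) (auto simp: Pc_def)
  then show ?thesis using assms by simp
qed

text \<open>For a in the block of i, \<open>Qc i b\<close> is half the sign of b - a except at b =
  a, where the square of \<open>G a\<close> vanishes. The sum is therefore half the signed double
  sum over all a and b, and anticommutation folds it onto a < b.\<close>

lemma sum_Pc_Qc:
  assumes hom: "\<And>j. module_hom scale scale (G j)"
    and anti: "\<And>j k v. j < 2 * L \<Longrightarrow> k < 2 * L \<Longrightarrow> G j (G k v) = - G k (G j v)"
  shows "(\<Sum>i<L. lincomb G (Pc i) (lincomb G (Qc i) v)) =
    (\<Sum>a<2 * L. \<Sum>b<2 * L. if a < b then G a (G b v) else 0)"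
proof -
  define g where "g a b = (1 / 2) *s G a (G b v)" for a b
  have g_anti: "g a b = - g b a" if "a < 2 * L" "b < 2 * L" for a b
    unfolding g_def by (subst anti[OF that]) simp
  have g_same: "g a a = 0" if "a < 2 * L" for a
    using g_anti[OF that that] eq_neg_self_iff by blast
  have g_double: "g a b + g a b = G a (G b v)" for a b
    unfolding g_def by (simp flip: scale_left_distrib)
  define h where "h a = (\<Sum>b<2 * L. if a < b then g a b else - g a b)" for a
  have h: "G a (lincomb G (Qc i) v) = h a" if "a = 2 * i \<or> a = 2 * i + 1" "i < L" for a i
  proof -
    have "a < 2 * L" using that by auto
    have "G a (lincomb G (Qc i) v) = (\<Sum>b<2 * L. Qc i b *s G a (G b v))"
      unfolding lincomb_def module_hom.sum[OF hom] module_hom.scale[OF hom] ..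
    also have "\<dots> = h a"
      unfolding h_def
    proof (intro sum.cong refl)
      fix b assume "b \<in> {..<2 * L}"
      show "Qc i b *s G a (G b v) = (if a < b then g a b else - g a b)"
      proof (cases "a = b")
        case True
        then have "G a (G b v) = 0" using g_double[of a a] g_same[OF \<open>a < 2 * L\<close>] by simp
        then show ?thesis using True by (simp add: g_def)
      next
        case False
        then show ?thesis using that(1) by (auto simp: Qc_def g_def)
      qed
    qed
    finally show ?thesis .
  qed
  have "(\<Sum>i<L. lincomb G (Pc i) (lincomb G (Qc i) v)) = (\<Sum>i<L. h (2 * i) + h (2 * i + 1))"
    by (intro sum.cong refl) (simp only: lincomb_Pc lessThan_iff h simp_thms)
  also have "\<dots> = (\<Sum>a<2 * L. h a)" by (rule sum_even_odd[symmetric])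
  also have "\<dots> = (\<Sum>a<2 * L. \<Sum>b<2 * L. (if a < b then g a b else 0) + (if b < a then g b a else 0))"
    unfolding h_def
  proof (intro sum.cong refl)
    fix a b assume "a \<in> {..<2 * L}" "b \<in> {..<2 * L}"
    then have ab: "a < 2 * L" "b < 2 * L" by auto
    show "(if a < b then g a b else - g a b) = (if a < b then g a b else 0) + (if b < a then g b a else 0)"
      using g_anti[OF ab] g_same[OF ab(1)] by (cases a b rule: linorder_cases) auto
  qed
  also have "\<dots> = (\<Sum>a<2 * L. \<Sum>b<2 * L. if a < b then g a b else 0) +
      (\<Sum>a<2 * L. \<Sum>b<2 * L. if b < a then g b a else 0)"
    by (simp only: sum.distrib)
  also have "(\<Sum>a<2 * L. \<Sum>b<2 * L. if b < a then g b a else 0) =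
      (\<Sum>a<2 * L. \<Sum>b<2 * L. if a < b then g a b else 0)"
    by (rule sum.swap)
  also have "(\<Sum>a<2 * L. \<Sum>b<2 * L. if a < b then g a b else 0) +
      (\<Sum>a<2 * L. \<Sum>b<2 * L. if a < b then g a b else 0) =
      (\<Sum>a<2 * L. \<Sum>b<2 * L. if a < b then G a (G b v) else 0)"
    unfolding sum.distrib[symmetric] g_double[symmetric] by (intro sum.cong) auto
  finally show ?thesis .
qed

lemma e_eq_pair_sum: "e v = (\<Sum>a<2 * L. \<Sum>b<2 * L. if a < b then Fd a (Fd b v) else 0)"
proof -
  have "e v = (\<Sum>i<L. CR (Pc i) (CR (Qc i) v))" by (simp add: e_def d_def cr_def)
  also have "\<dots> = (\<Sum>a<2 * L. \<Sum>b<2 * L. if a < b then Fd a (Fd b v) else 0)"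
    by (rule sum_Pc_Qc[OF hom_Fd Fd_Fd])
  finally show ?thesis .
qed

lemma f_eq_pair_sum: "f v = (\<Sum>a<2 * L. \<Sum>b<2 * L. if a < b then F a (F b v) else 0)"
proof -
  have "f v = (\<Sum>i<L. AN (Pc i) (AN (Qc i) v))" by (simp add: f_def D_def an_def)
  also have "\<dots> = (\<Sum>a<2 * L. \<Sum>b<2 * L. if a < b then F a (F b v) else 0)"
    by (rule sum_Pc_Qc[OF hom_F F_F])
  finally show ?thesis .
qed

lemma lincomb_alpha_pair: "j + 1 < 2 * L \<Longrightarrow> lincomb G (alpha j) v = G j v + G (j + 1) v"
proof -
  assume j: "j + 1 < 2 * L"
  have "lincomb G (alpha j) v = (\<Sum>k<2 * L. (if k = j then G k v else 0) + (if k = j + 1 then G k v else 0))"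
    unfolding lincomb_def using j by (intro sum.cong) (auto simp: alpha_def)
  then show ?thesis using j by (simp add: sum.distrib)
qed

lemma lincomb_alpha_twist: "lincomb G (alpha (2 * L - 1)) v = G (2 * L - 1) v - G 0 v"
proof -
  have L1: "1 < 2 * L" using L_pos by simp
  have "lincomb G (alpha (2 * L - 1)) v =
      (\<Sum>k<2 * L. (if k = 2 * L - 1 then G k v else 0) - (if k = 0 then G k v else 0))"
    unfolding lincomb_def by (intro sum.cong) (use L1 in \<open>auto simp: alpha_def\<close>)
  then show ?thesis using L_pos by (simp add: sum_subtractf)
qed

text \<open>Inverts the symplectic basis: \<open>Fd 0\<close> is half the sum of all
  \<open>p\<^sub>i\<close> minus \<open>q\<^sub>0\<close>, and each later \<open>Fd (m + 1)\<close>
  is the two-site sum at m minus \<open>Fd m\<close>.\<close>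

lemma Fock_Fd:
  assumes v: "v \<in> Fock" and "m < 2 * L"
  shows "Fd m v \<in> Fock"
  using assms(2)
proof (induction m)
  case 0
  have "(\<Sum>i<L. cr True i v) = (\<Sum>j<2 * L. Fd j v)"
    unfolding sum_even_odd by (intro sum.cong) (simp_all add: cr_def lincomb_Pc)
  then have "(1 / 2) *s (\<Sum>i<L. cr True i v) - cr False 0 v =
      (\<Sum>j<2 * L. (1 / 2 - Qc 0 j) *s Fd j v)"
    by (simp add: cr_def lincomb_def scale_sum_right scale_left_diff_distrib sum_subtractf)
  also have "\<dots> = (\<Sum>j<2 * L. if j = 0 then Fd j v else 0)"
    by (intro sum.cong) (auto simp: Qc_def)
  also have "\<dots> = Fd 0 v" using L_pos by simp
  finally have "Fd 0 v = (1 / 2) *s (\<Sum>i<L. cr True i v) - cr False 0 v" ..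
  moreover have "cr True i v \<in> Fock" if "i < L" for i using Fock_cr[OF v that] .
  moreover have "cr False 0 v \<in> Fock" using Fock_cr[OF v L_pos] .
  ultimately show ?case unfolding Fock_def by (auto intro!: span_diff span_scale span_sum)
next
  case (Suc m)
  have "CR (alpha m) v \<in> Fock"
  proof (cases "even m")
    case True
    then obtain i where i: "m = 2 * i" "i < L" using Suc.prems by (auto elim!: evenE)
    then show ?thesis using Fock_cr[OF v, of i True] by (simp add: lincomb_alpha_even cr_def)
  next
    case False
    then obtain i where i: "m = 2 * i + 1" "i + 1 < L" using Suc.prems by (auto elim!: oddE)
    have "cr False i v \<in> Fock" "cr False (i + 1) v \<in> Fock" using Fock_cr[OF v] i by auto
    then show ?thesis
      unfolding i(1) lincomb_alpha_odd[OF i(2)] Fock_def by (simp add: cr_def span_diff)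
  qed
  moreover have "Fd (Suc m) v = CR (alpha m) v - Fd m v"
    using lincomb_alpha_pair[of m] Suc.prems by simp
  ultimately show ?case using Suc unfolding Fock_def by (simp add: span_diff)
qed

section \<open>Translation by two sites\<close>

context
  fixes U :: "'v \<Rightarrow> 'v"
  assumes hom_U: "module_hom scale scale U"
    and U_Fd: "\<And>j v. j < 2 * L \<Longrightarrow>
      U (Fd j v) = (if j + 2 < 2 * L then Fd (j + 2) (U v) else - Fd (j + 2 - 2 * L) (U v))"
    and U_F: "\<And>j v. j < 2 * L \<Longrightarrow>
      U (F j v) = (if j + 2 < 2 * L then F (j + 2) (U v) else - F (j + 2 - 2 * L) (U v))"
begin

definition shift :: "(nat \<Rightarrow> complex) \<Rightarrow> nat \<Rightarrow> complex" where
  "shift x j = (if j < 2 then - x (j + 2 * L - 2) else x (j - 2))"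

lemma U_lincomb:
  assumes "\<And>j v. j < 2 * L \<Longrightarrow>
      U (G j v) = (if j + 2 < 2 * L then G (j + 2) (U v) else - G (j + 2 - 2 * L) (U v))"
  shows "U (lincomb G x v) = lincomb G (shift x) (U v)"
proof -
  obtain M where L: "L = Suc M" using L_pos gr0_conv_Suc by blast
  have L2: "2 * L = Suc (Suc (2 * M))" using L by simp
  have "U (lincomb G x v) = (\<Sum>j<2 * L. x j *s U (G j v))"
    by (simp add: lincomb_def module_hom.sum[OF hom_U] module_hom.scale[OF hom_U])
  also have "\<dots> = (\<Sum>j<2 * M. x j *s U (G j v)) + x (2 * M) *s U (G (2 * M) v)
      + x (2 * M + 1) *s U (G (2 * M + 1) v)"
    by (simp add: L2)
  also have "(\<Sum>j<2 * M. x j *s U (G j v)) = (\<Sum>j<2 * M. x j *s G (j + 2) (U v))"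
    using assms L by (intro sum.cong) auto
  also have "U (G (2 * M) v) = - G 0 (U v)" using assms[of "2 * M"] L by simp
  also have "U (G (2 * M + 1) v) = - G 1 (U v)" using assms[of "2 * M + 1"] L by simp
  finally have "U (lincomb G x v) = (\<Sum>j<2 * M. x j *s G (j + 2) (U v)) - x (2 * M) *s G 0 (U v)
      - x (2 * M + 1) *s G 1 (U v)"
    by simp
  moreover have "lincomb G (shift x) (U v) = shift x 0 *s G 0 (U v) + (shift x 1 *s G 1 (U v) +
      (\<Sum>j<2 * M. shift x (j + 2) *s G (j + 2) (U v)))"
    unfolding lincomb_def L2 sum.lessThan_Suc_shift by simp
  moreover have "shift x 0 = - x (2 * M)" "shift x 1 = - x (2 * M + 1)" "shift x (j + 2) = x j" for j
    by (simp_all add: shift_def L2)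
  ultimately show ?thesis by simp
qed

lemma lincomb_shift_Pc:
  assumes "i < L"
  shows "lincomb G (shift (Pc i)) v = (if i + 1 < L then lincomb G (Pc (i + 1)) v else - lincomb G (Pc 0) v)"
proof (cases "i + 1 < L")
  case True
  then have "lincomb G (shift (Pc i)) v = lincomb G (Pc (i + 1)) v"
    by (intro lincomb_cong) (auto simp: shift_def Pc_def)
  then show ?thesis using True by simp
next
  case False
  then have i: "i = L - 1" using assms by simp
  have "shift (Pc i) j = - Pc 0 j" if "j < 2 * L" for j
    using L_pos that by (cases "j = 0"; cases "j = 1") (auto simp: shift_def Pc_def i)
  then have "lincomb G (shift (Pc i)) v = lincomb G (\<lambda>j. - Pc 0 j) v"
    by (rule lincomb_cong)
  then show ?thesis using False by (simp add: lincomb_minus)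
qed

text \<open>The antiperiodic sign turns the tail of \<open>Qc i\<close> that wraps around, with
  values 1/2, into the first two values -1/2 of \<open>Qc (i + 1)\<close>; the last step function
  returns as minus the first.\<close>

lemma lincomb_shift_Qc:
  assumes "i < L"
  shows "lincomb G (shift (Qc i)) v = (if i + 1 < L then lincomb G (Qc (i + 1)) v else - lincomb G (Qc 0) v)"
proof (cases "i + 1 < L")
  case True
  then have "lincomb G (shift (Qc i)) v = lincomb G (Qc (i + 1)) v"
    by (intro lincomb_cong) (auto simp: shift_def Qc_def)
  then show ?thesis using True by simp
next
  case False
  then have i: "i = L - 1" using assms by simp
  have "shift (Qc i) j = - Qc 0 j" if "j < 2 * L" for j
    using L_pos that by (cases "j = 0"; cases "j = 1") (auto simp: shift_def Qc_def i)
  then have "lincomb G (shift (Qc i)) v = lincomb G (\<lambda>j. - Qc 0 j) v"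
    by (rule lincomb_cong)
  then show ?thesis using False by (simp add: lincomb_minus)
qed

text \<open>A pair that wraps around picks up two signs, which cancel, so translation permutes the
  pair creators cyclically.\<close>

lemma U_d: "i < L \<Longrightarrow> U (d i v) = d (if i + 1 < L then i + 1 else 0) (U v)"
  using U_lincomb[of Fd, OF U_Fd] by (simp add: d_def cr_def lincomb_shift_Pc lincomb_shift_Qc module_hom.neg[OF hom_CR])

lemma U_D: "i < L \<Longrightarrow> U (D i v) = D (if i + 1 < L then i + 1 else 0) (U v)"
  using U_lincomb[of F, OF U_F] by (simp add: D_def an_def lincomb_shift_Pc lincomb_shift_Qc module_hom.neg[OF hom_AN])

lemma U_e: "U (e v) = e (U v)"
proof -
  have "U (e v) = (\<Sum>i<L. d (if i + 1 < L then i + 1 else 0) (U v))"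
    unfolding e_def module_hom.sum[OF hom_U] by (intro sum.cong refl U_d) simp
  then show ?thesis
    using sum_cyclic_shift[OF L_pos, of "\<lambda>i. d i (U v)"] by (simp add: e_def)
qed

lemma U_f: "U (f v) = f (U v)"
proof -
  have "U (f v) = (\<Sum>i<L. D (if i + 1 < L then i + 1 else 0) (U v))"
    unfolding f_def module_hom.sum[OF hom_U] by (intro sum.cong refl U_D) simp
  then show ?thesis
    using sum_cyclic_shift[OF L_pos, of "\<lambda>i. D i (U v)"] by (simp add: f_def)
qed

lemma U_num: "U (num v) = num (U v)"
proof -
  define t where "t j = (- ((- 1) ^ j)) *s Fd j (F j (U v))" for j :: nat
  have num: "num w = (\<Sum>i<L. (- ((- 1) ^ (2 * i))) *s Fd (2 * i) (F (2 * i) w) +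
      (- ((- 1) ^ (2 * i + 1))) *s Fd (2 * i + 1) (F (2 * i + 1) w))" for w
    unfolding num_def sum_even_odd ..
  define s where "s i = t (2 * i) + t (2 * i + 1)" for i
  have "U (num v) = (\<Sum>i<L. s (if i + 1 < L then i + 1 else 0))"
    unfolding num module_hom.sum[OF hom_U]
  proof (intro sum.cong refl)
    fix i assume "i \<in> {..<L}"
    then have i: "2 * i < 2 * L" "2 * i + 1 < 2 * L" "i < L" by auto
    show "U ((- ((- 1) ^ (2 * i))) *s Fd (2 * i) (F (2 * i) v) +
      (- ((- 1) ^ (2 * i + 1))) *s Fd (2 * i + 1) (F (2 * i + 1) v)) =
      s (if i + 1 < L then i + 1 else 0)"
    proof (cases "i + 1 < L")
      case True
      then show ?thesis using i
        by (simp add: module_hom.add[OF hom_U] module_hom.scale[OF hom_U] module_hom.neg[OF hom_U]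
          module_hom.diff[OF hom_U] U_Fd U_F s_def t_def)
    next
      case False
      then have "i = L - 1" using i by simp
      then have "2 * i + 2 - 2 * L = 0" "2 * i + 1 + 2 - 2 * L = 1" using L_pos by auto
      then show ?thesis using i False
        by (simp add: module_hom.add[OF hom_U] module_hom.scale[OF hom_U] module_hom.neg[OF hom_U]
          module_hom.diff[OF hom_U] U_Fd U_F s_def t_def module_hom.neg[OF hom_Fd])
    qed
  qed
  also have "\<dots> = (\<Sum>i<L. s i)" by (rule sum_cyclic_shift[OF L_pos])
  also have "\<dots> = num (U v)" unfolding num s_def t_def ..
  finally show ?thesis .
qed

end

end

section \<open>Matrices as operators\<close>

text \<open>An \<open>n \<times> n\<close> matrix acts on the infinite-dimensional space \<open>nat \<Rightarrow> complex\<close> through the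
  digit \<open>s mod n\<close> of the index and trivially on \<open>s div n\<close>. The action is unital, so the
  anticommutation relations hold for operators on a whole type.\<close>

definition act :: "nat \<Rightarrow> complex mat \<Rightarrow> (nat \<Rightarrow> complex) \<Rightarrow> nat \<Rightarrow> complex" where
  "act n A v s = (\<Sum>r<n. A $$ (s mod n, r) * v (r + n * (s div n)))"

definition fscale :: "complex \<Rightarrow> (nat \<Rightarrow> complex) \<Rightarrow> nat \<Rightarrow> complex" where
  "fscale c v s = c * v s"

interpretation fn: vector_space fscale
  by unfold_locales (auto simp: fscale_def fun_eq_iff algebra_simps)

lemma hom_act: "module_hom fscale fscale (act n A)"
  by unfold_locales (auto simp: act_def fscale_def fun_eq_iff algebra_simps sum.distrib sum_distrib_left)

context
  fixes n :: nat
  assumes n: "0 < n"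
begin

lemma act_add:
  assumes "A \<in> carrier_mat n n" "B \<in> carrier_mat n n"
  shows "act n (A + B) v = act n A v + act n B v"
  using assms n by (auto simp: act_def fun_eq_iff algebra_simps sum.distrib)

lemma act_smult:
  assumes "A \<in> carrier_mat n n"
  shows "act n (c \<cdot>\<^sub>m A) v = fscale c (act n A v)"
  using assms n by (auto simp: act_def fscale_def fun_eq_iff mult.assoc sum_distrib_left)

lemma act_uminus:
  assumes "A \<in> carrier_mat n n"
  shows "act n (- A) v = - act n A v"
  using assms n by (auto simp: act_def fun_eq_iff sum_negf)

lemma act_minus:
  assumes "A \<in> carrier_mat n n" "B \<in> carrier_mat n n"
  shows "act n (A - B) v = act n A v - act n B v"
  using assms n by (auto simp: act_def fun_eq_iff algebra_simps sum_subtractf)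

lemma act_one: "act n (1\<^sub>m n) v = v"
proof
  fix s
  have "act n (1\<^sub>m n) v s = (\<Sum>r<n. if r = s mod n then v (r + n * (s div n)) else 0)"
    unfolding act_def using n by (intro sum.cong) auto
  also have "\<dots> = v (s mod n + n * (s div n))" using n by simp
  finally show "act n (1\<^sub>m n) v s = v s" by simp
qed

lemma act_mult:
  assumes "A \<in> carrier_mat n n" "B \<in> carrier_mat n n"
  shows "act n (A * B) v = act n A (act n B v)"
proof
  fix s
  have "act n (A * B) v s =
      (\<Sum>r<n. \<Sum>k<n. A $$ (s mod n, k) * B $$ (k, r) * v (r + n * (s div n)))"
    unfolding act_def using assms n
    by (intro sum.cong refl) (auto simp: scalar_prod_def sum_distrib_right atLeast0LessThan)
  also have "\<dots> = (\<Sum>k<n. \<Sum>r<n. A $$ (s mod n, k) * B $$ (k, r) * v (r + n * (s div n)))"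
    by (rule sum.swap)
  also have "\<dots> = act n A (act n B v) s"
    unfolding act_def by (intro sum.cong refl) (simp add: sum_distrib_left mult.assoc)
  finally show "act n (A * B) v s = act n A (act n B v) s" .
qed

lemma act_entry:
  assumes "i < n" "j < n"
  shows "act n A (\<lambda>s. if s = j then 1 else 0) i = A $$ (i, j)"
proof -
  have "act n A (\<lambda>s. if s = j then 1 else 0) i = (\<Sum>r<n. if r = j then A $$ (i, r) else 0)"
    unfolding act_def using assms by (intro sum.cong) auto
  then show ?thesis using assms by simp
qed

text \<open>The copy of the state space with s div n = 0; the action on it determines a
  matrix.\<close>

definition supported :: "(nat \<Rightarrow> complex) set" where
  "supported = {v. \<forall>s\<ge>n. v s = 0}"

lemma act_eqI:
  assumes "A \<in> carrier_mat n n" "B \<in> carrier_mat n n" "\<And>v. v \<in> supported \<Longrightarrow> act n A v = act n B v"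
  shows "A = B"
proof (rule eq_matI)
  fix i j assume "i < dim_row B" "j < dim_col B"
  then have ij: "i < n" "j < n" using assms by auto
  have "(\<lambda>s. if s = j then 1 else 0) \<in> supported" using ij by (auto simp: supported_def)
  then show "A $$ (i, j) = B $$ (i, j)"
    using act_entry[OF ij] assms(3) by metis
qed (use assms in auto)

lemma act_supported: "v \<in> supported \<Longrightarrow> act n A v \<in> supported"
proof -
  assume v: "v \<in> supported"
  have "v (r + n * (s div n)) = 0" if "n \<le> s" for r s
  proof -
    have "1 \<le> s div n" using that n by (simp add: div_greater_zero_iff Suc_le_eq)
    then have "n * 1 \<le> n * (s div n)" by (intro mult_le_mono2)
    then have "n \<le> r + n * (s div n)" by linarith
    then show ?thesis using v by (simp add: supported_def)
  qed
  then show ?thesis by (simp add: supported_def act_def)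
qed

lemma sum_mats_carrier: "sum_mats n F K \<in> carrier_mat n n"
  by (simp add: sum_mats_def)

lemma act_sum_mats:
  assumes "\<And>k. k \<in> K \<Longrightarrow> F k \<in> carrier_mat n n"
  shows "act n (sum_mats n F K) v = (\<Sum>k\<in>K. act n (F k) v)"
proof
  fix s
  have "act n (sum_mats n F K) v s = (\<Sum>r<n. \<Sum>k\<in>K. F k $$ (s mod n, r) * v (r + n * (s div n)))"
    unfolding act_def sum_mats_def using n by (intro sum.cong) (auto simp: sum_distrib_right)
  also have "\<dots> = (\<Sum>k\<in>K. act n (F k) v s)" unfolding act_def by (rule sum.swap)
  also have "\<dots> = (\<Sum>k\<in>K. act n (F k) v) s" by (induction K rule: infinite_finite_induct) auto
  finally show "act n (sum_mats n F K) v s = (\<Sum>k\<in>K. act n (F k) v) s" .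
qed

end

section \<open>Jordan-Wigner operators on bit strings\<close>

definition sg :: "nat \<Rightarrow> nat \<Rightarrow> complex" where
  "sg m s = (- 1) ^ card {k. k < m \<and> bit s k}"

text \<open>Written on coefficients rather than on basis vectors: the value at s is read off from
  the state in which bit m is filled, hence \<open>set_bit\<close> for an annihilator. The number of
  bits is unbounded.\<close>

definition annf :: "nat \<Rightarrow> (nat \<Rightarrow> complex) \<Rightarrow> nat \<Rightarrow> complex" where
  "annf m v s = (if bit s m then 0 else sg m s * v (set_bit m s))"
definition cref :: "nat \<Rightarrow> (nat \<Rightarrow> complex) \<Rightarrow> nat \<Rightarrow> complex" where
  "cref m v s = (if bit s m then sg m s * v (unset_bit m s) else 0)"

lemma sg_sq [simp]: "sg m s * sg m s = 1" "sg m s * (sg m s * x) = x"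
  by (simp_all add: sg_def flip: power_add mult_2 mult.assoc)

lemma sg_set_bit:
  assumes "\<not> bit s k"
  shows "sg m (set_bit k s) = (if k < m then - sg m s else sg m s)"
proof (cases "k < m")
  case True
  have "{i. i < m \<and> bit (set_bit k s) i} = insert k {i. i < m \<and> bit s i}"
    using True by (auto simp: bit_set_bit_iff)
  moreover have "k \<notin> {i. i < m \<and> bit s i}" using assms by simp
  moreover have "finite {i. i < m \<and> bit s i}" by simp
  ultimately show ?thesis using True by (simp add: sg_def)
next
  case False
  then have "{i. i < m \<and> bit (set_bit k s) i} = {i. i < m \<and> bit s i}"
    by (auto simp: bit_set_bit_iff)
  then show ?thesis using False by (simp add: sg_def)
qed

lemma set_unset_bit: "bit s k \<Longrightarrow> set_bit k (unset_bit k s) = (s :: nat)"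
  by (rule bit_eqI) (auto simp: bit_set_bit_iff bit_unset_bit_iff)

lemma unset_set_bit: "\<not> bit s k \<Longrightarrow> unset_bit k (set_bit k s) = (s :: nat)"
  by (rule bit_eqI) (auto simp: bit_set_bit_iff bit_unset_bit_iff)

lemma set_bit_swap: "set_bit k (set_bit m s) = set_bit m (set_bit k (s :: nat))"
  by (rule bit_eqI) (auto simp: bit_set_bit_iff)

lemma unset_bit_swap: "unset_bit k (unset_bit m s) = unset_bit m (unset_bit k (s :: nat))"
  by (rule bit_eqI) (auto simp: bit_unset_bit_iff)

lemma set_unset_bit_swap: "k \<noteq> m \<Longrightarrow> set_bit k (unset_bit m s) = unset_bit m (set_bit k (s :: nat))"
  by (rule bit_eqI) (auto simp: bit_set_bit_iff bit_unset_bit_iff)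

lemma sg_unset_bit:
  assumes "bit s k"
  shows "sg m (unset_bit k s) = (if k < m then - sg m s else sg m s)"
  using sg_set_bit[of "unset_bit k s" k m] set_unset_bit[OF assms]
  by (auto simp: bit_unset_bit_iff)

lemma bit_set_bit_nat: "bit (set_bit k s) m \<longleftrightarrow> k = m \<or> bit (s :: nat) m"
  by (auto simp: bit_set_bit_iff)

lemma bit_unset_bit_nat: "bit (unset_bit k s) m \<longleftrightarrow> k \<noteq> m \<and> bit (s :: nat) m"
  by (auto simp: bit_unset_bit_iff)

lemma annf_annf: "annf m (annf k v) = - annf k (annf m v)"
proof
  fix s show "annf m (annf k v) s = (- annf k (annf m v)) s"
    by (cases m k rule: linorder_cases)
      (auto simp: annf_def bit_set_bit_nat sg_set_bit set_bit_swap[of k m] mult.left_commute)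
qed

lemma cref_cref: "cref m (cref k v) = - cref k (cref m v)"
proof
  fix s show "cref m (cref k v) s = (- cref k (cref m v)) s"
    by (cases m k rule: linorder_cases)
      (auto simp: cref_def bit_unset_bit_nat sg_unset_bit unset_bit_swap[of k m] mult.left_commute)
qed

lemma annf_cref: "annf m (cref k v) = (if m = k then v else 0) - cref k (annf m v)"
proof
  fix s show "annf m (cref k v) s = ((if m = k then v else 0) - cref k (annf m v)) s"
    by (cases m k rule: linorder_cases)
      (auto simp: annf_def cref_def bit_set_bit_nat bit_unset_bit_nat sg_set_bit sg_unset_bit
        set_unset_bit unset_set_bit set_unset_bit_swap mult.left_commute)
qed

lemma set_bit_mod: "m < N \<Longrightarrow> set_bit m s mod 2 ^ N = set_bit m (s mod 2 ^ N :: nat)"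
  unfolding take_bit_eq_mod[symmetric]
  by (rule bit_eqI) (auto simp: bit_set_bit_iff bit_take_bit_iff)

lemma set_bit_div: "m < N \<Longrightarrow> set_bit m s div 2 ^ N = (s div 2 ^ N :: nat)"
  unfolding drop_bit_eq_div[symmetric]
  by (rule bit_eqI) (auto simp: bit_set_bit_iff bit_drop_bit_eq)

lemma set_bit_split: "m < N \<Longrightarrow> set_bit m (s mod 2 ^ N) + 2 ^ N * (s div 2 ^ N) = set_bit m (s :: nat)"
  using mod_mult_div_eq[of "set_bit m s" "2 ^ N"] by (simp add: set_bit_mod set_bit_div)

lemma unset_bit_mod: "m < N \<Longrightarrow> unset_bit m s mod 2 ^ N = unset_bit m (s mod 2 ^ N :: nat)"
  unfolding take_bit_eq_mod[symmetric]
  by (rule bit_eqI) (auto simp: bit_unset_bit_iff bit_take_bit_iff)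

lemma unset_bit_div: "m < N \<Longrightarrow> unset_bit m s div 2 ^ N = (s div 2 ^ N :: nat)"
  unfolding drop_bit_eq_div[symmetric]
  by (rule bit_eqI) (auto simp: bit_unset_bit_iff bit_drop_bit_eq)

lemma unset_bit_split:
  "m < N \<Longrightarrow> unset_bit m (s mod 2 ^ N) + 2 ^ N * (s div 2 ^ N) = unset_bit m (s :: nat)"
  using mod_mult_div_eq[of "unset_bit m s" "2 ^ N"] by (simp add: unset_bit_mod unset_bit_div)

lemma bit_mod: "bit (s mod 2 ^ N) k \<longleftrightarrow> k < N \<and> bit (s :: nat) k"
  unfolding take_bit_eq_mod[symmetric] by (rule bit_take_bit_iff)

lemma sg_mod: "m \<le> N \<Longrightarrow> sg m (s mod 2 ^ N) = sg m s"
proof -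
  assume "m \<le> N"
  then have "{k. k < m \<and> bit (s mod 2 ^ N) k} = {k. k < m \<and> bit s k}" by (auto simp: bit_mod)
  then show ?thesis by (simp add: sg_def)
qed

lemma ann_carrier [simp]: "ann N j \<in> carrier_mat (2 ^ N) (2 ^ N)"
  and cre_carrier [simp]: "cre N j \<in> carrier_mat (2 ^ N) (2 ^ N)"
  by (simp_all add: ann_def cre_def)

text \<open>Bit m and the sign string below it all lie in s mod 2 ^ N, so the digit s div 2 ^ N
  passes through untouched.\<close>

lemma act_ann:
  assumes "m < N"
  shows "act (2 ^ N) (ann N (Suc m)) v = annf m v"
proof
  fix s :: nat
  let ?r = "s mod 2 ^ N"
  have "act (2 ^ N) (ann N (Suc m)) v s =
    (\<Sum>k<2 ^ N. if k = set_bit m ?r \<and> \<not> bit ?r m then sg m k * v (k + 2 ^ N * (s div 2 ^ N)) else 0)"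
    unfolding act_def
  proof (intro sum.cong refl)
    fix k :: nat assume k: "k \<in> {..<2 ^ N}"
    have "bit k m \<and> ?r = unset_bit m k \<longleftrightarrow> k = set_bit m ?r \<and> \<not> bit ?r m"
      using set_unset_bit[of k m] unset_set_bit[of ?r m]
      by (auto simp: bit_set_bit_nat bit_unset_bit_nat)
    moreover have "ann N (Suc m) $$ (?r, k) = (if bit k m \<and> ?r = unset_bit m k then sg m k else 0)"
      using k by (simp add: ann_def sg_def)
    ultimately show "ann N (Suc m) $$ (?r, k) * v (k + 2 ^ N * (s div 2 ^ N)) =
      (if k = set_bit m ?r \<and> \<not> bit ?r m then sg m k * v (k + 2 ^ N * (s div 2 ^ N)) else 0)"
      by simp
  qed
  also have "\<dots> = (if bit s m then 0 else sg m s * v (set_bit m s))"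
  proof (cases "bit ?r m")
    case True
    then show ?thesis by (simp add: bit_mod)
  next
    case False
    have "set_bit m ?r < 2 ^ N" using set_bit_mod[OF assms, of s, symmetric] by simp
    then show ?thesis
      using False assms by (simp add: set_bit_split sg_set_bit sg_mod bit_mod)
  qed
  finally show "act (2 ^ N) (ann N (Suc m)) v s = annf m v s" by (simp add: annf_def)
qed

lemma act_cre:
  assumes "m < N"
  shows "act (2 ^ N) (cre N (Suc m)) v = cref m v"
proof
  fix s :: nat
  let ?r = "s mod 2 ^ N"
  have "act (2 ^ N) (cre N (Suc m)) v s =
    (\<Sum>k<2 ^ N. if k = unset_bit m ?r then (if bit ?r m then sg m ?r * v (k + 2 ^ N * (s div 2 ^ N)) else 0) else 0)"
    unfolding act_def by (intro sum.cong) (auto simp: cre_def ann_def sg_def)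
  also have "\<dots> = (if bit ?r m then sg m ?r * v (unset_bit m ?r + 2 ^ N * (s div 2 ^ N)) else 0)"
  proof -
    have "unset_bit m ?r < 2 ^ N" using unset_bit_mod[OF assms, of s, symmetric] by simp
    then show ?thesis by simp
  qed
  also have "\<dots> = cref m v s" using assms by (simp add: cref_def unset_bit_split sg_mod bit_mod)
  finally show "act (2 ^ N) (cre N (Suc m)) v s = cref m v s" .
qed

section \<open>The spin chain\<close>

definition FF :: "nat \<Rightarrow> nat \<Rightarrow> (nat \<Rightarrow> complex) \<Rightarrow> nat \<Rightarrow> complex" where
  "FF N j = act (2 ^ N) (f_op N (Suc j))"
definition FFd :: "nat \<Rightarrow> nat \<Rightarrow> (nat \<Rightarrow> complex) \<Rightarrow> nat \<Rightarrow> complex" where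
  "FFd N j = act (2 ^ N) (fd_op N (Suc j))"
definition vacuum :: "nat \<Rightarrow> complex" where "vacuum s = (if s = 0 then 1 else 0)"

lemma f_op_carrier [simp]: "f_op N j \<in> carrier_mat (2 ^ N) (2 ^ N)"
  and fd_op_carrier [simp]: "fd_op N j \<in> carrier_mat (2 ^ N) (2 ^ N)"
  by (simp_all add: f_op_def fd_op_def)

lemma ladder_product_carrier [simp]:
  "cre N j * cre N k \<in> carrier_mat (2 ^ N) (2 ^ N)" "ann N j * ann N k \<in> carrier_mat (2 ^ N) (2 ^ N)"
  "cre N j * ann N k \<in> carrier_mat (2 ^ N) (2 ^ N)"
  by (rule mult_carrier_mat[OF cre_carrier cre_carrier] mult_carrier_mat[OF ann_carrier ann_carrier]
      mult_carrier_mat[OF cre_carrier ann_carrier])+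

lemma FF_eq: "j < N \<Longrightarrow> FF N j v = fscale (\<i> ^ Suc j) (annf j v)"
  by (simp add: FF_def f_op_def act_smult act_ann del: power_Suc)

lemma FFd_eq: "j < N \<Longrightarrow> FFd N j v = fscale (\<i> ^ Suc j) (cref j v)"
  by (simp add: FFd_def fd_op_def act_smult act_cre del: power_Suc)

lemma annf_fscale: "annf m (fscale c v) = fscale c (annf m v)"
  by (auto simp: annf_def fscale_def)

lemma cref_fscale: "cref m (fscale c v) = fscale c (cref m v)"
  by (auto simp: cref_def fscale_def)

lemma i_power_sq: "\<i> ^ Suc j * \<i> ^ Suc j = - ((- 1) ^ j)"
proof -
  have "\<i> ^ Suc j * \<i> ^ Suc j = (\<i> * \<i>) ^ Suc j" by (rule power_mult_distrib[symmetric])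
  then show ?thesis by simp
qed

lemma staggered_fermions_FF:
  assumes "0 < L"
  shows "staggered_fermions fscale L (FF (2 * L)) (FFd (2 * L)) vacuum (\<lambda>v. v 0)"
proof (intro staggered_fermions.intro staggered_fermions_axioms.intro)
  show "vector_space fscale" by (rule fn.vector_space_axioms)
  show "module_hom fscale fscale (FF (2 * L) j)" "module_hom fscale fscale (FFd (2 * L) j)" for j
    by (simp_all add: FF_def FFd_def hom_act)
  show "FFd (2 * L) j (FFd (2 * L) k v) = - FFd (2 * L) k (FFd (2 * L) j v)"
    if "j < 2 * L" "k < 2 * L" for j k v
    using that cref_cref[of j k v]
    by (simp add: FFd_eq cref_fscale mult.commute del: power_Suc)
  show "FF (2 * L) j (FF (2 * L) k v) = - FF (2 * L) k (FF (2 * L) j v)"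
    if "j < 2 * L" "k < 2 * L" for j k v
    using that annf_annf[of j k v]
    by (simp add: FF_eq annf_fscale mult.commute del: power_Suc)
  show "FF (2 * L) j (FFd (2 * L) k v) =
      (if j = k then fscale (- ((- 1) ^ j)) v else 0) - FFd (2 * L) k (FF (2 * L) j v)"
    if "j < 2 * L" "k < 2 * L" for j k v
    using that annf_cref[of j k v]
    by (auto simp: FF_eq FFd_eq annf_fscale cref_fscale i_power_sq fn.scale_right_diff_distrib mult.commute
        simp del: power_Suc)
  show "FF (2 * L) j vacuum = 0" if "j < 2 * L" for j
  proof -
    have "set_bit j s \<noteq> 0" for s :: nat
    proof
      assume "set_bit j s = 0"
      moreover have "bit (set_bit j s) j" by (simp add: bit_set_bit_nat)
      ultimately show False by simp
    qed
    then have "annf j vacuum s = 0" for s by (simp only: annf_def vacuum_def if_False if_cancel mult_zero_right)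
    then have "annf j vacuum = 0" by (simp add: fun_eq_iff)
    then show ?thesis using that by (simp add: FF_eq del: power_Suc)
  qed
  show "FFd (2 * L) j v 0 = 0" if "j < 2 * L" for j v
    using that by (simp add: FFd_eq fscale_def cref_def del: power_Suc)
qed (use assms in \<open>auto simp: fscale_def vacuum_def\<close>)

lemma sum_ordered_pairs:
  "(\<Sum>(j1, j2)\<in>ordered_pairs N. h j1 j2) = (\<Sum>a<N. \<Sum>b<N. if a < b then h (Suc a) (Suc b) else 0)"
proof -
  have "(\<Sum>a<N. \<Sum>b<N. if a < b then h (Suc a) (Suc b) else 0) =
      (\<Sum>p\<in>{..<N} \<times> {..<N}. if fst p < snd p then h (Suc (fst p)) (Suc (snd p)) else 0)"
    by (simp add: sum.cartesian_product case_prod_beta)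
  also have "\<dots> = (\<Sum>p\<in>{p \<in> {..<N} \<times> {..<N}. fst p < snd p}. h (Suc (fst p)) (Suc (snd p)))"
    by (rule sum.inter_filter[symmetric]) simp
  also have "\<dots> = (\<Sum>(j1, j2)\<in>ordered_pairs N. h j1 j2)"
    by (rule sum.reindex_bij_witness[of _ "\<lambda>(j1, j2). (j1 - 1, j2 - 1)" "\<lambda>(a, b). (Suc a, Suc b)"])
      (auto simp: ordered_pairs_def)
  finally show ?thesis ..
qed

locale spin_chain =
  fixes L :: nat
  assumes chain_pos: "0 < L"
begin

sublocale staggered_fermions fscale L "FF (2 * L)" "FFd (2 * L)" vacuum "\<lambda>v. v 0"
  by (rule staggered_fermions_FF[OF chain_pos])

abbreviation "n \<equiv> (2 :: nat) ^ (2 * L)"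

lemma TL_e_carrier: "TL_e (2 * L) j \<in> carrier_mat n n"
  by (auto simp: TL_e_def intro!: mult_carrier_mat[of _ n n] minus_carrier_mat)

lemma act_TL_e:
  assumes "j < 2 * L"
  shows "act n (TL_e (2 * L) (Suc j)) v = tl_op j v"
proof (cases "j + 1 < 2 * L")
  case True
  have "act n (TL_e (2 * L) (Suc j)) v = act n ((f_op (2 * L) (Suc j) + f_op (2 * L) (Suc (j + 1))) *
      (fd_op (2 * L) (Suc j) + fd_op (2 * L) (Suc (j + 1)))) v"
    using True by (simp add: TL_e_def)
  also have "\<dots> = tl_op j v"
    unfolding tl_op_def lincomb_alpha_pair[OF True] FF_def FFd_def
    by (simp add: act_mult act_add)
  finally show ?thesis .
next
  case False
  then have j: "j = 2 * L - 1" "Suc j = 2 * L" using assms by auto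
  have "act n (TL_e (2 * L) (Suc j)) v = act n ((f_op (2 * L) (Suc j) - f_op (2 * L) (Suc 0)) *
      (fd_op (2 * L) (Suc j) - fd_op (2 * L) (Suc 0))) v"
    using j(2) by (simp add: TL_e_def)
  also have "\<dots> = act n (f_op (2 * L) (Suc j) - f_op (2 * L) (Suc 0))
      (act n (fd_op (2 * L) (Suc j) - fd_op (2 * L) (Suc 0)) v)"
    by (rule act_mult) (auto intro!: minus_carrier_mat)
  also have "\<dots> = tl_op j v"
    unfolding tl_op_def j(1) lincomb_alpha_twist FF_def FFd_def
    by (simp add: act_minus)
  finally show ?thesis .
qed

lemma sl2_carrier:
  "sl2_e (2 * L) \<in> carrier_mat n n" "sl2_f (2 * L) \<in> carrier_mat n n" "sl2_h (2 * L) \<in> carrier_mat n n"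
  by (auto simp: sl2_e_def sl2_f_def sl2_h_def sum_mats_def intro!: smult_carrier_mat minus_carrier_mat)

text \<open>Since (-1)^j is the square of i^j, the coefficient of a pair is i times the product of
  the two phases contained in the \<open>fd_op\<close>; in the staggered operators all pairs get the
  same weight.\<close>

lemma act_sl2_e: "act n (sl2_e (2 * L)) v = fscale \<i> (e v)"
proof -
  have coeff: "(- 1) ^ (Suc a + Suc b) * \<i> powi (1 - int (Suc a) - int (Suc b)) =
      \<i> * (\<i> ^ Suc a * \<i> ^ Suc b)" for a b
  proof -
    have "(- 1 :: complex) ^ (Suc a + Suc b) = (\<i> ^ Suc a * \<i> ^ Suc b) * (\<i> ^ Suc a * \<i> ^ Suc b)"
    proof -
      have "(\<i> ^ Suc a * \<i> ^ Suc b) * (\<i> ^ Suc a * \<i> ^ Suc b) =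
          (\<i> ^ Suc a * \<i> ^ Suc a) * (\<i> ^ Suc b * \<i> ^ Suc b)"
        by (simp only: mult_ac)
      then show ?thesis unfolding i_power_sq by (simp add: power_add)
    qed
    moreover have "\<i> powi (1 - int (Suc a) - int (Suc b)) = \<i> / (\<i> ^ Suc a * \<i> ^ Suc b)"
    proof -
      have "\<i> powi (1 - int (Suc a) - int (Suc b)) = \<i> powi (1 - int (Suc a)) / \<i> powi int (Suc b)"
        by (rule power_int_diff) simp
      also have "\<i> powi (1 - int (Suc a)) = \<i> powi 1 / \<i> powi int (Suc a)"
        by (rule power_int_diff) simp
      finally show ?thesis unfolding power_int_of_nat by simp
    qed
    ultimately show ?thesis by (simp del: power_Suc)
  qed
  have "act n (sl2_e (2 * L)) v = (\<Sum>(j1, j2)\<in>ordered_pairs (2 * L).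
      act n (((- 1) ^ (j1 + j2) * \<i> powi (1 - int j1 - int j2)) \<cdot>\<^sub>m (cre (2 * L) j1 * cre (2 * L) j2)) v)"
    unfolding sl2_e_def by (subst act_sum_mats) (auto simp: case_prod_beta)
  also have "\<dots> = (\<Sum>a<2 * L. \<Sum>b<2 * L. if a < b then act n (((- 1) ^ (Suc a + Suc b) *
      \<i> powi (1 - int (Suc a) - int (Suc b))) \<cdot>\<^sub>m (cre (2 * L) (Suc a) * cre (2 * L) (Suc b))) v else 0)"
    by (rule sum_ordered_pairs)
  also have "\<dots> = (\<Sum>a<2 * L. \<Sum>b<2 * L. fscale \<i> (if a < b then FFd (2 * L) a (FFd (2 * L) b v) else 0))"
  proof (intro sum.cong refl)
    fix a b assume "a \<in> {..<2 * L}" "b \<in> {..<2 * L}"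
    then have ab: "a < 2 * L" "b < 2 * L" by auto
    have "act n ((\<i> * (\<i> ^ Suc a * \<i> ^ Suc b)) \<cdot>\<^sub>m (cre (2 * L) (Suc a) * cre (2 * L) (Suc b))) v =
        fscale \<i> (FFd (2 * L) a (FFd (2 * L) b v))"
      using ab by (simp add: act_smult act_mult act_cre FFd_eq cref_fscale del: power_Suc)
    then show "(if a < b then act n (((- 1) ^ (Suc a + Suc b) *
      \<i> powi (1 - int (Suc a) - int (Suc b))) \<cdot>\<^sub>m (cre (2 * L) (Suc a) * cre (2 * L) (Suc b))) v else 0) =
      fscale \<i> (if a < b then FFd (2 * L) a (FFd (2 * L) b v) else 0)"
      unfolding coeff by simp
  qed
  also have "\<dots> = fscale \<i> (e v)" unfolding e_eq_pair_sum fn.scale_sum_right ..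
  finally show ?thesis .
qed

lemma act_sl2_f: "act n (sl2_f (2 * L)) v = fscale (- \<i>) (f v)"
proof -
  \<comment> \<open>The same absorption of phases; lowering the exponent by 1 contributes the factor
    1 / i = -i.\<close>
  have coeff: "\<i> powi (int (Suc a) + int (Suc b) - 1) = - \<i> * (\<i> ^ Suc a * \<i> ^ Suc b)" for a b
  proof -
    have "\<i> powi (int (Suc a + Suc b) - 1) = \<i> powi int (Suc a + Suc b) / \<i> powi 1"
      by (rule power_int_diff) simp
    then have "\<i> powi (int (Suc a + Suc b) - 1) = \<i> ^ (Suc a + Suc b) / \<i>"
      unfolding power_int_of_nat by simp
    then have "\<i> powi (int (Suc a + Suc b) - 1) = - \<i> * (\<i> ^ Suc a * \<i> ^ Suc b)"
      unfolding power_add by (simp del: power_Suc)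
    then show ?thesis unfolding of_nat_add .
  qed
  have "act n (sl2_f (2 * L)) v = (\<Sum>(j1, j2)\<in>ordered_pairs (2 * L).
      act n ((\<i> powi (int j1 + int j2 - 1)) \<cdot>\<^sub>m (ann (2 * L) j1 * ann (2 * L) j2)) v)"
    unfolding sl2_f_def by (subst act_sum_mats) (auto simp: case_prod_beta)
  also have "\<dots> = (\<Sum>a<2 * L. \<Sum>b<2 * L. if a < b then act n ((\<i> powi (int (Suc a) + int (Suc b) - 1))
      \<cdot>\<^sub>m (ann (2 * L) (Suc a) * ann (2 * L) (Suc b))) v else 0)"
    by (rule sum_ordered_pairs)
  also have "\<dots> = (\<Sum>a<2 * L. \<Sum>b<2 * L. fscale (- \<i>) (if a < b then FF (2 * L) a (FF (2 * L) b v) else 0))"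
  proof (intro sum.cong refl)
    fix a b assume "a \<in> {..<2 * L}" "b \<in> {..<2 * L}"
    then have ab: "a < 2 * L" "b < 2 * L" by auto
    have "act n ((- \<i> * (\<i> ^ Suc a * \<i> ^ Suc b)) \<cdot>\<^sub>m (ann (2 * L) (Suc a) * ann (2 * L) (Suc b))) v =
        fscale (- \<i>) (FF (2 * L) a (FF (2 * L) b v))"
      using ab by (simp add: act_smult act_mult act_ann FF_eq annf_fscale del: power_Suc)
    then show "(if a < b then act n ((\<i> powi (int (Suc a) + int (Suc b) - 1))
      \<cdot>\<^sub>m (ann (2 * L) (Suc a) * ann (2 * L) (Suc b))) v else 0) =
      fscale (- \<i>) (if a < b then FF (2 * L) a (FF (2 * L) b v) else 0)"
      unfolding coeff by simp
  qed
  also have "\<dots> = fscale (- \<i>) (f v)" unfolding f_eq_pair_sum fn.scale_sum_right ..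
  finally show ?thesis .
qed

lemma act_sl2_h: "act n (sl2_h (2 * L)) v = fscale (1 / 2) (num v - fscale (of_nat (2 * L) / 2) v)"
proof -
  let ?S = "sum_mats n (\<lambda>j. cre (2 * L) j * ann (2 * L) j) {1..2 * L}"
  have "act n ?S v = (\<Sum>j\<in>{1..2 * L}. act n (cre (2 * L) j * ann (2 * L) j) v)"
    by (rule act_sum_mats) auto
  also have "\<dots> = (\<Sum>j<2 * L. act n (cre (2 * L) (Suc j) * ann (2 * L) (Suc j)) v)"
    by (simp add: sum.atLeast1_atMost_eq)
  also have "\<dots> = num v"
    unfolding num_def
  proof (intro sum.cong refl)
    fix j assume "j \<in> {..<2 * L}"
    then have j: "j < 2 * L" by simp
    have "fscale (- ((- 1) ^ j)) (FFd (2 * L) j (FF (2 * L) j v)) =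
        fscale (- ((- 1) ^ j) * (\<i> ^ Suc j * \<i> ^ Suc j)) (cref j (annf j v))"
      using j by (simp only: FF_eq FFd_eq cref_fscale fn.scale_scale mult.assoc)
    also have "\<dots> = cref j (annf j v)" unfolding i_power_sq by (simp flip: power_add mult_2)
    also have "\<dots> = act n (cre (2 * L) (Suc j) * ann (2 * L) (Suc j)) v"
      using j by (simp add: act_mult act_cre act_ann)
    finally show "act n (cre (2 * L) (Suc j) * ann (2 * L) (Suc j)) v =
      fscale (- ((- 1) ^ j)) (FFd (2 * L) j (FF (2 * L) j v))" ..
  qed
  finally have S: "act n ?S v = num v" .
  let ?I = "(of_nat (2 * L) / 2) \<cdot>\<^sub>m 1\<^sub>m n :: complex mat"
  have I: "?I \<in> carrier_mat n n" by simp
  have "act n (sl2_h (2 * L)) v = fscale (1 / 2) (act n (?S - ?I) v)"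
    unfolding sl2_h_def by (rule act_smult) (rule zero_less_power, simp, rule minus_carrier_mat[OF I])
  also have "act n (?S - ?I) v = act n ?S v - act n ?I v"
    by (rule act_minus[OF _ sum_mats_carrier I]) simp_all
  also have "act n ?I v = fscale (of_nat (2 * L) / 2) v"
    by (subst act_smult) (simp_all add: act_one)
  finally show ?thesis unfolding S .
qed

lemma generated_algebra_carrier:
  assumes "G \<subseteq> carrier_mat m m" "A \<in> generated_algebra m G"
  shows "A \<in> carrier_mat m m"
  using assms(2) by induction (use assms(1) in auto)

lemma rho_carrier: "Y \<in> rho_gl (2 * L) \<Longrightarrow> Y \<in> carrier_mat n n"
  unfolding rho_gl_def by (rule generated_algebra_carrier) (use sl2_carrier in auto)

lemma rho_closed:
  "1\<^sub>m n \<in> rho_gl (2 * L)" "sl2_e (2 * L) \<in> rho_gl (2 * L)" "sl2_f (2 * L) \<in> rho_gl (2 * L)"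
  "sl2_h (2 * L) \<in> rho_gl (2 * L)"
  "Y \<in> rho_gl (2 * L) \<Longrightarrow> Z \<in> rho_gl (2 * L) \<Longrightarrow> Y + Z \<in> rho_gl (2 * L)"
  "Y \<in> rho_gl (2 * L) \<Longrightarrow> c \<cdot>\<^sub>m Y \<in> rho_gl (2 * L)"
  "Y \<in> rho_gl (2 * L) \<Longrightarrow> Z \<in> rho_gl (2 * L) \<Longrightarrow> Y * Z \<in> rho_gl (2 * L)"
  unfolding rho_gl_def
  by (auto intro: generated_algebra.one generated_algebra.add generated_algebra.smult
      generated_algebra.mult generated_algebra.gen)

lemma Alg_act:
  assumes "A \<in> Alg"
  shows "\<exists>Y\<in>rho_gl (2 * L). act n Y = A"
  using assms
proof (induction rule: Alg.induct)
  case ident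
  show ?case by (rule bexI[OF _ rho_closed(1)]) (simp add: act_one fun_eq_iff)
next
  case e
  have "act n (- \<i> \<cdot>\<^sub>m sl2_e (2 * L)) = e"
    by (rule ext) (simp add: act_smult[OF _ sl2_carrier(1)] act_sl2_e)
  then show ?case using rho_closed(2,6) by blast
next
  case f
  have "act n (\<i> \<cdot>\<^sub>m sl2_f (2 * L)) = f"
    by (rule ext) (simp add: act_smult[OF _ sl2_carrier(2)] act_sl2_f)
  then show ?case using rho_closed(3,6) by blast
next
  case num
  have "act n (2 \<cdot>\<^sub>m sl2_h (2 * L) + of_nat L \<cdot>\<^sub>m 1\<^sub>m n) = num"
    by (rule ext) (simp add: act_add act_smult sl2_carrier act_sl2_h act_one)
  then show ?case using rho_closed(1,4,5,6) by blast
next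
  case (add A B)
  then obtain Y Z where YZ: "Y \<in> rho_gl (2 * L)" "act n Y = A" "Z \<in> rho_gl (2 * L)" "act n Z = B"
    by blast
  then have "act n (Y + Z) = (\<lambda>v. A v + B v)"
    by (intro ext) (simp add: act_add rho_carrier)
  moreover have "Y + Z \<in> rho_gl (2 * L)"
    using YZ by (simp add: rho_closed)
  ultimately show ?case by blast
next
  case (smult A c)
  then obtain Y where Y: "Y \<in> rho_gl (2 * L)" "act n Y = A" by blast
  then have "act n (c \<cdot>\<^sub>m Y) = (\<lambda>v. fscale c (A v))"
    by (intro ext) (simp add: act_smult rho_carrier)
  moreover have "c \<cdot>\<^sub>m Y \<in> rho_gl (2 * L)"
    using Y by (simp add: rho_closed)
  ultimately show ?case by blast
next
  case (comp A B)
  then obtain Y Z where YZ: "Y \<in> rho_gl (2 * L)" "act n Y = A" "Z \<in> rho_gl (2 * L)" "act n Z = B"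
    by blast
  then have "act n (Y * Z) = (\<lambda>v. A (B v))"
    by (intro ext) (simp add: act_mult rho_carrier)
  moreover have "Y * Z \<in> rho_gl (2 * L)"
    using YZ by (simp add: rho_closed)
  ultimately show ?case by blast
qed

section \<open>The Fock space is the space of supported functions\<close>

lemma supported_fscale: "v \<in> supported n \<Longrightarrow> fscale c v \<in> supported n"
  and supported_add: "u \<in> supported n \<Longrightarrow> v \<in> supported n \<Longrightarrow> u + v \<in> supported n"
  and supported_zero: "0 \<in> supported n"
  by (simp_all add: supported_def fscale_def)

lemma supported_vacuum: "vacuum \<in> supported n"
proof -
  have "0 < n" by simp
  then have "vacuum s = 0" if "n \<le> s" for s
    using less_le_trans[OF _ that] by (auto simp: vacuum_def)
  then show ?thesis by (simp add: supported_def)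
qed

lemma supported_sum: "(\<And>i. i \<in> I \<Longrightarrow> g i \<in> supported n) \<Longrightarrow> sum g I \<in> supported n"
  by (induction I rule: infinite_finite_induct) (auto simp: supported_zero supported_add)

lemma supported_cr: "v \<in> supported n \<Longrightarrow> cr b i v \<in> supported n"
  unfolding cr_def lincomb_def
  by (intro supported_sum supported_fscale) (simp add: FFd_def act_supported)

lemma Fock_supported:
  assumes "v \<in> Fock"
  shows "v \<in> supported n"
  using assms unfolding Fock_def
proof (induction rule: fn.span_induct)
  case base
  show ?case
    by (rule fn.subspaceI) (simp_all add: supported_zero supported_add supported_fscale)
next
  case (step x)
  then obtain S T where "mon S T x" by blast
  then show ?case
    by (induction rule: mon.induct)
      (auto simp: d_def supported_cr supported_vacuum)
qed

text \<open>Clearing a filled bit gives a smaller index, so the state is created from one already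
  known to lie in \<open>Fock\<close>.\<close>

lemma basis_Fock:
  "s < n \<Longrightarrow> (\<lambda>t. if t = s then 1 else 0) \<in> Fock"
proof (induction s rule: less_induct)
  case (less s)
  show ?case
  proof (cases "s = 0")
    case True
    have "(\<lambda>t. if t = s then 1 else 0) = vacuum" by (auto simp: vacuum_def True)
    then show ?thesis using Fock_vac by simp
  next
    case False
    then obtain m where m: "bit s m" using bit_eq_iff[of s 0] by auto
    define t where "t = unset_bit m s"
    have st: "s = set_bit m t" "\<not> bit t m"
      using set_unset_bit[OF m] by (simp_all add: t_def bit_unset_bit_nat)
    have mN: "m < 2 * L"
    proof (rule ccontr)
      assume "\<not> m < 2 * L"
      then show False using m bit_mod[of s "2 * L" m] less.prems by simp
    qed
    have "t < s" using st by (simp add: set_bit_eq)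
    then have "(\<lambda>r. if r = t then 1 else 0) \<in> Fock" using less by simp
    then have F: "FFd (2 * L) m (\<lambda>r. if r = t then 1 else 0) \<in> Fock"
      by (rule Fock_Fd[OF _ mN])
    have "cref m (\<lambda>r. if r = t then 1 else 0) = fscale (sg m s) (\<lambda>r. if r = s then 1 else 0)"
    proof
      fix r
      have "bit r m \<and> unset_bit m r = t \<longleftrightarrow> r = s"
      proof
        assume "bit r m \<and> unset_bit m r = t"
        then show "r = s" unfolding st(1) using set_unset_bit[of r m] by simp
      next
        assume "r = s"
        then show "bit r m \<and> unset_bit m r = t" using m t_def by simp
      qed
      then show "cref m (\<lambda>r. if r = t then 1 else 0) r = fscale (sg m s) (\<lambda>r. if r = s then 1 else 0) r"
        by (auto simp: cref_def fscale_def)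
    qed
    \<comment> \<open>The Jordan-Wigner sign is its own inverse; only the phase of
      \<open>fd_op\<close> has to be divided out.\<close>
    then have eq: "(\<lambda>r. if r = s then 1 else 0) =
        fscale (sg m s / \<i> ^ Suc m) (FFd (2 * L) m (\<lambda>r. if r = t then 1 else 0))"
      using mN by (simp add: FFd_eq del: power_Suc)
    show ?thesis by (subst eq) (use F in \<open>simp add: Fock_def fn.span_scale\<close>)
  qed
qed

lemma supported_Fock:
  assumes "v \<in> supported n"
  shows "v \<in> Fock"
proof -
  have "v = (\<Sum>s<n. fscale (v s) (\<lambda>t. if t = s then 1 else 0))"
  proof
    fix r
    have "(\<Sum>s\<in>I. fscale (v s) (\<lambda>t. if t = s then 1 else 0)) r =
        (\<Sum>s\<in>I. if s = r then v s else 0)" if "finite I" for I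
      using that by (induction I) (auto simp: fscale_def)
    then have "(\<Sum>s<n. fscale (v s) (\<lambda>t. if t = s then 1 else 0)) r = (\<Sum>s<n. if s = r then v s else 0)"
      by blast
    also have "\<dots> = v r" using assms by (auto simp: supported_def)
    finally show "v r = (\<Sum>s<n. fscale (v s) (\<lambda>t. if t = s then 1 else 0)) r" ..
  qed
  also have "\<dots> \<in> Fock"
    unfolding Fock_def by (intro fn.span_sum fn.span_scale) (use basis_Fock in \<open>auto simp: Fock_def\<close>)
  finally show ?thesis .
qed

text \<open>X acts as an operator commuting with sp, hence on \<open>Fock\<close> as an element of
  \<open>Alg\<close>, which is the action of a matrix Y in \<open>rho_gl\<close>. Since
  \<open>Fock\<close> contains all supported vectors, X = Y.\<close>

lemma commuting_in_rho:
  assumes X: "X \<in> carrier_mat n n"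
    and comm: "\<And>j. j < 2 * L \<Longrightarrow> X * TL_e (2 * L) (Suc j) = TL_e (2 * L) (Suc j) * X"
  shows "X \<in> rho_gl (2 * L)"
proof -
  have "act n X (tl_op j v) = tl_op j (act n X v)" if "j < 2 * L" for j v
  proof -
    let ?T = "TL_e (2 * L) (Suc j)"
    have "act n X (act n ?T v) = act n (X * ?T) v"
      by (rule act_mult[OF _ X TL_e_carrier, symmetric]) simp
    also have "\<dots> = act n (?T * X) v" by (simp only: comm[OF that])
    also have "\<dots> = act n ?T (act n X v)" by (rule act_mult[OF _ TL_e_carrier X]) simp
    finally show ?thesis unfolding act_TL_e[OF that] .
  qed
  then have sp: "sp_comm (act n X)" by (intro sp_comm_of_tl_op hom_act)
  have "act n X v \<in> Fock" if "v \<in> Fock" for v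
    by (rule supported_Fock, rule act_supported, simp, rule Fock_supported[OF that])
  from sp_comm_in_Alg[OF sp this] obtain A where A: "A \<in> Alg" "\<And>v. v \<in> Fock \<Longrightarrow> act n X v = A v"
    by blast
  obtain Y where Y: "Y \<in> rho_gl (2 * L)" "act n Y = A" using Alg_act[OF A(1)] by blast
  have "X = Y"
    using A(2) Y(2) supported_Fock by (intro act_eqI[OF _ X rho_carrier[OF Y(1)]]) auto
  then show ?thesis using Y(1) by simp
qed

lemma mat_commute_of_act:
  assumes "A \<in> carrier_mat n n" "B \<in> carrier_mat n n" "\<And>v. act n A (act n B v) = act n B (act n A v)"
  shows "A * B = B * A"
proof (rule act_eqI[of n])
  show "A * B \<in> carrier_mat n n" "B * A \<in> carrier_mat n n"
    using assms(1,2) by (auto intro: mult_carrier_mat)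
  show "act n (A * B) v = act n (B * A) v" for v
    using assms(3)[of v] by (simp add: act_mult assms(1,2))
qed simp

lemma generated_algebra_commute:
  assumes G: "G \<subseteq> carrier_mat m m" and B: "B \<in> carrier_mat m m"
    and comm: "\<And>A. A \<in> G \<Longrightarrow> A * B = B * A" and A: "A \<in> generated_algebra m G"
  shows "A * B = B * A"
  using A
proof induction
  case one
  then show ?case using B by simp
next
  case (gen A)
  then show ?case by (rule comm)
next
  case (add A C)
  then have "A \<in> carrier_mat m m" "C \<in> carrier_mat m m"
    using generated_algebra_carrier[OF G] by auto
  then show ?case using add B by (simp add: add_mult_distrib_mat mult_add_distrib_mat)
next
  case (smult A a)
  then have "A \<in> carrier_mat m m" using generated_algebra_carrier[OF G] by auto
  then show ?case using smult B by (simp add: mult_smult_distrib mult_smult_assoc_mat)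
next
  case (mult A C)
  then have AC: "A \<in> carrier_mat m m" "C \<in> carrier_mat m m"
    using generated_algebra_carrier[OF G] by auto
  have "A * C * B = A * (B * C)" using assoc_mult_mat[OF AC B] mult by simp
  also have "\<dots> = B * A * C" using assoc_mult_mat[OF AC(1) B AC(2)] mult by simp
  also have "\<dots> = B * (A * C)" by (rule assoc_mult_mat[OF B AC])
  finally show ?case .
qed

lemma translation_commutes:
  assumes t: "is_translation2 (2 * L) U V"
    and A: "A \<in> {sl2_e (2 * L), sl2_f (2 * L), sl2_h (2 * L)}"
  shows "A * U = U * A" "A * V = V * A"
proof -
  have U: "U \<in> carrier_mat n n" and V: "V \<in> carrier_mat n n"
    and UV: "U * V = 1\<^sub>m n" and VU: "V * U = 1\<^sub>m n"
    using t by (auto simp: is_translation2_def inverts_mat_def)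
  \<comment> \<open>Multiplying U B V = C by U on the right turns the conjugation rules into
    intertwining relations for the actions.\<close>
  have conj: "act n U (act n B v) = act n C (act n U v)"
    if "U * B * V = C" "B \<in> carrier_mat n n" for B C v
  proof -
    have UB: "U * B \<in> carrier_mat n n" by (rule mult_carrier_mat[OF U that(2)])
    have "C * U = U * B * (V * U)"
      unfolding that(1)[symmetric] by (rule assoc_mult_mat[OF UB V U])
    then have "C * U = U * B" unfolding VU using right_mult_one_mat[OF UB] by simp
    moreover have "C \<in> carrier_mat n n"
      unfolding that(1)[symmetric] by (rule mult_carrier_mat[OF UB V])
    ultimately show ?thesis
      using act_mult[OF _ U that(2), of v] act_mult[OF _ _ U, of C v] by simp
  qed
  have U_Fd: "act n U (FFd (2 * L) j v) = (if j + 2 < 2 * L then FFd (2 * L) (j + 2) (act n U v)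
      else - FFd (2 * L) (j + 2 - 2 * L) (act n U v))" if "j < 2 * L" for j v
  proof (cases "j + 2 < 2 * L")
    case True
    then have "U * fd_op (2 * L) (Suc j) * V = fd_op (2 * L) (Suc (j + 2))"
      using t by (simp add: is_translation2_def)
    from conj[OF this] show ?thesis using True by (simp add: FFd_def)
  next
    case False
    then have "U * fd_op (2 * L) (Suc j) * V = - fd_op (2 * L) (Suc (j + 2 - 2 * L))"
      using t that by (simp add: is_translation2_def Suc_diff_le)
    from conj[OF this] show ?thesis using False by (simp add: FFd_def act_uminus)
  qed
  have U_F: "act n U (FF (2 * L) j v) = (if j + 2 < 2 * L then FF (2 * L) (j + 2) (act n U v)
      else - FF (2 * L) (j + 2 - 2 * L) (act n U v))" if "j < 2 * L" for j v
  proof (cases "j + 2 < 2 * L")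
    case True
    then have "U * f_op (2 * L) (Suc j) * V = f_op (2 * L) (Suc (j + 2))"
      using t by (simp add: is_translation2_def)
    from conj[OF this] show ?thesis using True by (simp add: FF_def)
  next
    case False
    then have "U * f_op (2 * L) (Suc j) * V = - f_op (2 * L) (Suc (j + 2 - 2 * L))"
      using t that by (simp add: is_translation2_def Suc_diff_le)
    from conj[OF this] show ?thesis using False by (simp add: FF_def act_uminus)
  qed
  note comm = U_e[OF hom_act U_Fd U_F] U_f[OF hom_act U_Fd U_F] U_num[OF hom_act U_Fd U_F]
  have Ac: "A \<in> carrier_mat n n" using A sl2_carrier by auto
  have "act n A (act n U v) = act n U (act n A v)" for v
    using A by (auto simp: act_sl2_e act_sl2_f act_sl2_h comm module_hom.scale[OF hom_act]
      module_hom.diff[OF hom_act] module_hom.neg[OF hom_act])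
  then show AU: "A * U = U * A" by (intro mat_commute_of_act Ac U)
  have AV: "A * V \<in> carrier_mat n n" and UA: "U * A \<in> carrier_mat n n"
    and VA: "V * A \<in> carrier_mat n n"
    by (rule mult_carrier_mat[OF Ac V] mult_carrier_mat[OF U Ac] mult_carrier_mat[OF V Ac])+
  \<comment> \<open>The inverse follows by inserting V U = 1 on the left and moving U past
    A.\<close>
  have "A * V = V * U * (A * V)" unfolding VU using left_mult_one_mat[OF AV] by simp
  also have "\<dots> = V * (U * (A * V))" by (rule assoc_mult_mat[OF V U AV])
  also have "U * (A * V) = A * U * V"
    unfolding AU by (rule assoc_mult_mat[OF U Ac V, symmetric])
  also have "\<dots> = A * (U * V)" by (rule assoc_mult_mat[OF Ac U V])
  also have "V * \<dots> = V * A" unfolding UV using right_mult_one_mat[OF Ac] by simp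
  finally show "A * V = V * A" .
qed

lemma TL_commutes:
  assumes j: "j < 2 * L" and A: "A \<in> {sl2_e (2 * L), sl2_f (2 * L), sl2_h (2 * L)}"
  shows "A * TL_e (2 * L) (Suc j) = TL_e (2 * L) (Suc j) * A"
proof (rule mat_commute_of_act)
  fix v
  have tl_op: "tl_op j (fscale c v) = fscale c (tl_op j v)" "tl_op j (u - v) = tl_op j u - tl_op j v" "tl_op j (- v) = - tl_op j v"
    for c u v
    by (simp_all add: tl_op_def module_hom.neg[OF hom_CR] module_hom.neg[OF hom_AN] module_hom.scale[OF hom_CR] module_hom.scale[OF hom_AN]
      module_hom.diff[OF hom_CR] module_hom.diff[OF hom_AN])
  show "act n A (act n (TL_e (2 * L) (Suc j)) v) = act n (TL_e (2 * L) (Suc j)) (act n A v)"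
    using A tl_op_of_sp_comm[OF sp_comm_e j] tl_op_of_sp_comm[OF sp_comm_f j] tl_op_of_sp_comm[OF sp_comm_num j]
    by (auto simp: act_TL_e[OF j] act_sl2_e act_sl2_f act_sl2_h tl_op)
qed (use A sl2_carrier TL_e_carrier in auto)

theorem centralizer_JTL_image:
  assumes t: "is_translation2 (2 * L) U V"
  shows "centralizer_mat n (JTL_image (2 * L) U V) = rho_gl (2 * L)"
proof
  let ?G = "TL_e (2 * L) ` {1..2 * L} \<union> {U, V}"
  let ?S = "{sl2_e (2 * L), sl2_f (2 * L), sl2_h (2 * L)}"
  have UV: "U \<in> carrier_mat n n" "V \<in> carrier_mat n n" using t by (auto simp: is_translation2_def)
  have G: "?G \<subseteq> carrier_mat n n" using UV TL_e_carrier by auto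
  have S: "?S \<subseteq> carrier_mat n n" using sl2_carrier by auto
  show "centralizer_mat n (JTL_image (2 * L) U V) \<subseteq> rho_gl (2 * L)"
  proof
    fix X assume "X \<in> centralizer_mat n (JTL_image (2 * L) U V)"
    then have X: "X \<in> carrier_mat n n" "\<And>A. A \<in> JTL_image (2 * L) U V \<Longrightarrow> X * A = A * X"
      by (auto simp: centralizer_mat_def)
    have "TL_e (2 * L) (Suc j) \<in> JTL_image (2 * L) U V" if "j < 2 * L" for j
      unfolding JTL_image_def by (rule generated_algebra.gen) (use that in auto)
    then show "X \<in> rho_gl (2 * L)" by (intro commuting_in_rho X)
  qed
  show "rho_gl (2 * L) \<subseteq> centralizer_mat n (JTL_image (2 * L) U V)"
  proof
    fix X assume X: "X \<in> rho_gl (2 * L)"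
    have gens: "A * B = B * A" if "A \<in> ?S" "B \<in> ?G" for A B
    proof -
      from that(2) consider j where "j < 2 * L" "B = TL_e (2 * L) (Suc j)" | "B = U" | "B = V"
        by (auto simp: image_iff) (metis Suc_le_D Suc_le_lessD)
      then show ?thesis using TL_commutes that(1) translation_commutes[OF t that(1)] by cases auto
    qed
    \<comment> \<open>Commutation spreads from the generators in two passes: over
      \<open>rho_gl\<close> with a chain generator B fixed, then over the chain algebra with X
      fixed.\<close>
    have XB: "X * B = B * X" if "B \<in> ?G" for B
    proof (rule generated_algebra_commute[OF S])
      show "B \<in> carrier_mat n n" using that G by blast
      show "A * B = B * A" if "A \<in> ?S" for A using gens[OF that \<open>B \<in> ?G\<close>] .
      show "X \<in> generated_algebra n ?S" using X by (simp add: rho_gl_def)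
    qed
    have "A * X = X * A" if "A \<in> generated_algebra n ?G" for A
      by (rule generated_algebra_commute[OF G rho_carrier[OF X] _ that]) (use XB in auto)
    then show "X \<in> centralizer_mat n (JTL_image (2 * L) U V)"
      using rho_carrier[OF X] by (auto simp: centralizer_mat_def JTL_image_def)
  qed
qed

end

theorem theorem3p4p1:
  fixes L N :: nat and U V :: "complex mat"
  assumes "L \<ge> 1" and "N = 2 * L"
    and "is_translation2 N U V"
  shows "centralizer_mat (2 ^ N) (JTL_image N U V) = rho_gl N"
proof -
  interpret spin_chain L by unfold_locales (use assms in simp)
  show ?thesis using centralizer_JTL_image assms by simp
qed

end
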